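(* Let $n \geq 3$ and let $m$ be a positive integer with $m < n$. Then every homomorphism $\mathrm{Aut}(F_n) \to \mathrm{Aut}(F_m)$ is either trivial or has image of order $2$. Likewise, every homomorphism $\mathrm{Aut}(F_n) \to \mathrm{Out}(F_m)$ is either trivial or has image of order $2$, and every homomorphism $\mathrm{Aut}(F_n) \to \mathrm{GL}(m,\mathbb{Z})$ is either trivial or has image of order $2$.
   Context: $F_k$ denotes the free group of rank $k$; $\mathrm{Aut}(F_k)$ is its automorphism group, and $\mathrm{Out}(F_k)$ is the quotient of $\mathrm{Aut}(F_k)$ by the subgroup of inner automorphisms. *)

theory Defs
  imports "HOL-Algebra.Algebra" "Jordan_Normal_Form.Matrix"
begin

section \<open>Free groups\<close>

text \<open>A letter \<open>(a, True)\<close> stands for the generator \<open>a\<close> and \<open>(a, False)\<close> for its inverse.\<close>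

definition inv_letter :: "'a \<times> bool \<Rightarrow> 'a \<times> bool" where
  "inv_letter x = (fst x, \<not> snd x)"

definition reduced :: "('a \<times> bool) list \<Rightarrow> bool" where
  "reduced w \<longleftrightarrow> successively (\<lambda>x y. y \<noteq> inv_letter x) w"

fun cancel_cons :: "'a \<times> bool \<Rightarrow> ('a \<times> bool) list \<Rightarrow> ('a \<times> bool) list" where
  "cancel_cons x [] = [x]"
| "cancel_cons x (y # ys) = (if y = inv_letter x then ys else x # y # ys)"

definition reduce :: "('a \<times> bool) list \<Rightarrow> ('a \<times> bool) list" where
  "reduce w = foldr cancel_cons w []"

definition free_group :: "'a set \<Rightarrow> ('a \<times> bool) list monoid" where
  "free_group S =
    \<lparr>carrier = {w. reduced w \<and> fst ` set w \<subseteq> S},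
     monoid.mult = \<lambda>u v. reduce (u @ v),
     one = []\<rparr>"

abbreviation free_group_rank :: "nat \<Rightarrow> (nat \<times> bool) list monoid" where
  "free_group_rank k \<equiv> free_group {..<k}"

lemma inv_letter_inv_letter [simp]: "inv_letter (inv_letter x) = x"
  by (simp add: inv_letter_def)

lemma fst_inv_letter [simp]: "fst (inv_letter x) = fst x"
  by (simp add: inv_letter_def)

lemma reduced_Nil [simp]: "reduced []"
  by (simp add: reduced_def)

lemma reduced_ConsD: "reduced (x # w) \<Longrightarrow> reduced w"
  by (cases w) (auto simp: reduced_def)

lemma reduced_cancel_cons: "reduced w \<Longrightarrow> reduced (cancel_cons x w)"
  by (cases w) (auto simp: reduced_def successively_Cons)

lemma reduced_reduce [simp]: "reduced (reduce w)"
  by (induction w) (auto simp: reduce_def reduced_cancel_cons)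

lemma cancel_cons_eq_Cons: "reduced (x # w) \<Longrightarrow> cancel_cons x w = x # w"
  by (cases w) (auto simp: reduced_def)

lemma reduce_reduced: "reduced w \<Longrightarrow> reduce w = w"
proof (induction w)
  case (Cons x w)
  then have "reduce w = w" by (blast dest: reduced_ConsD)
  then show ?case using Cons.prems by (simp add: reduce_def cancel_cons_eq_Cons)
qed (simp add: reduce_def)

lemma cancel_cons_inv_letter:
  assumes "reduced w"
  shows "cancel_cons (inv_letter x) (cancel_cons x w) = w"
proof (cases w)
  case (Cons y ys)
  show ?thesis
  proof (cases "y = inv_letter x")
    case True
    then show ?thesis using assms Cons by (simp add: cancel_cons_eq_Cons)
  qed (simp add: Cons)
qed simp

lemma reduced_foldr_cancel_cons: "reduced v \<Longrightarrow> reduced (foldr cancel_cons u v)"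
  by (induction u) (auto simp: reduced_cancel_cons)

lemma foldr_cancel_cons_cancel_cons:
  assumes "reduced v"
  shows "foldr cancel_cons (cancel_cons x u) v = cancel_cons x (foldr cancel_cons u v)"
proof (cases u)
  case (Cons y ys)
  have *: "reduced (foldr cancel_cons ys v)"
    using assms by (rule reduced_foldr_cancel_cons)
  show ?thesis
    using cancel_cons_inv_letter[OF *, of "inv_letter x"] by (simp add: Cons)
qed simp

lemma foldr_cancel_cons_reduce:
  "reduced v \<Longrightarrow> foldr cancel_cons (reduce u) v = foldr cancel_cons u v"
  by (induction u) (simp_all add: reduce_def foldr_cancel_cons_cancel_cons)

lemma reduce_append: "reduce (u @ v) = foldr cancel_cons u (reduce v)"
  by (simp add: reduce_def)

lemma reduce_append_reduce1: "reduce (reduce u @ v) = reduce (u @ v)"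
  by (simp add: reduce_append foldr_cancel_cons_reduce)

lemma reduce_append_reduce2: "reduce (u @ reduce v) = reduce (u @ v)"
  by (simp add: reduce_append reduce_reduced)

lemma set_cancel_cons: "set (cancel_cons x w) \<subseteq> insert x (set w)"
  by (cases w) auto

lemma set_reduce: "set (reduce w) \<subseteq> set w"
proof (induction w)
  case (Cons x w)
  have "reduce (x # w) = cancel_cons x (reduce w)" by (simp add: reduce_def)
  then show ?case using Cons set_cancel_cons[of x "reduce w"] by auto
qed (simp add: reduce_def)

lemma reduce_inverse_append: "reduce (rev (map inv_letter w) @ w) = []"
proof (induction w)
  case (Cons x w)
  have "reduce (rev (map inv_letter (x # w)) @ x # w) =
    foldr cancel_cons (rev (map inv_letter w))
      (cancel_cons (inv_letter x) (cancel_cons x (reduce w)))"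
    by (simp add: reduce_def)
  also have "\<dots> = reduce (rev (map inv_letter w) @ w)"
    by (simp add: cancel_cons_inv_letter reduce_append)
  finally show ?case using Cons.IH by simp
qed (simp add: reduce_def)

lemma group_free_group: "group (free_group S)"
proof (rule groupI)
  fix u v assume "u \<in> carrier (free_group S)" "v \<in> carrier (free_group S)"
  then show "u \<otimes>\<^bsub>free_group S\<^esub> v \<in> carrier (free_group S)"
    using set_reduce[of "u @ v"] by (fastforce simp: free_group_def)
next
  fix u assume u: "u \<in> carrier (free_group S)"
  let ?u' = "reduce (rev (map inv_letter u))"
  have "?u' \<in> carrier (free_group S)"
    using u set_reduce[of "rev (map inv_letter u)"] by (fastforce simp: free_group_def)
  moreover have "?u' \<otimes>\<^bsub>free_group S\<^esub> u = \<one>\<^bsub>free_group S\<^esub>"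
    by (simp add: free_group_def reduce_append_reduce1 reduce_inverse_append)
  ultimately show "\<exists>v\<in>carrier (free_group S). v \<otimes>\<^bsub>free_group S\<^esub> u = \<one>\<^bsub>free_group S\<^esub>"
    by blast
qed (auto simp: free_group_def reduce_append_reduce1 reduce_append_reduce2 reduce_reduced)


subsection \<open>Universal property\<close>

definition letter_eval :: "('b, 'c) monoid_scheme \<Rightarrow> ('a \<Rightarrow> 'b) \<Rightarrow> 'a \<times> bool \<Rightarrow> 'b" where
  "letter_eval H f x = (if snd x then f (fst x) else inv\<^bsub>H\<^esub> f (fst x))"

definition word_eval :: "('b, 'c) monoid_scheme \<Rightarrow> ('a \<Rightarrow> 'b) \<Rightarrow> ('a \<times> bool) list \<Rightarrow> 'b" where
  "word_eval H f w = foldr (\<lambda>x y. letter_eval H f x \<otimes>\<^bsub>H\<^esub> y) w \<one>\<^bsub>H\<^esub>"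

lemma word_eval_simps [simp]:
  "word_eval H f [] = \<one>\<^bsub>H\<^esub>"
  "word_eval H f (x # w) = letter_eval H f x \<otimes>\<^bsub>H\<^esub> word_eval H f w"
  by (simp_all add: word_eval_def)

context group
begin

lemma letter_eval_closed:
  "f \<in> S \<rightarrow> carrier G \<Longrightarrow> fst x \<in> S \<Longrightarrow> letter_eval G f x \<in> carrier G"
  by (auto simp: letter_eval_def)

lemma word_eval_closed:
  "f \<in> S \<rightarrow> carrier G \<Longrightarrow> fst ` set w \<subseteq> S \<Longrightarrow> word_eval G f w \<in> carrier G"
  by (induction w) (auto intro!: m_closed letter_eval_closed[of f S])

lemma word_eval_append:
  assumes "f \<in> S \<rightarrow> carrier G" "fst ` set u \<subseteq> S" "fst ` set v \<subseteq> S"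
  shows "word_eval G f (u @ v) = word_eval G f u \<otimes> word_eval G f v"
  using assms by (induction u) (auto simp: m_assoc letter_eval_closed word_eval_closed)

lemma letter_eval_inv_letter:
  "f \<in> S \<rightarrow> carrier G \<Longrightarrow> fst x \<in> S \<Longrightarrow> letter_eval G f (inv_letter x) = inv (letter_eval G f x)"
  by (auto simp: letter_eval_def inv_letter_def Pi_iff)

lemma word_eval_cancel_cons:
  assumes f: "f \<in> S \<rightarrow> carrier G" and x: "fst x \<in> S" and w: "fst ` set w \<subseteq> S"
  shows "word_eval G f (cancel_cons x w) = letter_eval G f x \<otimes> word_eval G f w"
proof (cases w)
  case (Cons y ys)
  have "letter_eval G f x \<in> carrier G" "word_eval G f ys \<in> carrier G"
    using f x w Cons by (auto intro: letter_eval_closed word_eval_closed)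
  then show ?thesis
    using Cons by (auto simp: letter_eval_inv_letter[OF f x] m_assoc[symmetric])
qed simp

lemma word_eval_reduce:
  assumes f: "f \<in> S \<rightarrow> carrier G" and w: "fst ` set w \<subseteq> S"
  shows "word_eval G f (reduce w) = word_eval G f w"
  using w
proof (induction w)
  case (Cons x w)
  have "fst ` set (reduce w) \<subseteq> S" using Cons.prems set_reduce[of w] by auto
  then have "word_eval G f (cancel_cons x (reduce w)) = letter_eval G f x \<otimes> word_eval G f (reduce w)"
    using Cons.prems by (intro word_eval_cancel_cons[OF f]) auto
  moreover have "reduce (x # w) = cancel_cons x (reduce w)" by (simp add: reduce_def)
  ultimately show ?case using Cons by simp
qed (simp add: reduce_def)

lemma word_eval_hom:
  assumes "f \<in> S \<rightarrow> carrier G"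
  shows "word_eval G f \<in> hom (free_group S) G"
proof (rule homI)
  fix u v assume "u \<in> carrier (free_group S)" "v \<in> carrier (free_group S)"
  then have "fst ` set u \<subseteq> S" "fst ` set v \<subseteq> S" by (auto simp: free_group_def)
  moreover from this have "fst ` set (u @ v) \<subseteq> S" by auto
  ultimately show "word_eval G f (u \<otimes>\<^bsub>free_group S\<^esub> v) = word_eval G f u \<otimes> word_eval G f v"
    using word_eval_reduce[OF assms] word_eval_append[OF assms] by (simp add: free_group_def)
next
  fix u assume "u \<in> carrier (free_group S)"
  then show "word_eval G f u \<in> carrier G"
    using word_eval_closed[OF assms] by (simp add: free_group_def)
qed

lemma word_eval_generator:
  "f \<in> S \<rightarrow> carrier G \<Longrightarrow> s \<in> S \<Longrightarrow> word_eval G f [(s, True)] = f s"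
  by (auto simp: letter_eval_def Pi_iff)

lemma hom_free_group_eq_word_eval:
  assumes h: "h \<in> hom (free_group S) G" and f: "\<And>s. s \<in> S \<Longrightarrow> h [(s, True)] = f s"
    and w: "w \<in> carrier (free_group S)"
  shows "h w = word_eval G f w"
proof -
  interpret F: group "free_group S" by (rule group_free_group)
  interpret h: group_hom "free_group S" G h
    using h by unfold_locales
  have letter: "[x] \<in> carrier (free_group S)" if "fst x \<in> S" for x
    using that by (auto simp: free_group_def reduced_def)
  have eval_letter: "h [x] = letter_eval G f x" if "fst x \<in> S" for x
  proof (cases "snd x")
    case True
    then show ?thesis using f[OF that] by (cases x) (simp add: letter_eval_def)
  next
    case False
    have "[x] \<otimes>\<^bsub>free_group S\<^esub> [inv_letter x] = \<one>\<^bsub>free_group S\<^esub>"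
      by (simp add: free_group_def reduce_def)
    then have "[x] = inv\<^bsub>free_group S\<^esub> [inv_letter x]"
      using that by (intro F.inv_equality[symmetric] letter) auto
    then have "h [x] = inv (h [inv_letter x])"
      using that letter[of "inv_letter x"] by (metis fst_inv_letter h.hom_inv)
    moreover have "inv_letter x = (fst x, True)"
      using False by (simp add: inv_letter_def)
    ultimately show ?thesis
      using False f[OF that] by (simp add: letter_eval_def)
  qed
  show ?thesis using w
  proof (induction w)
    case Nil
    then show ?case using h.hom_one by (simp add: free_group_def)
  next
    case (Cons x w)
    then have x: "fst x \<in> S" and w: "w \<in> carrier (free_group S)"
      by (auto simp: free_group_def dest: reduced_ConsD)
    have "x # w = [x] \<otimes>\<^bsub>free_group S\<^esub> w"
      using Cons.prems by (simp add: free_group_def reduce_reduced)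
    then have "h (x # w) = h [x] \<otimes> h w"
      using letter[OF x] w by (metis h.hom_mult)
    then show ?case using Cons.IH[OF w] eval_letter[OF x] by simp
  qed
qed

end


section \<open>Inner and outer automorphisms\<close>

definition inner_autos :: "('a, 'b) monoid_scheme \<Rightarrow> ('a \<Rightarrow> 'a) set" where
  "inner_autos G = (\<lambda>g. \<lambda>x\<in>carrier G. g \<otimes>\<^bsub>G\<^esub> x \<otimes>\<^bsub>G\<^esub> inv\<^bsub>G\<^esub> g) ` carrier G"

definition OutGroup :: "('a, 'b) monoid_scheme \<Rightarrow> ('a \<Rightarrow> 'a) set monoid" where
  "OutGroup G = AutoGroup G Mod inner_autos G"

context group
begin

lemma inner_autos_group_hom:
  "group_hom G (AutoGroup G) (\<lambda>g. \<lambda>x\<in>carrier G. g \<otimes> x \<otimes> inv g)"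
proof -
  let ?c = "\<lambda>g. \<lambda>x\<in>carrier G. g \<otimes> x \<otimes> inv g"
  have bij: "?c g \<in> Bij (carrier G)" if "g \<in> carrier G" for g
    using conjugation_is_bij[OF that] that by (simp add: Bij_def bij_betw_restrict_eq)
  have auto: "?c g \<in> auto G" if g: "g \<in> carrier G" for g
  proof -
    have "g \<otimes> (x \<otimes> y) \<otimes> inv g = g \<otimes> x \<otimes> inv g \<otimes> (g \<otimes> y \<otimes> inv g)"
      if "x \<in> carrier G" "y \<in> carrier G" for x y
    proof -
      have "inv g \<otimes> (g \<otimes> (y \<otimes> inv g)) = y \<otimes> inv g"
        using g that by (simp add: m_assoc[symmetric])
      then show ?thesis using g that by (simp add: m_assoc)
    qed
    then have "?c g \<in> hom G G" using g by (intro homI) auto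
    then show ?thesis using bij[OF g] by (simp add: auto_def)
  qed
  have "?c \<in> hom G (AutoGroup G)"
    using auto bij
    by (auto intro!: homI ext
        simp: AutoGroup_def BijGroup_def compose_def restrict_def m_assoc inv_mult_group)
  then show ?thesis
    by (intro group_hom.intro group_hom_axioms.intro is_group AutoGroup)
qed

lemma inner_autos_normal: "inner_autos G \<lhd> AutoGroup G"
proof -
  let ?c = "\<lambda>g. \<lambda>x\<in>carrier G. g \<otimes> x \<otimes> inv g"
  interpret A: group "AutoGroup G" by (rule AutoGroup)
  interpret c: group_hom G "AutoGroup G" ?c by (rule inner_autos_group_hom)
  show ?thesis
  proof (rule A.normal_invI)
    show "subgroup (inner_autos G) (AutoGroup G)"
      unfolding inner_autos_def by (rule c.img_is_subgroup)
  next
    fix a i assume a: "a \<in> carrier (AutoGroup G)" and "i \<in> inner_autos G"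
    then obtain g where g: "g \<in> carrier G" and i: "i = ?c g"
      by (auto simp: inner_autos_def)
    have ahom: "a \<in> hom G G" and abij: "a \<in> Bij (carrier G)"
      using a by (auto simp: AutoGroup_def auto_def)
    interpret a: group_hom G G a using ahom by unfold_locales
    have cg: "?c g \<in> Bij (carrier G)" and cag: "?c (a g) \<in> Bij (carrier G)"
      using c.hom_closed[OF g] c.hom_closed[OF a.hom_closed[OF g]]
      by (auto simp: AutoGroup_def auto_def)
    have "compose (carrier G) a (?c g) = compose (carrier G) (?c (a g)) a"
      using g by (auto simp: compose_def fun_eq_iff)
    then have "a \<otimes>\<^bsub>AutoGroup G\<^esub> i = ?c (a g) \<otimes>\<^bsub>AutoGroup G\<^esub> a"
      using abij cg cag by (simp add: i AutoGroup_def BijGroup_def)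
    then have "a \<otimes>\<^bsub>AutoGroup G\<^esub> i \<otimes>\<^bsub>AutoGroup G\<^esub> inv\<^bsub>AutoGroup G\<^esub> a = ?c (a g)"
      using a c.hom_closed[OF a.hom_closed[OF g]]
      by (simp only: A.m_assoc A.inv_closed A.r_inv A.r_one)
    then show "a \<otimes>\<^bsub>AutoGroup G\<^esub> i \<otimes>\<^bsub>AutoGroup G\<^esub> inv\<^bsub>AutoGroup G\<^esub> a \<in> inner_autos G"
      using g by (auto simp: inner_autos_def)
  qed
qed

lemma group_OutGroup: "group (OutGroup G)"
  unfolding OutGroup_def by (rule normal.factorgroup_is_group[OF inner_autos_normal])

end


section \<open>Integral general linear groups\<close>

abbreviation GL_int :: "nat \<Rightarrow> int mat monoid" where
  "GL_int m \<equiv> units_of (ring_mat TYPE(int) m ())"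

lemma group_GL_int: "group (GL_int m)"
  by (rule monoid.units_group[OF ring.is_monoid[OF ring_mat]])



section \<open>Trivial homomorphisms\<close>

definition trivial_hom ::
  "('a, 'c) monoid_scheme \<Rightarrow> ('b, 'd) monoid_scheme \<Rightarrow> ('a \<Rightarrow> 'b) \<Rightarrow> bool" where
  "trivial_hom G H h \<longleftrightarrow> (\<forall>x\<in>carrier G. h x = \<one>\<^bsub>H\<^esub>)"

end

theory Submission
  imports Defs "Jordan_Normal_Form.Char_Poly" "HOL-Library.Nat_Bijection"
begin

text \<open>
  It suffices to kill all transvections \<open>x\<^sub>i \<mapsto> x\<^sub>j x\<^sub>i\<close>: by Nielsen's theorem they generate \<open>Aut(F\<^sub>n)\<close>
  together with the inversions \<open>x\<^sub>i \<mapsto> x\<^sub>i\<inverse>\<close>, which are conjugate modulo the transvections.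

  For \<open>GL(m,\<int>)\<close> with \<open>m < n\<close>, the \<open>n\<close> commuting inversions have a common eigenvector. If two of them acted
  differently, permuting the generators would give common eigenvectors with at least \<open>n\<close> different sign
  patterns, and these are linearly independent. So all inversions act alike, and then the transvections at a fixed \<open>x\<^sub>i\<close>
  act as \<open>n - 1\<close> commuting involutions. Conjugating by the other transvections again produces \<open>n\<close> sign
  patterns unless these involutions are trivial.

  For \<open>Aut(F\<^sub>m)\<close> and \<open>Out(F\<^sub>m)\<close>, it follows that the transvections act trivially on homology. Automorphisms
  with this property are unipotent on the functions on \<open>F\<^sub>m\<close> killed by \<open>k\<close>-fold differences, and since every
  transvection is a commutator of transvections and their inverses, their images act on these functions
  trivially (for \<open>Out\<close>: as inner automorphisms) for every \<open>k\<close>. Coefficients of the Magnus expansion are such functions and separate points,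
  which settles \<open>Aut(F\<^sub>m)\<close>. Sums of coefficients over cyclic rotations are such functions and are
  invariant under conjugation; an automorphism preserving all of them is inner.
\<close>

text \<open>The kernel of the action on homology is large, so triviality on homology alone does not
  finish the cases of Aut and Out; perfectness does. If two operators lower degree by j + 1, their
  commutator lowers it by 2j + 2, so a set whose members are all commutators of members sinks
  through every level of the filtration. Polynomial functions play the role of the lower central
  series, and residual nilpotence becomes the statement that Magnus coefficients separate words.
  Working modulo squares makes 1 - Y the inverse of 1 + Y, so that each coefficient is a short
  recursion over the word. The price is that only index words without equal neighbours are
  admissible; they suffice because the syllables of a reduced word form such an index. In Out the
  unipotent representative of a coset may change from level to level. Functions invariant under
  conjugation are indifferent to that choice. Rank at least three supplies a third index: it makes
  transvections commutators, and it gives an inversion commuting with a given transvection.\<close>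

section \<open>The Magnus expansion\<close>

text \<open>\<open>magnus v w\<close> is the coefficient of the monomial \<open>v\<close> in the image of \<open>w\<close> under the Magnus-type map
  \<open>x\<^sub>i \<mapsto> 1 + Y\<^sub>i\<close>, \<open>x\<^sub>i\<inverse> \<mapsto> 1 - Y\<^sub>i\<close> into integral noncommutative power series modulo all \<open>Y\<^sub>i\<^sup>2\<close>.
  It is invariant under reduction only if \<open>v\<close> has no two equal adjacent letters.\<close>

fun magnus :: "'a list \<Rightarrow> ('a \<times> bool) list \<Rightarrow> int" where
  "magnus v [] = (if v = [] then 1 else 0)"
| "magnus v (x # w) = magnus v w +
    (case v of [] \<Rightarrow> 0 | y # v' \<Rightarrow>
      if y = fst x then (if snd x then 1 else -1) * magnus v' w else 0)"

lemma magnus_Nil [simp]: "magnus [] w = 1"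
  by (induction w) auto

text \<open>Multiplicativity of the expansion, read off one coefficient: the Cauchy product of
  noncommutative series.\<close>

lemma magnus_append:
  "magnus v (u @ w) = (\<Sum>i\<le>length v. magnus (take i v) u * magnus (drop i v) w)"
proof (induction u arbitrary: v)
  case Nil
  have "(\<Sum>i\<le>length v. magnus (take i v) [] * magnus (drop i v) w) =
        (\<Sum>i\<in>{0}. magnus (take i v) [] * magnus (drop i v) w)"
    by (rule sum.mono_neutral_right) auto
  then show ?case by simp
next
  case (Cons x u)
  show ?case
  proof (cases v)
    case v: (Cons y v')
    let ?s = "(if snd x then 1 else -1) :: int"
    have "(\<Sum>i\<le>length v. magnus (take i v) (x # u) * magnus (drop i v) w) =
        magnus v w + (\<Sum>i\<le>length v'. (magnus (y # take i v') u +
          (if y = fst x then ?s * magnus (take i v') u else 0)) * magnus (drop i v') w)"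
      unfolding v list.size add_Suc_right add_0_right sum.atMost_Suc_shift by simp
    also have "\<dots> = magnus v w + (\<Sum>i\<le>length v'. magnus (y # take i v') u * magnus (drop i v') w) +
        (if y = fst x then ?s * magnus v' (u @ w) else 0)"
      by (auto simp: Cons.IH algebra_simps sum.distrib sum_distrib_left)
    also have "magnus v w + (\<Sum>i\<le>length v'. magnus (y # take i v') u * magnus (drop i v') w)
        = magnus v (u @ w)"
      unfolding Cons.IH unfolding v list.size add_Suc_right add_0_right sum.atMost_Suc_shift by simp
    finally show ?thesis by (simp add: v)
  qed simp
qed

text \<open>(1 + Y)(1 - Y) = 1 - Y^2, and Y^2 cannot contribute to a monomial without equal
  neighbours.\<close>

lemma magnus_cancel:
  "distinct_adj v \<Longrightarrow> magnus v (x # inv_letter x # w) = magnus v w"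
  by (auto simp: inv_letter_def split: list.splits)

lemma magnus_cancel_cons:
  assumes "distinct_adj v"
  shows "magnus v (cancel_cons x w) = magnus v (x # w)"
proof (cases w)
  case (Cons y ys)
  show ?thesis
  proof (cases "y = inv_letter x")
    case True
    then have "cancel_cons x w = ys" "x # w = x # inv_letter x # ys" using Cons by auto
    then show ?thesis using magnus_cancel[OF assms, of x ys] by simp
  qed (simp add: Cons)
qed simp

lemma magnus_reduce: "distinct_adj v \<Longrightarrow> magnus v (reduce w) = magnus v w"
proof (induction w arbitrary: v)
  case (Cons x w)
  have "reduce (x # w) = cancel_cons x (reduce w)" by (simp add: reduce_def)
  then have "magnus v (reduce (x # w)) = magnus v (x # reduce w)"
    using Cons.prems by (simp add: magnus_cancel_cons)
  also have "\<dots> = magnus v (x # w)"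
    using Cons.prems Cons.IH by (auto split: list.splits dest: distinct_adj_ConsD)
  finally show ?case .
qed (simp add: reduce_def)

definition syllables :: "('a \<times> bool) list \<Rightarrow> 'a list" where
  "syllables w = remdups_adj (map fst w)"

text \<open>Modulo Y^2 the power (1 + sY)^e, with s the sign of the letter, is 1 + seY. A maximal
  power in a word thus enters through its exponent.\<close>

lemma magnus_replicate:
  assumes "distinct_adj v"
  shows "magnus v (replicate e (y, s) @ r) = magnus v r +
    (case v of [] \<Rightarrow> 0 | z # v' \<Rightarrow> if z = y then (if s then 1 else -1) * int e * magnus v' r else 0)"
proof -
  have *: "magnus v (replicate e (y, s) @ r) = magnus v r" if "v = [] \<or> hd v \<noteq> y" for v e
    using that by (induction e) (auto split: list.splits)
  show ?thesis
  proof (cases "v = [] \<or> hd v \<noteq> y")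
    case True
    then show ?thesis using *[of v e] by (auto split: list.splits)
  next
    case False
    then obtain v' where v: "v = y # v'" by (cases v) auto
    have "v' = [] \<or> hd v' \<noteq> y" using assms v by (cases v') auto
    then have "magnus v (replicate e (y, s) @ r) = magnus v r + (if s then 1 else -1) * int e * magnus v' r" for e
      using v by (induction e) (simp_all add: * algebra_simps)
    then show ?thesis by (simp add: v)
  qed
qed

lemma reduced_block:
  assumes "reduced (x # w)"
  obtains e r where "x # w = replicate (Suc e) x @ r" "reduced r" "r = [] \<or> fst (hd r) \<noteq> fst x"
  using assms
proof (induction w arbitrary: thesis x)
  case Nil
  show ?case by (rule Nil(1)[of 0 "[]"]) auto
next
  case (Cons y w)
  show ?case
  proof (cases "y = x")
    case True
    obtain e r where "y # w = replicate (Suc e) y @ r" "reduced r" "r = [] \<or> fst (hd r) \<noteq> fst y"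
      using Cons.IH[of y] reduced_ConsD[OF Cons.prems(2)] by metis
    then show thesis using True by (intro Cons.prems(1)[of "Suc e" r]) auto
  next
    case False
    have "y \<noteq> inv_letter x" using Cons.prems(2) by (simp add: reduced_def)
    then have "fst y \<noteq> fst x" using False by (cases x; cases y) (auto simp: inv_letter_def)
    then show thesis using reduced_ConsD[OF Cons.prems(2)] by (intro Cons.prems(1)[of 0 "y # w"]) auto
  qed
qed

lemma syllables_block:
  assumes "r = [] \<or> fst (hd r) \<noteq> fst x"
  shows "syllables (replicate (Suc e) x @ r) = fst x # syllables r"
  using assms
proof (induction e)
  case 0
  then show ?case by (cases r) (auto simp: syllables_def)
next
  case (Suc e)
  then show ?case by (auto simp: syllables_def)
qed

lemma distinct_adj_syllables [simp]: "distinct_adj (syllables w)"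
  by (simp add: syllables_def)

text \<open>Modulo squares, a reduced word with k syllables expands into k factors 1 + e Y with
  nonzero exponents e. Only the product of all k linear terms reaches length k, and nothing is
  longer.\<close>

lemma magnus_syllables:
  assumes "reduced w" "distinct_adj v" "length (syllables w) \<le> length v"
  shows "magnus v w \<noteq> 0 \<longleftrightarrow> v = syllables w"
  using assms
proof (induction "length w" arbitrary: v w rule: less_induct)
  case less
  show ?case
  proof (cases w)
    case Nil
    then show ?thesis by (simp add: syllables_def)
  next
    case (Cons x w')
    obtain e r where w: "w = replicate (Suc e) x @ r" and r: "reduced r" "r = [] \<or> fst (hd r) \<noteq> fst x"
      using less.prems(1) reduced_block unfolding Cons by metis
    have syl: "syllables w = fst x # syllables r"
      unfolding w by (rule syllables_block[OF r(2)])
    then obtain z v' where v: "v = z # v'" using less.prems(3) by (cases v) auto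
    have v': "distinct_adj v'" using less.prems(2) v by (auto dest: distinct_adj_ConsD)
    have "magnus v r = 0"
      using less.hyps[of r v] less.prems r syl by (auto simp: w)
    then have "magnus v w = (if z = fst x then (if snd x then 1 else -1) * int (Suc e) * magnus v' r else 0)"
      using magnus_replicate[OF less.prems(2), of "Suc e" "fst x" "snd x" r]
      by (simp add: w v del: replicate_Suc of_nat_Suc)
    moreover have "magnus v' r \<noteq> 0 \<longleftrightarrow> v' = syllables r"
      using less.hyps[of r v'] less.prems(3) r v' syl v by (auto simp: w)
    ultimately show ?thesis using syl v by auto
  qed
qed

section \<open>Cyclic traces\<close>

definition rotations :: "'a list \<Rightarrow> 'a list set" where
  "rotations v = range (\<lambda>i. rotate i v)"

text \<open>Invariance under reduction is needed for all rotations at once. For words of length at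
  least two this adds that the first and last letters differ; a single letter qualifies.\<close>

definition cyc_distinct :: "'a list \<Rightarrow> bool" where
  "cyc_distinct v \<longleftrightarrow> (\<forall>v'\<in>rotations v. distinct_adj v')"

definition cyc_trace :: "'a list \<Rightarrow> ('a \<times> bool) list \<Rightarrow> int" where
  "cyc_trace v w = (\<Sum>v'\<in>rotations v. magnus v' w)"

lemma finite_rotations [simp]: "finite (rotations v)"
proof (rule finite_subset)
  show "rotations v \<subseteq> {xs. set xs \<subseteq> set v \<and> length xs = length v}"
    by (auto simp: rotations_def)
qed (simp add: finite_lists_length_eq)

lemma length_rotations: "v' \<in> rotations v \<Longrightarrow> length v' = length v"
  by (auto simp: rotations_def)

lemma self_in_rotations [simp]: "v \<in> rotations v"
  unfolding rotations_def by (rule range_eqI[of _ _ 0]) simp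

lemma rotate_in_rotations: "v' \<in> rotations v \<Longrightarrow> rotate i v' \<in> rotations v"
  unfolding rotations_def by (auto simp: rotate_rotate)

lemma cyc_distinctD: "cyc_distinct v \<Longrightarrow> v' \<in> rotations v \<Longrightarrow> distinct_adj v'"
  by (simp add: cyc_distinct_def)

text \<open>A rotation pq, with p read off u and q off w, is matched with the rotation qp, with q
  read off w and p off u. On pairs of a rotation and a cut this is an involution.\<close>

lemma cyc_trace_append_commute: "cyc_trace v (u @ w) = cyc_trace v (w @ u)"
proof -
  define n where "n = length v"
  have expand: "cyc_trace v (u @ w) =
      (\<Sum>(v', i)\<in>rotations v \<times> {..n}. magnus (take i v') u * magnus (drop i v') w)" for u w
    unfolding cyc_trace_def sum.cartesian_product[symmetric] n_def
    by (intro sum.cong refl) (simp add: magnus_append length_rotations)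
  have *: "rotate (n - i) (rotate i v') = v'" "take (n - i) (rotate i v') = drop i v'"
    "drop (n - i) (rotate i v') = take i v'"
    if "length v' = n" "i \<le> n" for i v'
  proof -
    show "rotate (n - i) (rotate i v') = v'" using that by (simp add: rotate_rotate)
    \<comment> \<open>\<open>rotate_drop_take\<close> takes i modulo n, so the cut i = n is treated
      apart.\<close>
    have "rotate i v' = drop i v' @ take i v'"
      using that by (cases "i = n") (auto simp: rotate_drop_take)
    then show "take (n - i) (rotate i v') = drop i v'" "drop (n - i) (rotate i v') = take i v'"
      using that by auto
  qed
  show ?thesis
    unfolding expand
    by (rule sum.reindex_bij_witness[of _ "\<lambda>(v', i). (rotate i v', n - i)" "\<lambda>(v', i). (rotate i v', n - i)"])
       (auto simp: * length_rotations n_def[symmetric] rotate_in_rotations)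
qed

lemma cyc_trace_reduce: "cyc_distinct v \<Longrightarrow> cyc_trace v (reduce w) = cyc_trace v w"
  unfolding cyc_trace_def by (intro sum.cong refl magnus_reduce cyc_distinctD)

text \<open>By \<open>magnus_syllables\<close> at most one rotation has a nonzero coefficient, so
  nothing can cancel in the sum.\<close>

lemma cyc_trace_syllables:
  assumes "reduced w" "cyc_distinct v" "length (syllables w) \<le> length v"
  shows "cyc_trace v w \<noteq> 0 \<longleftrightarrow> syllables w \<in> rotations v"
proof -
  have "magnus v' w \<noteq> 0 \<longleftrightarrow> v' = syllables w" if "v' \<in> rotations v" for v'
    using magnus_syllables[OF assms(1), of v'] that assms(2,3) 
    by (auto simp: length_rotations cyc_distinct_def)
  then have "cyc_trace v w = (\<Sum>v'\<in>rotations v. if v' = syllables w then magnus v' w else 0)"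
    unfolding cyc_trace_def by (intro sum.cong) auto
  then show ?thesis
    using magnus_syllables[OF assms(1) distinct_adj_syllables] by (auto simp: sum.delta)
qed

lemma cyc_distinctI:
  assumes "distinct_adj v" "v \<noteq> []" "hd v \<noteq> last v"
  shows "cyc_distinct v"
proof -
  have "distinct_adj (drop i v @ take i v)" for i
  proof -
    have "distinct_adj (take i v)" "distinct_adj (drop i v)"
      using assms(1) by (metis append_take_drop_id distinct_adj_append_iff)+
    moreover have "last (drop i v) \<noteq> hd (take i v)" if "drop i v \<noteq> []" "take i v \<noteq> []"
      using assms(3) that by (auto simp: hd_take)
    ultimately show ?thesis by (auto simp: distinct_adj_append_iff)
  qed
  then show ?thesis by (auto simp: cyc_distinct_def rotations_def rotate_drop_take)
qed

section \<open>Polynomial functions on a group\<close>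

lemma (in group) commutator_mult:
  assumes "a \<in> carrier G" "b \<in> carrier G"
  shows "(a \<otimes> b \<otimes> inv a \<otimes> inv b) \<otimes> (b \<otimes> a) = a \<otimes> b"
proof -
  have "inv b \<otimes> (b \<otimes> a) = a" using assms by (simp add: m_assoc[symmetric])
  then show ?thesis using assms by (simp add: m_assoc)
qed

context group
begin

section \<open>Automorphisms as functions on the carrier\<close>

lemma AutoGroup_iff:
  "a \<in> carrier (AutoGroup G) \<longleftrightarrow> a \<in> hom G G \<and> a \<in> Bij (carrier G)"
  by (auto simp: AutoGroup_def auto_def)

lemma AutoGroup_hom: "a \<in> carrier (AutoGroup G) \<Longrightarrow> a \<in> hom G G"
  by (simp add: AutoGroup_iff)

lemma AutoGroup_apply_closed:
  "a \<in> carrier (AutoGroup G) \<Longrightarrow> x \<in> carrier G \<Longrightarrow> a x \<in> carrier G"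
  by (auto simp: AutoGroup_iff hom_def)

lemma AutoGroup_apply_mult:
  "a \<in> carrier (AutoGroup G) \<Longrightarrow> x \<in> carrier G \<Longrightarrow> y \<in> carrier G \<Longrightarrow> a (x \<otimes> y) = a x \<otimes> a y"
  by (auto simp: AutoGroup_iff hom_def)

lemma AutoGroup_apply_one: "a \<in> carrier (AutoGroup G) \<Longrightarrow> a \<one> = \<one>"
  using AutoGroup_hom hom_one group_axioms by blast

lemma AutoGroup_apply_inv:
  assumes "a \<in> carrier (AutoGroup G)" "x \<in> carrier G"
  shows "a (inv x) = inv (a x)"
proof -
  interpret group_hom G G a using AutoGroup_hom[OF assms(1)] by unfold_locales
  show ?thesis using assms by simp
qed

lemma AutoGroup_mult_apply:
  "a \<in> carrier (AutoGroup G) \<Longrightarrow> b \<in> carrier (AutoGroup G) \<Longrightarrow> x \<in> carrier G \<Longrightarrow>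
    (a \<otimes>\<^bsub>AutoGroup G\<^esub> b) x = a (b x)"
  by (simp add: AutoGroup_iff) (simp add: AutoGroup_def BijGroup_def compose_def)

lemma AutoGroup_one_apply: "x \<in> carrier G \<Longrightarrow> \<one>\<^bsub>AutoGroup G\<^esub> x = x"
  by (simp add: AutoGroup_def BijGroup_def)

lemma AutoGroup_eqI:
  "a \<in> carrier (AutoGroup G) \<Longrightarrow> b \<in> carrier (AutoGroup G) \<Longrightarrow>
    (\<And>x. x \<in> carrier G \<Longrightarrow> a x = b x) \<Longrightarrow> a = b"
  by (auto simp: AutoGroup_iff Bij_def intro: extensionalityI)

lemma AutoGroup_inv_apply:
  assumes "a \<in> carrier (AutoGroup G)" "x \<in> carrier G"
  shows "(inv\<^bsub>AutoGroup G\<^esub> a) (a x) = x" "a ((inv\<^bsub>AutoGroup G\<^esub> a) x) = x"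
proof -
  interpret A: group "AutoGroup G" by (rule AutoGroup)
  show "(inv\<^bsub>AutoGroup G\<^esub> a) (a x) = x" "a ((inv\<^bsub>AutoGroup G\<^esub> a) x) = x"
    using assms by (simp_all flip: AutoGroup_mult_apply add: AutoGroup_one_apply)
qed

lemma AutoGroup_inj:
  "a \<in> carrier (AutoGroup G) \<Longrightarrow> x \<in> carrier G \<Longrightarrow> y \<in> carrier G \<Longrightarrow> a x = a y \<Longrightarrow> x = y"
  by (metis AutoGroup_inv_apply(1))

lemma AutoGroup_memI:
  assumes "f \<in> hom G G" "g \<in> hom G G" "f \<in> extensional (carrier G)"
    "\<And>x. x \<in> carrier G \<Longrightarrow> f (g x) = x" "\<And>x. x \<in> carrier G \<Longrightarrow> g (f x) = x"
  shows "f \<in> carrier (AutoGroup G)"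
proof -
  have "bij_betw f (carrier G) (carrier G)"
    using assms by (intro bij_betw_byWitness[where f' = g]) (auto simp: hom_def)
  then show ?thesis using assms by (simp add: AutoGroup_iff Bij_def)
qed

definition inner :: "'a \<Rightarrow> 'a \<Rightarrow> 'a" where
  "inner g = (\<lambda>x\<in>carrier G. g \<otimes> x \<otimes> inv g)"

lemma inner_closed: "g \<in> carrier G \<Longrightarrow> inner g \<in> carrier (AutoGroup G)"
  using group_hom.hom_closed[OF inner_autos_group_hom] by (simp add: inner_def)

lemma inner_apply: "x \<in> carrier G \<Longrightarrow> inner g x = g \<otimes> x \<otimes> inv g"
  by (simp add: inner_def)

lemma inner_autos_eq: "inner_autos G = inner ` carrier G"
  by (simp add: inner_autos_def inner_def)

section \<open>Functions killed by iterated differences and the automorphisms unipotent on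
  them\<close>

text \<open>Extended linearly to the group ring, these functions are the ones that vanish on the \<open>k\<close>-th power
  of the augmentation ideal.\<close>

fun poly_fun :: "nat \<Rightarrow> ('a \<Rightarrow> int) set" where
  "poly_fun 0 = {f. \<forall>x\<in>carrier G. f x = 0}"
| "poly_fun (Suc k) = {f. \<forall>g\<in>carrier G. (\<lambda>x. f (x \<otimes> g) - f x) \<in> poly_fun k}"

declare poly_fun.simps(2) [simp del]

lemma poly_fun_SucI:
  "(\<And>g. g \<in> carrier G \<Longrightarrow> (\<lambda>x. f (x \<otimes> g) - f x) \<in> poly_fun k) \<Longrightarrow> f \<in> poly_fun (Suc k)"
  by (simp add: poly_fun.simps)

lemma poly_fun_SucD:
  "f \<in> poly_fun (Suc k) \<Longrightarrow> g \<in> carrier G \<Longrightarrow> (\<lambda>x. f (x \<otimes> g) - f x) \<in> poly_fun k"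
  by (simp add: poly_fun.simps)

text \<open>Membership constrains the values on the carrier only, whereas functions live on the
  whole type.\<close>

lemma poly_fun_cong:
  "f \<in> poly_fun k \<Longrightarrow> (\<And>x. x \<in> carrier G \<Longrightarrow> f x = f' x) \<Longrightarrow> f' \<in> poly_fun k"
proof (induction k arbitrary: f f')
  case (Suc k)
  show ?case
  proof (rule poly_fun_SucI)
    fix g assume g: "g \<in> carrier G"
    show "(\<lambda>x. f' (x \<otimes> g) - f' x) \<in> poly_fun k"
      by (rule Suc.IH[of "\<lambda>x. f (x \<otimes> g) - f x"]) (use Suc.prems g poly_fun_SucD in auto)
  qed
qed simp

lemma poly_fun_zero: "(\<lambda>_. 0) \<in> poly_fun k"
  by (induction k) (auto simp: poly_fun.simps)

lemma poly_fun_add: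
  "f \<in> poly_fun k \<Longrightarrow> f' \<in> poly_fun k \<Longrightarrow> (\<lambda>x. f x + f' x) \<in> poly_fun k"
proof (induction k arbitrary: f f')
  case (Suc k)
  show ?case
  proof (rule poly_fun_SucI)
    fix g assume g: "g \<in> carrier G"
    show "(\<lambda>x. f (x \<otimes> g) + f' (x \<otimes> g) - (f x + f' x)) \<in> poly_fun k"
      by (rule poly_fun_cong[OF Suc.IH[of "\<lambda>x. f (x \<otimes> g) - f x" "\<lambda>x. f' (x \<otimes> g) - f' x"]])
         (use Suc.prems g poly_fun_SucD in auto)
  qed
qed simp

lemma poly_fun_scale: "f \<in> poly_fun k \<Longrightarrow> (\<lambda>x. c * f x) \<in> poly_fun k"
proof (induction k arbitrary: f)
  case (Suc k)
  show ?case
  proof (rule poly_fun_SucI)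
    fix g assume g: "g \<in> carrier G"
    show "(\<lambda>x. c * f (x \<otimes> g) - c * f x) \<in> poly_fun k"
      by (rule poly_fun_cong[OF Suc.IH[of "\<lambda>x. f (x \<otimes> g) - f x"]])
         (use Suc.prems g poly_fun_SucD in \<open>auto simp: algebra_simps\<close>)
  qed
qed simp

lemma poly_fun_diff:
  assumes "f \<in> poly_fun k" "f' \<in> poly_fun k"
  shows "(\<lambda>x. f x - f' x) \<in> poly_fun k"
  using poly_fun_add[OF assms(1) poly_fun_scale[OF assms(2), of "-1"]] by simp

lemma poly_fun_sum:
  "(\<And>i. i \<in> I \<Longrightarrow> f i \<in> poly_fun k) \<Longrightarrow> (\<lambda>x. \<Sum>i\<in>I. f i x) \<in> poly_fun k"
  by (induction I rule: infinite_finite_induct) (auto simp: poly_fun_zero intro: poly_fun_add)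

lemma poly_fun_Suc: "f \<in> poly_fun k \<Longrightarrow> f \<in> poly_fun (Suc k)"
proof (induction k arbitrary: f)
  case (Suc k)
  show ?case by (rule poly_fun_SucI) (intro Suc.IH poly_fun_SucD[OF Suc.prems])
qed (simp add: poly_fun.simps)

lemma poly_fun_mono: "k \<le> l \<Longrightarrow> f \<in> poly_fun k \<Longrightarrow> f \<in> poly_fun l"
  by (induction l rule: dec_induct) (auto intro: poly_fun_Suc)

text \<open>The difference of f o a in direction g is the difference of f in direction
  \<open>a g\<close>, composed with a.\<close>

lemma poly_fun_hom:
  "f \<in> poly_fun k \<Longrightarrow> a \<in> hom G G \<Longrightarrow> (\<lambda>x. f (a x)) \<in> poly_fun k"
proof (induction k arbitrary: f)
  case 0
  then show ?case by (auto simp: hom_def)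
next
  case (Suc k)
  show ?case
  proof (rule poly_fun_SucI)
    fix g assume g: "g \<in> carrier G"
    show "(\<lambda>x. f (a (x \<otimes> g)) - f (a x)) \<in> poly_fun k"
      by (rule poly_fun_cong[OF Suc.IH[of "\<lambda>x. f (x \<otimes> a g) - f x"]])
         (use Suc.prems g poly_fun_SucD in \<open>auto simp: hom_def\<close>)
  qed
qed

text \<open>Dual form of the condition that a - 1 raises the filtration of the group ring by powers
  of the augmentation ideal by j. Subtraction is truncated: functions in \<open>poly_fun k\<close>
  with k \<le> j are fixed on the carrier.\<close>

definition unip_autos :: "nat \<Rightarrow> ('a \<Rightarrow> 'a) set" where
  "unip_autos j = {a \<in> carrier (AutoGroup G).
     \<forall>k. \<forall>f\<in>poly_fun k. (\<lambda>x. f (a x) - f x) \<in> poly_fun (k - j)}"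

lemma unip_autosD:
  "a \<in> unip_autos j \<Longrightarrow> f \<in> poly_fun k \<Longrightarrow> (\<lambda>x. f (a x) - f x) \<in> poly_fun (k - j)"
  by (simp add: unip_autos_def)

text \<open>On functions, ab - ba is the commutator of a - 1 and b - 1, so it loses 2(j + 1)
  degrees, which is at least j + 2. Composing with the inverse of ba turns this into c - 1 for the
  commutator c and does not change the degree.\<close>

lemma unip_autos_commutator:
  assumes a: "a \<in> unip_autos (Suc j)" and b: "b \<in> unip_autos (Suc j)"
  shows "a \<otimes>\<^bsub>AutoGroup G\<^esub> b \<otimes>\<^bsub>AutoGroup G\<^esub> inv\<^bsub>AutoGroup G\<^esub> a \<otimes>\<^bsub>AutoGroup G\<^esub> inv\<^bsub>AutoGroup G\<^esub> b
    \<in> unip_autos (Suc (Suc j))"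
proof -
  interpret A: group "AutoGroup G" by (rule AutoGroup)
  have ac: "a \<in> carrier (AutoGroup G)" and bc: "b \<in> carrier (AutoGroup G)"
    using a b by (auto simp: unip_autos_def)
  define c where "c = a \<otimes>\<^bsub>AutoGroup G\<^esub> b \<otimes>\<^bsub>AutoGroup G\<^esub> inv\<^bsub>AutoGroup G\<^esub> a \<otimes>\<^bsub>AutoGroup G\<^esub> inv\<^bsub>AutoGroup G\<^esub> b"
  have cc: "c \<in> carrier (AutoGroup G)" using ac bc by (simp add: c_def)
  define d where "d = b \<otimes>\<^bsub>AutoGroup G\<^esub> a"
  have dc: "d \<in> carrier (AutoGroup G)" using ac bc by (simp add: d_def)
  have cd: "c \<otimes>\<^bsub>AutoGroup G\<^esub> d = a \<otimes>\<^bsub>AutoGroup G\<^esub> b"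
    unfolding c_def d_def using ac bc by (rule A.commutator_mult)
  have "(\<lambda>x. f (c x) - f x) \<in> poly_fun (k - Suc (Suc j))" if f: "f \<in> poly_fun k" for k f
  proof -
    have fa: "(\<lambda>x. f (a x) - f x) \<in> poly_fun (k - Suc j)" and fb: "(\<lambda>x. f (b x) - f x) \<in> poly_fun (k - Suc j)"
      using a b f by (auto simp: unip_autos_def)
    have "(\<lambda>x. (f (a (b x)) - f (b x)) - (f (a x) - f x)) \<in> poly_fun (k - Suc j - Suc j)"
         "(\<lambda>x. (f (b (a x)) - f (a x)) - (f (b x) - f x)) \<in> poly_fun (k - Suc j - Suc j)"
      by (rule unip_autosD[OF b fa], rule unip_autosD[OF a fb])
    from poly_fun_diff[OF this]
    have *: "(\<lambda>x. f (a (b x)) - f (b (a x))) \<in> poly_fun (k - Suc j - Suc j)" by (simp add: algebra_simps)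
    have "(\<lambda>x. f (c x) - f x) \<in> poly_fun (k - Suc j - Suc j)"
    proof (rule poly_fun_cong[OF poly_fun_hom[OF * AutoGroup_hom[OF A.inv_closed[OF dc]]]])
      fix x assume x: "x \<in> carrier G"
      define y where "y = (inv\<^bsub>AutoGroup G\<^esub> d) x"
      have y: "y \<in> carrier G" and xy: "x = d y"
        using AutoGroup_apply_closed[OF A.inv_closed[OF dc] x] AutoGroup_inv_apply(2)[OF dc x]
        by (simp_all add: y_def)
      have "c x = a (b y)" using xy cd AutoGroup_mult_apply[OF cc dc y] AutoGroup_mult_apply[OF ac bc y] by simp
      moreover have "x = b (a y)" using xy AutoGroup_mult_apply[OF bc ac y] by (simp add: d_def)
      ultimately show "f (a (b ((inv\<^bsub>AutoGroup G\<^esub> d) x))) - f (b (a ((inv\<^bsub>AutoGroup G\<^esub> d) x))) = f (c x) - f x"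
        unfolding y_def[symmetric] by metis
    qed
    then show ?thesis by (rule poly_fun_mono[rotated]) simp
  qed
  then show ?thesis using cc by (auto simp: unip_autos_def c_def)
qed

end

text \<open>Writing an element of \<open>L\<close> as one commutator gains one level.
  \<open>B\<close> is any family of sets, not a chain of subgroups: for outer automorphisms it will
  consist of the cosets that contain a representative of the given level.\<close>

lemma hom_commutator_descent:
  assumes "group A" "group H" "h \<in> hom A H" "L \<subseteq> carrier A"
    and L: "\<And>l. l \<in> L \<Longrightarrow> \<exists>a\<in>L. \<exists>b\<in>L. l = a \<otimes>\<^bsub>A\<^esub> b \<otimes>\<^bsub>A\<^esub> inv\<^bsub>A\<^esub> a \<otimes>\<^bsub>A\<^esub> inv\<^bsub>A\<^esub> b"
    and B: "\<And>j x y. x \<in> B (Suc j) \<Longrightarrow> y \<in> B (Suc j) \<Longrightarrow>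
      x \<otimes>\<^bsub>H\<^esub> y \<otimes>\<^bsub>H\<^esub> inv\<^bsub>H\<^esub> x \<otimes>\<^bsub>H\<^esub> inv\<^bsub>H\<^esub> y \<in> B (Suc (Suc j))"
    and "h ` L \<subseteq> B (Suc 0)"
  shows "h ` L \<subseteq> B (Suc j)"
proof (induction j)
  case (Suc j)
  interpret group_hom A H h
    using assms(1-3) by (simp add: group_hom_def group_hom_axioms_def)
  show ?case
  proof (rule image_subsetI)
    fix l assume "l \<in> L"
    then obtain a b where ab: "a \<in> L" "b \<in> L" and
      l: "l = a \<otimes>\<^bsub>A\<^esub> b \<otimes>\<^bsub>A\<^esub> inv\<^bsub>A\<^esub> a \<otimes>\<^bsub>A\<^esub> inv\<^bsub>A\<^esub> b" using L by blast
    have c: "a \<in> carrier A" "b \<in> carrier A" using ab assms(4) by auto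
    have "h a \<otimes>\<^bsub>H\<^esub> h b \<otimes>\<^bsub>H\<^esub> inv\<^bsub>H\<^esub> h a \<otimes>\<^bsub>H\<^esub> inv\<^bsub>H\<^esub> h b \<in> B (Suc (Suc j))"
      using ab Suc by (intro B) auto
    then show "h l \<in> B (Suc (Suc j))" using c by (simp add: l)
  qed
qed (rule assms)

section \<open>Polynomial functions on free groups\<close>

abbreviation gen :: "'a \<Rightarrow> ('a \<times> bool) list" where "gen s \<equiv> [(s, True)]"

lemma free_group_simps:
  "w \<in> carrier (free_group S) \<longleftrightarrow> reduced w \<and> fst ` set w \<subseteq> S"
  "u \<otimes>\<^bsub>free_group S\<^esub> v = reduce (u @ v)"
  "\<one>\<^bsub>free_group S\<^esub> = []"
  by (simp_all add: free_group_def)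

lemma letter_closed: "fst x \<in> S \<Longrightarrow> [x] \<in> carrier (free_group S)"
  by (auto simp: free_group_simps reduced_def)

lemma gen_closed: "s \<in> S \<Longrightarrow> gen s \<in> carrier (free_group S)"
  by (simp add: letter_closed)

lemma inv_letter_word:
  assumes "fst x \<in> S"
  shows "inv\<^bsub>free_group S\<^esub> [x] = [inv_letter x]"
proof -
  interpret F: group "free_group S" by (rule group_free_group)
  show ?thesis
    using assms by (intro F.inv_equality letter_closed) (auto simp: free_group_simps reduce_def)
qed

lemma free_group_inv:
  assumes "w \<in> carrier (free_group S)"
  shows "inv\<^bsub>free_group S\<^esub> w = reduce (rev (map inv_letter w))"
proof -
  interpret F: group "free_group S" by (rule group_free_group)
  have "reduce (rev (map inv_letter w)) \<in> carrier (free_group S)"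
    using assms set_reduce[of "rev (map inv_letter w)"] by (fastforce simp: free_group_simps)
  then show ?thesis
    using assms by (intro F.inv_equality) (auto simp: free_group_simps reduce_append_reduce1 reduce_inverse_append)
qed

lemma Cons_eq_mult: "reduced (x # w) \<Longrightarrow> x # w = [x] \<otimes>\<^bsub>free_group S\<^esub> w"
  by (simp add: free_group_simps reduce_reduced)

lemma free_group_induct [consumes 1, case_names Nil Cons]:
  assumes "w \<in> carrier (free_group S)"
    and "P []"
    and "\<And>x w. fst x \<in> S \<Longrightarrow> w \<in> carrier (free_group S) \<Longrightarrow> P w \<Longrightarrow> P ([x] \<otimes>\<^bsub>free_group S\<^esub> w)"
  shows "P w"
  using assms(1)
proof (induction w)
  case (Cons x w)
  then have "w \<in> carrier (free_group S)" "fst x \<in> S" "reduced (x # w)"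
    by (auto simp: free_group_simps dest: reduced_ConsD)
  then show ?case using Cons.IH assms(3) Cons_eq_mult by metis
qed (rule assms(2))

lemma magnus_mult:
  assumes "distinct_adj v"
  shows "magnus v (u \<otimes>\<^bsub>free_group S\<^esub> w) = (\<Sum>i\<le>length v. magnus (take i v) u * magnus (drop i v) w)"
  using assms by (simp add: free_group_simps magnus_reduce magnus_append)

lemma magnus_singleton_mult:
  "magnus [i] (u \<otimes>\<^bsub>free_group S\<^esub> w) = magnus [i] u + magnus [i] w"
  by (simp add: magnus_mult)

text \<open>By the Cauchy product, the difference in direction g is an integral combination of
  coefficients of proper prefixes of v. The successor is there because the constant
  \<open>magnus []\<close> is killed by one difference but is not zero.\<close>

lemma magnus_poly_fun:
  assumes "distinct_adj v"
  shows "magnus v \<in> group.poly_fun (free_group S) (Suc (length v))"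
  using assms
proof (induction "length v" arbitrary: v rule: less_induct)
  case less
  interpret F: group "free_group S" by (rule group_free_group)
  show ?case
  proof (rule F.poly_fun_SucI)
    fix g assume g: "g \<in> carrier (free_group S)"
    have "(\<lambda>x. \<Sum>i<length v. magnus (take i v) x * magnus (drop i v) g) \<in> F.poly_fun (length v)"
    proof (rule F.poly_fun_sum)
      fix i assume i: "i \<in> {..<length v}"
      have "distinct_adj (take i v)"
        using less.prems by (metis append_take_drop_id distinct_adj_append_iff)
      then have "magnus (take i v) \<in> F.poly_fun (Suc i)"
        using less.hyps[of "take i v"] i by simp
      then have "magnus (take i v) \<in> F.poly_fun (length v)"
        by (rule F.poly_fun_mono[rotated]) (use i in auto)
      from F.poly_fun_scale[OF this, of "magnus (drop i v) g"]
      show "(\<lambda>x. magnus (take i v) x * magnus (drop i v) g) \<in> F.poly_fun (length v)"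
        by (simp add: mult.commute)
    qed
    then show "(\<lambda>x. magnus v (x \<otimes>\<^bsub>free_group S\<^esub> g) - magnus v x) \<in> F.poly_fun (length v)"
    proof (rule F.poly_fun_cong)
      fix x
      have "(\<Sum>i\<le>length v. magnus (take i v) x * magnus (drop i v) g) =
          (\<Sum>i<length v. magnus (take i v) x * magnus (drop i v) g) + magnus v x"
        unfolding lessThan_Suc_atMost[symmetric] sum.lessThan_Suc by simp
      then show "(\<Sum>i<length v. magnus (take i v) x * magnus (drop i v) g) =
          magnus v (x \<otimes>\<^bsub>free_group S\<^esub> g) - magnus v x"
        by (simp only: magnus_mult[OF less.prems])
    qed
  qed
qed

text \<open>Modulo second differences, the difference operator of a word depends only on its exponent sums.\<close>

lemma poly_fun_linear_part:
  assumes "finite S" "w \<in> carrier (free_group S)" "f \<in> group.poly_fun (free_group S) (Suc (Suc k))"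
  shows "(\<lambda>x. f (x \<otimes>\<^bsub>free_group S\<^esub> w) - f x -
      (\<Sum>i\<in>S. magnus [i] w * (f (x \<otimes>\<^bsub>free_group S\<^esub> gen i) - f x)))
    \<in> group.poly_fun (free_group S) k"
  using assms(2)
proof (induction rule: free_group_induct)
  case Nil
  interpret F: group "free_group S" by (rule group_free_group)
  show ?case
    by (rule F.poly_fun_cong[OF F.poly_fun_zero]) (simp add: free_group_simps reduce_reduced)
next
  case (Cons y w)
  interpret F: group "free_group S" by (rule group_free_group)
  let ?m = "\<lambda>u v. u \<otimes>\<^bsub>free_group S\<^esub> v"
  let ?L = "\<lambda>u x. \<Sum>i\<in>S. magnus [i] u * (f (?m x (gen i)) - f x)"
  have f: "(\<lambda>x. f (?m x g) - f x) \<in> F.poly_fun (Suc k)" if "g \<in> carrier (free_group S)" for g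
    using F.poly_fun_SucD[OF assms(3) that] .
  have f2: "(\<lambda>x. f (?m (?m x u) g) - f (?m x u) - (f (?m x g) - f x)) \<in> F.poly_fun k"
    if "g \<in> carrier (free_group S)" "u \<in> carrier (free_group S)" for g u
    using F.poly_fun_SucD[OF f[OF that(1)] that(2)] .
  have y: "[y] \<in> carrier (free_group S)" using Cons.hyps by (simp add: letter_closed)
  have letter: "(\<lambda>x. f (?m x [y]) - f x - ?L [y] x) \<in> F.poly_fun k"
  proof -
    obtain s b where yb: "y = (s, b)" by (cases y)
    have s: "s \<in> S" using Cons.hyps yb by simp
    have L: "?L [y] x = (if b then 1 else -1) * (f (?m x (gen s)) - f x)" for x
    proof -
      have "?L [y] x = (\<Sum>i\<in>S. if i = s then (if b then 1 else -1) * (f (?m x (gen s)) - f x) else 0)"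
        by (intro sum.cong) (auto simp: yb)
      then show ?thesis using s assms(1) by simp
    qed
    show ?thesis
    proof (cases b)
      case True
      show ?thesis
        by (rule F.poly_fun_cong[OF F.poly_fun_zero]) (simp only: L, simp add: True yb)
    next
      case False
      have gs: "gen s \<in> carrier (free_group S)" using s by (rule gen_closed)
      have "?m (?m x [y]) (gen s) = x" if "x \<in> carrier (free_group S)" for x
      proof -
        have "?m [y] (gen s) = []" by (simp add: free_group_simps reduce_def yb False inv_letter_def)
        then have "?m (?m x [y]) (gen s) = ?m x \<one>\<^bsub>free_group S\<^esub>"
          using that y gs by (simp add: F.m_assoc free_group_simps(3))
        then show ?thesis using that by simp
      qed
      \<comment> \<open>With y the inverse of s one has x = (xy)s, so f(xy) - f(x) is minus the
        difference in direction s taken at xy. Moving that back to x costs a second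
        difference.\<close>
      then show ?thesis
        by (intro F.poly_fun_cong[OF F.poly_fun_scale[OF f2[OF gs y], of "-1"]])
           (simp only: L, simp add: False)
    qed
  qed
  have L: "?L (?m [y] w) x = ?L [y] x + ?L w x" for x
    by (simp only: magnus_singleton_mult distrib_right sum.distrib)
  \<comment> \<open>Cocycle rule: the difference in direction yw is the sum of those in directions y
    and w plus a second difference.\<close>
  show ?case
  proof (rule F.poly_fun_cong[OF F.poly_fun_add[OF F.poly_fun_add[OF letter Cons.IH] f2[OF Cons.hyps(2) y]]])
    fix x assume "x \<in> carrier (free_group S)"
    then have "?m x (?m [y] w) = ?m (?m x [y]) w" using Cons.hyps(2) y by (simp only: F.m_assoc)
    then show "f (?m x [y]) - f x - ?L [y] x + (f (?m x w) - f x - ?L w x) +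
        (f (?m (?m x [y]) w) - f (?m x [y]) - (f (?m x w) - f x)) =
        f (?m x (?m [y] w)) - f x - ?L (?m [y] w) x"
      unfolding L by simp
  qed
qed

text \<open>The hypothesis says that a is trivial on homology. The difference of f o a - f in
  direction g splits into f(ax ag) - f(ax g), which is small because
  \<open>poly_fun_linear_part\<close> sees only exponent sums, and the change under a of the
  difference of f in direction g, which the induction covers.\<close>

lemma unip_autos_1I:
  assumes "finite S" and a: "a \<in> carrier (AutoGroup (free_group S))"
    and ab: "\<And>i w. w \<in> carrier (free_group S) \<Longrightarrow> i \<in> S \<Longrightarrow> magnus [i] (a w) = magnus [i] w"
  shows "a \<in> group.unip_autos (free_group S) (Suc 0)"
proof -
  interpret F: group "free_group S" by (rule group_free_group)
  let ?m = "\<lambda>u v. u \<otimes>\<^bsub>free_group S\<^esub> v"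
  note aH = F.AutoGroup_hom[OF a]
  have "(\<lambda>x. f (a x) - f x) \<in> F.poly_fun k" if "f \<in> F.poly_fun (Suc k)" for f k
    using that
  proof (induction k arbitrary: f)
    case 0
    have "f (a x) = f x" if x: "x \<in> carrier (free_group S)" for x
    proof -
      have "f (?m \<one>\<^bsub>free_group S\<^esub> y) = f \<one>\<^bsub>free_group S\<^esub>" if "y \<in> carrier (free_group S)" for y
        using F.poly_fun_SucD[OF 0 that] by (simp del: F.l_one F.r_one)
      from this[OF x] this[OF F.AutoGroup_apply_closed[OF a x]] show ?thesis
        using x F.AutoGroup_apply_closed[OF a x] by (simp only: F.l_one)
    qed
    then show ?case by simp
  next
    case (Suc k)
    show ?case
    proof (rule F.poly_fun_SucI)
      fix g assume g: "g \<in> carrier (free_group S)"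
      have ag: "a g \<in> carrier (free_group S)" using F.AutoGroup_apply_closed[OF a g] .
      let ?L = "\<lambda>u x. \<Sum>i\<in>S. magnus [i] u * (f (?m x (gen i)) - f x)"
      have L: "?L (a g) x = ?L g x" for x by (intro sum.cong) (simp_all add: ab[OF g])
      have "(\<lambda>x. (f (?m x (a g)) - f x - ?L (a g) x) - (f (?m x g) - f x - ?L g x)) \<in> F.poly_fun k"
        by (rule F.poly_fun_diff[OF poly_fun_linear_part[OF assms(1) ag Suc.prems]
              poly_fun_linear_part[OF assms(1) g Suc.prems]])
      then have "(\<lambda>x. f (?m x (a g)) - f (?m x g)) \<in> F.poly_fun k"
        by (rule F.poly_fun_cong) (simp only: L)
      then have 1: "(\<lambda>x. f (?m (a x) (a g)) - f (?m (a x) g)) \<in> F.poly_fun k"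
        by (rule F.poly_fun_hom[OF _ aH])
      have "(\<lambda>x. f (?m x g) - f x) \<in> F.poly_fun (Suc k)"
        using F.poly_fun_SucD[OF Suc.prems g] .
      from Suc.IH[OF this]
      have 2: "(\<lambda>x. f (?m (a x) g) - f (a x) - (f (?m x g) - f x)) \<in> F.poly_fun k" .
      show "(\<lambda>x. f (a (?m x g)) - f (?m x g) - (f (a x) - f x)) \<in> F.poly_fun k"
        by (rule F.poly_fun_cong[OF F.poly_fun_add[OF 1 2]]) (simp add: F.AutoGroup_apply_mult[OF a _ g])
    qed
  qed
  moreover have "(\<lambda>x. f (a x) - f x) \<in> F.poly_fun 0" if "f \<in> F.poly_fun 0" for f
    using F.AutoGroup_apply_closed[OF a] that by simp
  ultimately have "(\<lambda>x. f (a x) - f x) \<in> F.poly_fun (k - Suc 0)" if "f \<in> F.poly_fun k" for f k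
    using that by (cases k) auto
  then show ?thesis using a by (auto simp: F.unip_autos_def)
qed

lemma magnus_separates:
  assumes "u \<in> carrier (free_group S)" "\<And>v. distinct_adj v \<Longrightarrow> v \<noteq> [] \<Longrightarrow> magnus v u = 0"
  shows "u = []"
proof (rule ccontr)
  assume u: "u \<noteq> []"
  have "magnus (syllables u) u \<noteq> 0"
    using magnus_syllables[of u "syllables u"] assms(1) by (simp add: free_group_simps)
  moreover have "syllables u \<noteq> []" using u by (simp add: syllables_def)
  ultimately show False using assms(2) by simp
qed

lemma unip_autos_Inter:
  assumes "\<And>j. a \<in> group.unip_autos (free_group S) (Suc j)"
  shows "a = \<one>\<^bsub>AutoGroup (free_group S)\<^esub>"
proof -
  interpret F: group "free_group S" by (rule group_free_group)
  interpret A: group "AutoGroup (free_group S)" by (rule F.AutoGroup)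
  have ac: "a \<in> carrier (AutoGroup (free_group S))" using assms by (auto simp: F.unip_autos_def)
  have inv: "magnus v (a x) = magnus v x" if "distinct_adj v" "x \<in> carrier (free_group S)" for v x
  proof -
    \<comment> \<open>At this level the degree of \<open>magnus v\<close> is used up, and
      \<open>poly_fun 0\<close> means equality on the carrier.\<close>
    have "(\<lambda>x. magnus v (a x) - magnus v x) \<in> F.poly_fun (Suc (length v) - Suc (length v))"
      by (rule F.unip_autosD[OF assms magnus_poly_fun[OF that(1)]])
    then show ?thesis using that by simp
  qed
  show ?thesis
  proof (rule F.AutoGroup_eqI[OF ac A.one_closed])
    fix x assume x: "x \<in> carrier (free_group S)"
    have ax: "a x \<in> carrier (free_group S)" using F.AutoGroup_apply_closed[OF ac x] .
    \<comment> \<open>\<open>magnus_separates\<close> detects only the identity, hence this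
      quotient. Its coefficients depend on \<open>a x\<close> only through the coefficients of
      \<open>a x\<close>.\<close>
    let ?u = "a x \<otimes>\<^bsub>free_group S\<^esub> inv\<^bsub>free_group S\<^esub> x"
    have "magnus v ?u = 0" if v: "distinct_adj v" "v \<noteq> []" for v
    proof -
      have "distinct_adj (take i v)" for i
        using v by (metis append_take_drop_id distinct_adj_append_iff)
      then have "magnus v ?u = magnus v (x \<otimes>\<^bsub>free_group S\<^esub> inv\<^bsub>free_group S\<^esub> x)"
        unfolding magnus_mult[OF v(1)] by (intro sum.cong) (simp_all add: inv x)
      then show ?thesis using x v by (simp add: free_group_simps(3))
    qed
    then have "?u = \<one>\<^bsub>free_group S\<^esub>"
      using magnus_separates[of ?u S] ax x by (simp add: free_group_simps(3))
    then have "inv\<^bsub>free_group S\<^esub> (inv\<^bsub>free_group S\<^esub> x) = a x"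
      using ax x by (intro F.inv_equality) auto
    then have "a x = x" using x by simp
    then show "a x = \<one>\<^bsub>AutoGroup (free_group S)\<^esub> x" using x by (simp add: F.AutoGroup_one_apply)
  qed
qed

section \<open>Automorphisms preserving cyclic traces are inner\<close>

lemma length_reduce_eq: "length w \<le> length (reduce w) \<Longrightarrow> reduce w = w"
proof (induction w)
  case (Cons x w)
  have eq: "reduce (x # w) = cancel_cons x (reduce w)" by (simp add: reduce_def)
  have "length (cancel_cons x (reduce w)) \<le> Suc (length (reduce w))"
    by (cases "reduce w") auto
  then have "reduce w = w" using Cons eq by simp
  then show ?case using Cons.prems eq by (cases w) (auto split: if_splits)
qed (simp add: reduce_def)

lemma inv_letter_eq_iff [simp]: "inv_letter x = inv_letter y \<longleftrightarrow> x = y"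
  by (auto simp: inv_letter_def prod_eq_iff)

lemma reduced_rev_inv: "reduced (rev (map inv_letter w)) \<longleftrightarrow> reduced w"
proof -
  have "successively (\<lambda>x y. inv_letter x \<noteq> inv_letter (inv_letter y)) w =
      successively (\<lambda>x y. y \<noteq> inv_letter x) w"
    by (intro arg_cong2[where f = successively] refl ext) auto
  then show ?thesis
    unfolding reduced_def successively_rev successively_map .
qed

lemma reduced_append_iff:
  "reduced (u @ v) \<longleftrightarrow> reduced u \<and> reduced v \<and> (u = [] \<or> v = [] \<or> hd v \<noteq> inv_letter (last u))"
  by (auto simp: reduced_def successively_append_iff)

lemma reduced_append_neq:
  "reduced u \<Longrightarrow> reduced v \<Longrightarrow> fst (hd v) \<noteq> fst (last u) \<Longrightarrow> reduced (u @ v)"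
  by (metis reduced_append_iff fst_inv_letter)

lemma reduced_single [simp]: "reduced [x]"
  by (simp add: reduced_def)

lemma free_group_inv_word:
  "w \<in> carrier (free_group S) \<Longrightarrow> inv\<^bsub>free_group S\<^esub> w = rev (map inv_letter w)"
  by (simp add: free_group_inv reduce_reduced reduced_rev_inv free_group_simps)

lemma cyc_trace_mult_commute:
  "cyc_distinct v \<Longrightarrow> cyc_trace v (u \<otimes>\<^bsub>free_group S\<^esub> w) = cyc_trace v (w \<otimes>\<^bsub>free_group S\<^esub> u)"
  by (simp add: free_group_simps cyc_trace_reduce cyc_trace_append_commute)

lemma cyc_trace_conj:
  assumes "cyc_distinct v" "g \<in> carrier (free_group S)" "w \<in> carrier (free_group S)"
  shows "cyc_trace v (g \<otimes>\<^bsub>free_group S\<^esub> w \<otimes>\<^bsub>free_group S\<^esub> inv\<^bsub>free_group S\<^esub> g) = cyc_trace v w"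
proof -
  interpret F: group "free_group S" by (rule group_free_group)
  have "cyc_trace v (g \<otimes>\<^bsub>free_group S\<^esub> w \<otimes>\<^bsub>free_group S\<^esub> inv\<^bsub>free_group S\<^esub> g) =
      cyc_trace v (inv\<^bsub>free_group S\<^esub> g \<otimes>\<^bsub>free_group S\<^esub> (g \<otimes>\<^bsub>free_group S\<^esub> w))"
    by (rule cyc_trace_mult_commute[OF assms(1)])
  also have "inv\<^bsub>free_group S\<^esub> g \<otimes>\<^bsub>free_group S\<^esub> (g \<otimes>\<^bsub>free_group S\<^esub> w) = w"
    using assms by (simp add: F.m_assoc[symmetric])
  finally show ?thesis .
qed

section \<open>Words with the same cyclic traces\<close>

definition trace_eq :: "('a \<times> bool) list \<Rightarrow> ('a \<times> bool) list \<Rightarrow> bool" where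
  "trace_eq u w \<longleftrightarrow> (\<forall>v. cyc_distinct v \<longrightarrow> cyc_trace v u = cyc_trace v w)"

lemma trace_eq_conj:
  "g \<in> carrier (free_group S) \<Longrightarrow> w \<in> carrier (free_group S) \<Longrightarrow>
    trace_eq (g \<otimes>\<^bsub>free_group S\<^esub> w \<otimes>\<^bsub>free_group S\<^esub> inv\<^bsub>free_group S\<^esub> g) w"
  by (simp add: trace_eq_def cyc_trace_conj)

lemma trace_eq_trans: "trace_eq u v \<Longrightarrow> trace_eq v w \<Longrightarrow> trace_eq u w"
  by (simp add: trace_eq_def)

lemma trace_eq_sym: "trace_eq u v \<Longrightarrow> trace_eq v u"
  by (simp add: trace_eq_def)

text \<open>As its ends differ, \<open>syllables u\<close> is itself an admissible index. Its trace
  is nonzero on u and vanishes on reduced words with fewer syllables.\<close>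

lemma trace_eq_syllables:
  assumes "trace_eq u w" "reduced u" "reduced w" "syllables u \<noteq> []" "hd (syllables u) \<noteq> last (syllables u)"
  shows "length (syllables u) \<le> length (syllables w)"
proof (rule ccontr)
  assume len: "\<not> length (syllables u) \<le> length (syllables w)"
  have cyc: "cyc_distinct (syllables u)" using assms by (intro cyc_distinctI) auto
  have "cyc_trace (syllables u) u \<noteq> 0" using cyc_trace_syllables[OF assms(2) cyc] by simp
  moreover have "cyc_trace (syllables u) w = 0"
    using cyc_trace_syllables[OF assms(3) cyc] len length_rotations[of "syllables w" "syllables u"] by auto
  ultimately show False using assms(1) cyc by (simp add: trace_eq_def)
qed

text \<open>u is a shortest conjugate of w. Every rotation of u is conjugate to w as well, so
  reduction cannot shorten it; this is cyclic reducedness.\<close>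

lemma conj_reduced_rotations:
  assumes w: "w \<in> carrier (free_group S)"
  obtains g u where "g \<in> carrier (free_group S)" "u \<in> carrier (free_group S)"
    "w = g \<otimes>\<^bsub>free_group S\<^esub> u \<otimes>\<^bsub>free_group S\<^esub> inv\<^bsub>free_group S\<^esub> g"
    "\<And>p q. u = p @ q \<Longrightarrow> reduced (q @ p) \<and> trace_eq (q @ p) w"
proof -
  interpret F: group "free_group S" by (rule group_free_group)
  let ?m = "\<lambda>u v. u \<otimes>\<^bsub>free_group S\<^esub> v" and ?i = "\<lambda>u. inv\<^bsub>free_group S\<^esub> u"
  let ?P = "\<lambda>g. g \<in> carrier (free_group S)"
  let ?c = "\<lambda>g. ?m (?m (?i g) w) g"
  obtain g where g: "?P g" and min: "\<And>g'. ?P g' \<Longrightarrow> length (?c g) \<le> length (?c g')"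
    using arg_min_nat_lemma[of ?P "\<one>\<^bsub>free_group S\<^esub>" "\<lambda>g. length (?c g)"] F.one_closed by blast
  define u where "u = ?c g"
  have uc: "?P u" using g w by (simp add: u_def)
  have "?m (?m g u) (?i g) = w"
  proof -
    have "?m g u = ?m w g" using g w by (simp add: u_def F.m_assoc[symmetric])
    then show ?thesis using g w by (simp add: F.m_assoc)
  qed
  note wu = this[symmetric]
  have "reduced (q @ p) \<and> trace_eq (q @ p) w" if pq: "u = p @ q" for p q
  proof -
    have p: "?P p" and q: "?P q" using uc unfolding pq by (auto simp: free_group_simps reduced_append_iff)
    have u: "u = ?m p q" using uc pq by (simp add: free_group_simps reduce_reduced)
    have "?c (?m g p) = ?m (?m (?i p) u) p"
      using g p w by (simp add: u_def F.inv_mult_group F.m_assoc)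
    also have "\<dots> = ?m q p" unfolding u using p q by (simp add: F.m_assoc[symmetric])
    finally have c: "?c (?m g p) = ?m q p" .
    have "length u \<le> length (?m q p)" using min[of "?m g p"] g p by (simp add: c u_def)
    then have red: "reduce (q @ p) = q @ p"
      using pq by (intro length_reduce_eq) (simp add: free_group_simps)
    then have qp: "q @ p = ?m q p" by (simp add: free_group_simps)
    have "trace_eq (?m q p) (?m p q)" by (simp add: trace_eq_def cyc_trace_mult_commute)
    then have "trace_eq (q @ p) u" using u qp by simp
    moreover have "trace_eq u w"
      using trace_eq_sym[OF trace_eq_conj[OF g uc]] wu by simp
    ultimately show ?thesis using red by (metis reduced_reduce trace_eq_trans)
  qed
  then show thesis using that[OF g uc wu] by blast
qed

text \<open>Pass to a cyclically reduced conjugate u. If it had more than one block, moving the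
  first block to the end would give a word with different ends and at least two syllables, against
  the single syllable of \<open>gen s\<close>. So u is a power of one generator, and the coefficient
  of s fixes the exponent to 1.\<close>

lemma trace_eq_gen_conj:
  assumes w: "w \<in> carrier (free_group S)" and tr: "trace_eq w (gen s)"
  obtains g where "g \<in> carrier (free_group S)" 
    "w = g \<otimes>\<^bsub>free_group S\<^esub> gen s \<otimes>\<^bsub>free_group S\<^esub> inv\<^bsub>free_group S\<^esub> g"
proof -
  obtain g u where gu: "g \<in> carrier (free_group S)" "u \<in> carrier (free_group S)"
    "w = g \<otimes>\<^bsub>free_group S\<^esub> u \<otimes>\<^bsub>free_group S\<^esub> inv\<^bsub>free_group S\<^esub> g"
    and rot: "\<And>p q. u = p @ q \<Longrightarrow> reduced (q @ p) \<and> trace_eq (q @ p) w"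
    using conj_reduced_rotations[OF w] by blast
  have tu: "reduced u" "trace_eq u (gen s)" using rot[of "[]" u] trace_eq_trans[OF _ tr] by auto
  have cs: "cyc_distinct [s]" by (auto simp: cyc_distinct_def rotations_def)
  have "rotations [s] = {[s]}" by (auto simp: rotations_def)
  then have ms: "magnus [s] u = 1" using tu(2) cs by (auto simp: trace_eq_def cyc_trace_def)
  have "u = gen s"
  proof (cases u)
    case Nil
    then show ?thesis using ms by simp
  next
    case (Cons x u')
    obtain e r where u: "u = replicate (Suc e) x @ r" and r: "reduced r" "r = [] \<or> fst (hd r) \<noteq> fst x"
      using tu(1) reduced_block unfolding Cons by metis
    have "r = []"
    proof (rule ccontr)
      assume r0: "r \<noteq> []"
      let ?q = "r @ replicate (Suc e) x"
      have q: "reduced ?q" "trace_eq ?q (gen s)"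
        using rot[OF u] trace_eq_trans[OF _ tr] by blast+
      have "hd (syllables ?q) = fst (hd r)" "last (syllables ?q) = fst x"
        using r0 by (simp_all add: syllables_def hd_map last_map del: replicate_Suc)
      moreover have ne: "syllables ?q \<noteq> []" by (simp add: syllables_def)
      ultimately have ne2: "hd (syllables ?q) \<noteq> last (syllables ?q)" using r r0 by auto
      have "length (syllables ?q) \<le> length (syllables (gen s))"
        by (rule trace_eq_syllables[OF q(2) q(1) _ ne ne2]) (simp add: reduced_def)
      then have "length (syllables ?q) = 1" using ne by (simp add: syllables_def Suc_le_eq le_Suc_eq)
      then show False using ne2 by (auto simp: length_Suc_conv)
    qed
    moreover have "magnus [s] u = (if s = fst x then (if snd x then 1 else -1) * int (Suc e) else 0)"
      using magnus_replicate[of "[s]" "Suc e" "fst x" "snd x" "[]"] by (simp add: u \<open>r = []\<close> del: replicate_Suc of_nat_Suc)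
    ultimately have "s = fst x" "snd x" "e = 0" using ms by (auto split: if_splits)
    then show ?thesis using u \<open>r = []\<close> by (cases x) simp
  qed
  then show thesis using that gu by simp
qed

text \<open>The twisted product is cyclically reduced and has more syllables than \<open>x\<^sub>a x\<^sub>b\<close>, which the cyclic
  traces detect.\<close>

lemma no_twist:
  assumes g: "g \<in> carrier (free_group S)" "g \<noteq> []" "fst (hd g) \<noteq> a" "fst (last g) \<noteq> b"
    and ab: "a \<in> S" "b \<in> S" "a \<noteq> b"
    and tr: "trace_eq (gen a \<otimes>\<^bsub>free_group S\<^esub> (g \<otimes>\<^bsub>free_group S\<^esub> gen b \<otimes>\<^bsub>free_group S\<^esub> inv\<^bsub>free_group S\<^esub> g))
      (gen a \<otimes>\<^bsub>free_group S\<^esub> gen b)"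
  shows False
proof -
  let ?g' = "rev (map inv_letter g)"
  let ?u = "(gen a @ g) @ (gen b @ ?g')"
  have rg: "reduced g" using g by (simp add: free_group_simps)
  have "hd ?g' = inv_letter (last g)" using g(2) by (simp add: hd_rev last_map)
  then have rb: "reduced (gen b @ ?g')"
    using g(4) rg by (intro reduced_append_neq reduced_single) (simp_all add: reduced_rev_inv)
  have ra: "reduced (gen a @ g)"
    using g(3) rg by (intro reduced_append_neq reduced_single) simp_all
  have ru: "reduced ?u"
    by (rule reduced_append_neq[OF ra rb]) (use g(2,4) in simp)
  have rgb: "reduce (gen a @ gen b) = [(a, True), (b, True)]"
    using ab by (simp add: reduce_def inv_letter_def)
  have "gen a \<otimes>\<^bsub>free_group S\<^esub> (g \<otimes>\<^bsub>free_group S\<^esub> gen b \<otimes>\<^bsub>free_group S\<^esub> inv\<^bsub>free_group S\<^esub> g) = reduce ?u"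
    by (simp only: free_group_inv_word[OF g(1)] free_group_simps(2) reduce_append_reduce1 reduce_append_reduce2 append_assoc)
  then have tr': "trace_eq ?u [(a, True), (b, True)]"
    using tr by (simp add: reduce_reduced[OF ru] free_group_simps(2) rgb del: append_assoc append.simps)
  have syl: "syllables ?u = [a] @ remdups_adj (map fst g) @ remdups_adj (b # map fst ?g')"
  proof -
    have "syllables ?u = remdups_adj (map fst (gen a @ g)) @ remdups_adj (map fst (gen b @ ?g'))"
      unfolding syllables_def map_append[of fst "gen a @ g"]
      using g by (intro remdups_adj_append') (auto simp: last_map)
    also have "remdups_adj (map fst (gen a @ g)) = remdups_adj [a] @ remdups_adj (map fst g)"
      using g remdups_adj_append'[of "[a]" "map fst g"] by (auto simp: hd_map)
    finally show ?thesis by simp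
  qed
  have "length (syllables ?u) \<le> length (syllables [(a, True), (b, True)])"
  proof (rule trace_eq_syllables[OF tr' ru])
    show "reduced [(a, True), (b, True)]" using ab by (simp add: reduced_def inv_letter_def)
    show "syllables ?u \<noteq> []" using syl by simp
    have "last (syllables ?u) = fst (hd g)"
      using g(2) by (simp add: syllables_def last_rev hd_map last_map)
    then show "hd (syllables ?u) \<noteq> last (syllables ?u)" using g(3) syl by simp
  qed
  also have "\<dots> \<le> 2" by (simp add: syllables_def)
  finally have "Suc (length (remdups_adj (map fst g)) + length (remdups_adj (b # map fst ?g'))) \<le> 2"
    using syl by simp
  moreover have "length (remdups_adj (map fst g)) \<ge> Suc 0" "length (remdups_adj (b # map fst ?g')) \<ge> Suc 0"
    using g(2) by (intro remdups_adj_length_ge1; simp)+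
  ultimately show False by linarith
qed

lemma letter_commute_powers:
  assumes "p \<in> carrier (free_group S)" "fst ` set p \<subseteq> {a}" "fst x = a" "a \<in> S"
  shows "p \<otimes>\<^bsub>free_group S\<^esub> [x] = [x] \<otimes>\<^bsub>free_group S\<^esub> p"
  using assms(1,2)
proof (induction p)
  case Nil
  then show ?case using assms by (simp add: free_group_simps reduce_def)
next
  case (Cons y p)
  interpret F: group "free_group S" by (rule group_free_group)
  have p: "p \<in> carrier (free_group S)" using Cons.prems(1) by (auto simp: free_group_simps dest: reduced_ConsD)
  have c: "[x] \<in> carrier (free_group S)" "[y] \<in> carrier (free_group S)"
    using assms Cons.prems by (auto intro!: letter_closed)
  have yp: "y # p = [y] \<otimes>\<^bsub>free_group S\<^esub> p" using Cons.prems(1) by (intro Cons_eq_mult) (simp add: free_group_simps)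
  have "y = x \<or> y = inv_letter x" using Cons.prems(2) assms(3) by (auto simp: inv_letter_def prod_eq_iff)
  then have xy: "[y] \<otimes>\<^bsub>free_group S\<^esub> [x] = [x] \<otimes>\<^bsub>free_group S\<^esub> [y]"
    by (auto simp: free_group_simps reduce_def)
  have "(y # p) \<otimes>\<^bsub>free_group S\<^esub> [x] = [y] \<otimes>\<^bsub>free_group S\<^esub> ([x] \<otimes>\<^bsub>free_group S\<^esub> p)"
    unfolding yp using Cons p c by (simp add: F.m_assoc)
  also have "\<dots> = [x] \<otimes>\<^bsub>free_group S\<^esub> (y # p)"
    unfolding yp using p c xy by (simp add: F.m_assoc[symmetric])
  finally show ?case .
qed

text \<open>Leading letters of g over a commute with \<open>gen a\<close>, so stripping one merely
  conjugates the whole product; these letters make up p. Trailing letters over b commute with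
  \<open>gen b\<close> and disappear. A nonempty g with nothing left to strip contradicts
  \<open>no_twist\<close>.\<close>

lemma conj_gen_by_powers:
  assumes ab: "a \<in> S" "b \<in> S" "a \<noteq> b"
    and "g \<in> carrier (free_group S)"
    and "trace_eq (gen a \<otimes>\<^bsub>free_group S\<^esub> (g \<otimes>\<^bsub>free_group S\<^esub> gen b \<otimes>\<^bsub>free_group S\<^esub> inv\<^bsub>free_group S\<^esub> g))
      (gen a \<otimes>\<^bsub>free_group S\<^esub> gen b)"
  shows "\<exists>p\<in>carrier (free_group S). fst ` set p \<subseteq> {a} \<and>
    g \<otimes>\<^bsub>free_group S\<^esub> gen b \<otimes>\<^bsub>free_group S\<^esub> inv\<^bsub>free_group S\<^esub> g =
    p \<otimes>\<^bsub>free_group S\<^esub> gen b \<otimes>\<^bsub>free_group S\<^esub> inv\<^bsub>free_group S\<^esub> p"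
  using assms(4,5)
proof (induction "length g" arbitrary: g rule: less_induct)
  case less
  interpret F: group "free_group S" by (rule group_free_group)
  let ?m = "\<lambda>u v. u \<otimes>\<^bsub>free_group S\<^esub> v" and ?i = "\<lambda>u. inv\<^bsub>free_group S\<^esub> u"
  let ?c = "\<lambda>g. ?m (?m g (gen b)) (?i g)"
  have gab: "gen a \<in> carrier (free_group S)" "gen b \<in> carrier (free_group S)"
    using ab by (auto intro: gen_closed)
  consider "g = []" | "g \<noteq> []" "fst (hd g) = a" | "g \<noteq> []" "fst (last g) = b"
    | "g \<noteq> []" "fst (hd g) \<noteq> a" "fst (last g) \<noteq> b" by blast
  then show ?case
  proof cases
    case 1
    then show ?thesis using less.prems(1) by (intro bexI[of _ g]) auto
  next
    case 2
    then obtain x g' where gx: "g = x # g'" "fst x = a" by (cases g) auto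
    have g': "g' \<in> carrier (free_group S)" and x: "[x] \<in> carrier (free_group S)"
      using less.prems(1) gx ab by (auto simp: free_group_simps dest: reduced_ConsD intro!: letter_closed)
    have g: "g = ?m [x] g'" unfolding gx using less.prems(1) gx by (intro Cons_eq_mult) (simp add: free_group_simps)
    have cg: "?c g = ?m (?m [x] (?c g')) (?i [x])"
      unfolding g using g' x gab by (simp add: F.inv_mult_group F.m_assoc)
    have xa: "?m (gen a) [x] = ?m [x] (gen a)"
      using letter_commute_powers[OF gab(1) _ gx(2)] ab by simp
    have "?m (gen a) (?c g) = ?m (?m (?m (gen a) [x]) (?c g')) (?i [x])"
      using cg g' x gab by (simp add: F.m_assoc)
    also have "\<dots> = ?m (?m [x] (?m (gen a) (?c g'))) (?i [x])"
      unfolding xa using g' x gab by (simp add: F.m_assoc)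
    finally have "trace_eq (?m (gen a) (?c g)) (?m (gen a) (?c g'))"
      using trace_eq_conj[OF x, of "?m (gen a) (?c g')"] g' gab by simp
    then have "trace_eq (?m (gen a) (?c g')) (?m (gen a) (gen b))"
      using less.prems(2) by (blast intro: trace_eq_trans trace_eq_sym)
    then obtain p where p: "p \<in> carrier (free_group S)" "fst ` set p \<subseteq> {a}" "?c g' = ?c p"
      using less.hyps[of g'] g' gx by auto
    have "?c g = ?c (?m [x] p)"
      using cg p x gab by (simp add: F.inv_mult_group F.m_assoc)
    moreover have "fst ` set (?m [x] p) \<subseteq> {a}"
      using set_reduce[of "[x] @ p"] p(2) gx(2) by (fastforce simp: free_group_simps)
    ultimately show ?thesis using p x by blast
  next
    case 3
    then obtain x g' where gx: "g = g' @ [x]" "fst x = b" by (cases g rule: rev_cases) auto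
    have g': "g' \<in> carrier (free_group S)" and x: "[x] \<in> carrier (free_group S)"
      using less.prems(1) gx ab by (auto simp: free_group_simps reduced_append_iff intro!: letter_closed)
    have g: "g = ?m g' [x]" using less.prems(1) gx by (simp add: free_group_simps reduce_reduced)
    have xb: "?m (gen b) (?i [x]) = ?m (?i [x]) (gen b)"
      using letter_commute_powers[OF gab(2) _ , of b "inv_letter x"] gx(2) ab inv_letter_word[of x S] by simp
    have "?c g = ?m (?m g' [x]) (?m (?m (gen b) (?i [x])) (?i g'))"
      unfolding g using g' x gab by (simp add: F.inv_mult_group F.m_assoc)
    also have "\<dots> = ?m g' (?m (?m [x] (?i [x])) (?m (gen b) (?i g')))"
      unfolding xb using g' x gab by (simp only: F.m_assoc F.m_closed F.inv_closed)
    also have "\<dots> = ?c g'" using g' x gab by (simp add: F.m_assoc)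
    finally have "?c g = ?c g'" .
    then show ?thesis using less.hyps[of g'] less.prems g' gx by auto
  next
    case 4
    then show ?thesis using no_twist[OF less.prems(1) 4 ab less.prems(2)] by blast
  qed
qed

section \<open>From conjugated generators to inner automorphisms\<close>

lemma AutoGroup_free_eqI:
  assumes "a \<in> carrier (AutoGroup (free_group S))" "b \<in> carrier (AutoGroup (free_group S))"
    and "\<And>s. s \<in> S \<Longrightarrow> a (gen s) = b (gen s)"
  shows "a = b"
proof -
  interpret F: group "free_group S" by (rule group_free_group)
  show ?thesis
  proof (rule F.AutoGroup_eqI[OF assms(1,2)])
    fix x assume x: "x \<in> carrier (free_group S)"
    show "a x = b x"
      using F.hom_free_group_eq_word_eval[OF F.AutoGroup_hom[OF assms(1)] _ x, of "\<lambda>s. b (gen s)"]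
        F.hom_free_group_eq_word_eval[OF F.AutoGroup_hom[OF assms(2)] _ x, of "\<lambda>s. b (gen s)"] assms(3)
      by simp
  qed
qed

definition trace_autos :: "'a set \<Rightarrow> (('a \<times> bool) list \<Rightarrow> ('a \<times> bool) list) set" where
  "trace_autos S = {a \<in> carrier (AutoGroup (free_group S)). \<forall>w\<in>carrier (free_group S). trace_eq (a w) w}"

lemma trace_autos_inner:
  assumes a: "a \<in> trace_autos S" and g: "g \<in> carrier (free_group S)"
  shows "group.inner (free_group S) g \<otimes>\<^bsub>AutoGroup (free_group S)\<^esub> a \<in> trace_autos S"
proof -
  interpret F: group "free_group S" by (rule group_free_group)
  interpret A: group "AutoGroup (free_group S)" by (rule F.AutoGroup)
  have ac: "a \<in> carrier (AutoGroup (free_group S))" using a by (simp add: trace_autos_def)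
  show ?thesis
    using a ac g F.inner_closed[OF g] F.AutoGroup_apply_closed[OF ac]
    by (auto simp: trace_autos_def F.AutoGroup_mult_apply F.inner_apply intro: trace_eq_trans[OF trace_eq_conj])
qed

lemma inner_mult_imp_inner:
  assumes "g \<in> carrier (free_group S)" "a \<in> carrier (AutoGroup (free_group S))"
    "group.inner (free_group S) g \<otimes>\<^bsub>AutoGroup (free_group S)\<^esub> a \<in> inner_autos (free_group S)"
  shows "a \<in> inner_autos (free_group S)"
proof -
  interpret F: group "free_group S" by (rule group_free_group)
  interpret A: group "AutoGroup (free_group S)" by (rule F.AutoGroup)
  interpret N: normal "inner_autos (free_group S)" "AutoGroup (free_group S)"
    by (rule F.inner_autos_normal)
  have "F.inner g \<in> inner_autos (free_group S)" using assms(1) by (auto simp: F.inner_autos_eq)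
  then have "inv\<^bsub>AutoGroup (free_group S)\<^esub> F.inner g \<otimes>\<^bsub>AutoGroup (free_group S)\<^esub>
      (F.inner g \<otimes>\<^bsub>AutoGroup (free_group S)\<^esub> a) \<in> inner_autos (free_group S)"
    using assms(3) by (blast intro: N.m_closed N.m_inv_closed)
  then show ?thesis using assms F.inner_closed[OF assms(1)] by (simp add: A.m_assoc[symmetric])
qed

lemma trace_autos_conj:
  assumes "a \<in> trace_autos S" "s \<in> S"
  obtains g where "g \<in> carrier (free_group S)"
    "a (gen s) = g \<otimes>\<^bsub>free_group S\<^esub> gen s \<otimes>\<^bsub>free_group S\<^esub> inv\<^bsub>free_group S\<^esub> g"
proof -
  interpret F: group "free_group S" by (rule group_free_group)
  show thesis
    using trace_eq_gen_conj[of "a (gen s)" S s] assms gen_closed[OF assms(2)] F.AutoGroup_apply_closed that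
    unfolding trace_autos_def by blast
qed

text \<open>The test word is x_s x_t: its image is x_s times a conjugate of x_t, and preservation of
  its traces restricts the conjugator.\<close>

lemma trace_autos_conj_powers:
  assumes a: "a \<in> trace_autos S" and st: "s \<in> S" "t \<in> S" "s \<noteq> t" and fix_s: "a (gen s) = gen s"
  obtains p where "p \<in> carrier (free_group S)" "fst ` set p \<subseteq> {s}"
    "a (gen t) = p \<otimes>\<^bsub>free_group S\<^esub> gen t \<otimes>\<^bsub>free_group S\<^esub> inv\<^bsub>free_group S\<^esub> p"
proof -
  interpret F: group "free_group S" by (rule group_free_group)
  have ac: "a \<in> carrier (AutoGroup (free_group S))" using a by (simp add: trace_autos_def)
  obtain g where g: "g \<in> carrier (free_group S)"
    "a (gen t) = g \<otimes>\<^bsub>free_group S\<^esub> gen t \<otimes>\<^bsub>free_group S\<^esub> inv\<^bsub>free_group S\<^esub> g"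
    using trace_autos_conj[OF a st(2)] by blast
  have "trace_eq (a (gen s \<otimes>\<^bsub>free_group S\<^esub> gen t)) (gen s \<otimes>\<^bsub>free_group S\<^esub> gen t)"
    using a st by (simp add: trace_autos_def gen_closed)
  then have "trace_eq (gen s \<otimes>\<^bsub>free_group S\<^esub> (g \<otimes>\<^bsub>free_group S\<^esub> gen t \<otimes>\<^bsub>free_group S\<^esub> inv\<^bsub>free_group S\<^esub> g))
      (gen s \<otimes>\<^bsub>free_group S\<^esub> gen t)"
    using F.AutoGroup_apply_mult[OF ac gen_closed[OF st(1)] gen_closed[OF st(2)]] fix_s g(2) by simp
  from conj_gen_by_powers[OF st g(1) this] show thesis using that g(2) by auto
qed

text \<open>Correct a by inner automorphisms: first make it fix x_s, then, by a power of x_s, which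
  does not disturb x_s, also some x_t. Any other x_r is then conjugated by a power q of x_s. The
  test word x_t x_r forces q = 1, because a nonempty q begins and ends with s, which is neither t
  nor r.\<close>

theorem trace_autos_subset_inner:
  assumes "a \<in> trace_autos S"
  shows "a \<in> inner_autos (free_group S)"
proof (cases "S = {}")
  case True
  interpret F: group "free_group S" by (rule group_free_group)
  have "a = F.inner \<one>\<^bsub>free_group S\<^esub>"
  proof (rule AutoGroup_free_eqI[OF _ F.inner_closed[OF F.one_closed]])
    show "a \<in> carrier (AutoGroup (free_group S))" using assms by (simp add: trace_autos_def)
  qed (use True in simp)
  then show ?thesis by (simp add: F.inner_autos_eq)
next
  case False
  then obtain s where s: "s \<in> S" by blast
  interpret F: group "free_group S" by (rule group_free_group)
  interpret A: group "AutoGroup (free_group S)" by (rule F.AutoGroup)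
  let ?m = "\<lambda>u v. u \<otimes>\<^bsub>free_group S\<^esub> v" and ?i = "\<lambda>u. inv\<^bsub>free_group S\<^esub> u"
  have inner_id: "b \<in> inner_autos (free_group S)"
    if b: "b \<in> trace_autos S" "b (gen s) = gen s" "\<And>r. r \<in> S \<Longrightarrow> r \<noteq> s \<Longrightarrow> b (gen r) = gen r" for b
  proof -
    have "b = F.inner \<one>\<^bsub>free_group S\<^esub>"
    proof (rule AutoGroup_free_eqI)
      show "b \<in> carrier (AutoGroup (free_group S))" using b by (simp add: trace_autos_def)
      fix r assume r: "r \<in> S"
      then show "b (gen r) = F.inner \<one>\<^bsub>free_group S\<^esub> (gen r)"
        using b gen_closed[OF r] by (cases "r = s") (simp_all add: F.inner_apply)
    qed (simp add: F.inner_closed)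
    then show ?thesis by (simp add: F.inner_autos_eq)
  qed
  have fix_s: "b \<in> inner_autos (free_group S)" if b: "b \<in> trace_autos S" "b (gen s) = gen s" for b
  proof (cases "\<exists>t\<in>S. t \<noteq> s")
    case False
    then show ?thesis using inner_id[OF b] by blast
  next
    case True
    then obtain t where t: "t \<in> S" "t \<noteq> s" by blast
    have bc: "b \<in> carrier (AutoGroup (free_group S))" using b by (simp add: trace_autos_def)
    obtain p where p: "p \<in> carrier (free_group S)" "fst ` set p \<subseteq> {s}" "b (gen t) = ?m (?m p (gen t)) (?i p)"
      using trace_autos_conj_powers[OF b(1) s t(1) _ b(2)] t(2) by metis
    define c where "c = F.inner (?i p) \<otimes>\<^bsub>AutoGroup (free_group S)\<^esub> b"
    have cT: "c \<in> trace_autos S" unfolding c_def using p by (intro trace_autos_inner b) auto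
    have cb: "c w = ?m (?m (?i p) (b w)) p" if "w \<in> carrier (free_group S)" for w
      using that p F.AutoGroup_apply_closed[OF bc that] F.inner_closed[of "?i p"] bc
      by (simp add: c_def F.AutoGroup_mult_apply F.inner_apply)
    have gs: "gen s \<in> carrier (free_group S)" "gen t \<in> carrier (free_group S)"
      using s t by (auto intro: gen_closed)
    have pg: "?m p (gen s) = ?m (gen s) p" using letter_commute_powers[OF p(1,2)] s by simp
    have "?m (?m (?i p) (gen s)) p = ?m (?i p) (?m p (gen s))"
      using p gs by (simp only: pg F.m_assoc F.inv_closed)
    also have "\<dots> = gen s" using p gs by (simp add: F.m_assoc[symmetric])
    finally have cs: "c (gen s) = gen s" using cb[OF gs(1)] b(2) by simp
    have ct: "c (gen t) = gen t"
      using cb[OF gs(2)] p gs F.m_assoc[symmetric, of "?i p"] by (simp add: F.m_assoc)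
    have "c (gen r) = gen r" if r: "r \<in> S" "r \<noteq> s" for r
    proof (cases "r = t")
      case False
      obtain q where q: "q \<in> carrier (free_group S)" "fst ` set q \<subseteq> {s}" "c (gen r) = ?m (?m q (gen r)) (?i q)"
        using trace_autos_conj_powers[OF cT s r(1) _ cs] r(2) by metis
      have cc: "c \<in> carrier (AutoGroup (free_group S))" using cT by (simp add: trace_autos_def)
      have gr: "gen r \<in> carrier (free_group S)" using r(1) by (rule gen_closed)
      have "q = []"
      proof (rule ccontr)
        assume q0: "q \<noteq> []"
        have "fst (hd q) = s" "fst (last q) = s" using q(2) q0 by (auto simp: image_subset_iff)
        then have "fst (hd q) \<noteq> t" "fst (last q) \<noteq> r" using t(2) r(2) by auto
        moreover have "trace_eq (c (?m (gen t) (gen r))) (?m (gen t) (gen r))"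
          using cT gs gr by (simp add: trace_autos_def)
        then have "trace_eq (?m (gen t) (?m (?m q (gen r)) (?i q))) (?m (gen t) (gen r))"
          by (simp only: F.AutoGroup_apply_mult[OF cc gs(2) gr] ct q(3))
        ultimately show False
          using no_twist[OF q(1) q0 _ _ t(1) r(1)] False by blast
      qed
      then have "q = \<one>\<^bsub>free_group S\<^esub>" by (simp add: free_group_simps)
      then show ?thesis using q(3) gr by simp
    qed (use ct in simp)
    then have "c \<in> inner_autos (free_group S)" using inner_id[OF cT cs] by blast
    then show ?thesis
      using inner_mult_imp_inner[OF F.inv_closed[OF p(1)] bc] by (simp add: c_def)
  qed
  have ac: "a \<in> carrier (AutoGroup (free_group S))" using assms by (simp add: trace_autos_def)
  obtain g where g: "g \<in> carrier (free_group S)" "a (gen s) = ?m (?m g (gen s)) (?i g)"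
    using trace_autos_conj[OF assms s] by blast
  let ?b = "F.inner (?i g) \<otimes>\<^bsub>AutoGroup (free_group S)\<^esub> a"
  have gs: "gen s \<in> carrier (free_group S)" using s by (rule gen_closed)
  have "?b (gen s) = ?m (?m (?i g) (a (gen s))) g"
    using g gs F.AutoGroup_apply_closed[OF ac gs] F.inner_closed[of "?i g"] ac
    by (simp add: F.AutoGroup_mult_apply F.inner_apply)
  also have "\<dots> = ?m (?m (?m (?i g) g) (gen s)) (?m (?i g) g)"
    unfolding g(2) using g(1) gs by (simp only: F.m_assoc F.inv_closed F.m_closed)
  also have "\<dots> = gen s" using g(1) gs by simp
  finally have "?b \<in> inner_autos (free_group S)" using g by (intro fix_s trace_autos_inner assms) auto
  then show ?thesis by (rule inner_mult_imp_inner[OF F.inv_closed[OF g(1)] ac])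
qed

section \<open>Abelianization and the Torelli filtration\<close>

lemma magnus_singleton_inv:
  assumes "u \<in> carrier (free_group S)"
  shows "magnus [i] (inv\<^bsub>free_group S\<^esub> u) = - magnus [i] u"
proof -
  interpret F: group "free_group S" by (rule group_free_group)
  have "magnus [i] (u \<otimes>\<^bsub>free_group S\<^esub> inv\<^bsub>free_group S\<^esub> u) = 0"
    using assms by (simp add: free_group_simps(3))
  then show ?thesis by (simp only: magnus_singleton_mult)
qed

lemma magnus_singleton_hom:
  assumes "finite S" "a \<in> hom (free_group S) (free_group S)" "w \<in> carrier (free_group S)"
  shows "magnus [i] (a w) = (\<Sum>k\<in>S. magnus [i] (a (gen k)) * magnus [k] w)"
  using assms(3)
proof (induction rule: free_group_induct)
  case Nil
  interpret F: group "free_group S" by (rule group_free_group)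
  interpret a: group_hom "free_group S" "free_group S" a
    using assms(2) by unfold_locales
  have "a [] = []" using a.hom_one by (simp add: free_group_simps(3))
  then show ?case by simp
next
  case (Cons x w)
  interpret F: group "free_group S" by (rule group_free_group)
  interpret a: group_hom "free_group S" "free_group S" a
    using assms(2) by unfold_locales
  obtain s b where xb: "x = (s, b)" by (cases x)
  have s: "s \<in> S" using Cons.hyps xb by simp
  have gs: "gen s \<in> carrier (free_group S)" using s by (rule gen_closed)
  have x: "[x] \<in> carrier (free_group S)" using Cons.hyps by (simp add: letter_closed)
  have "magnus [i] (a [x]) = (if b then 1 else -1) * magnus [i] (a (gen s))"
  proof (cases b)
    case False
    then have "[x] = inv\<^bsub>free_group S\<^esub> (gen s)"
      using inv_letter_word[of "(s, True)" S] s xb by (simp add: inv_letter_def)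
    then show ?thesis using False gs magnus_singleton_inv[OF a.hom_closed[OF gs]] by simp
  qed (simp add: xb)
  moreover have "(\<Sum>k\<in>S. magnus [i] (a (gen k)) * magnus [k] [x]) =
      (\<Sum>k\<in>S. if k = s then (if b then 1 else -1) * magnus [i] (a (gen s)) else 0)"
    by (intro sum.cong) (auto simp: xb)
  ultimately have "magnus [i] (a [x]) = (\<Sum>k\<in>S. magnus [i] (a (gen k)) * magnus [k] [x])"
    using s assms(1) by simp
  then show ?case
    using Cons x by (simp only: a.hom_mult magnus_singleton_mult distrib_left sum.distrib)
qed

text \<open>Images of generators are the columns, so that composition becomes the matrix product in
  the same order.\<close>

definition ab_mat :: "nat \<Rightarrow> ((nat \<times> bool) list \<Rightarrow> (nat \<times> bool) list) \<Rightarrow> int mat" where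
  "ab_mat m a = mat m m (\<lambda>(i, j). magnus [i] (a (gen j)))"

lemma ab_mat_carrier [simp]: "ab_mat m a \<in> carrier_mat m m"
  by (simp add: ab_mat_def)

section \<open>Aut and Out of the free group of rank m acting on homology\<close>

context
  fixes m :: nat and F A Ou
  defines "F \<equiv> free_group_rank m" and "A \<equiv> AutoGroup F" and "Ou \<equiv> OutGroup F"
begin

lemma free_group_rank_group: "group F" unfolding F_def by (rule group_free_group)

interpretation F: group F by (rule free_group_rank_group)
interpretation A: group A unfolding A_def by (rule F.AutoGroup)

lemma ab_mat_mult:
  assumes a: "a \<in> carrier A" and b: "b \<in> carrier A"
  shows "ab_mat m (a \<otimes>\<^bsub>A\<^esub> b) = ab_mat m a * ab_mat m b"
proof (rule eq_matI)
  fix i j assume ij: "i < dim_row (ab_mat m a * ab_mat m b)" "j < dim_col (ab_mat m a * ab_mat m b)"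
  then have m: "i < m" "j < m" by (auto simp: ab_mat_def)
  have gj: "gen j \<in> carrier F" using m unfolding F_def by (intro gen_closed) simp
  have bj: "b (gen j) \<in> carrier F" using b gj unfolding A_def by (rule F.AutoGroup_apply_closed)
  have "magnus [i] ((a \<otimes>\<^bsub>A\<^esub> b) (gen j)) = magnus [i] (a (b (gen j)))"
    using F.AutoGroup_mult_apply[OF a[unfolded A_def] b[unfolded A_def] gj] by (simp add: A_def)
  also have "\<dots> = (\<Sum>k<m. magnus [i] (a (gen k)) * magnus [k] (b (gen j)))"
    using F.AutoGroup_hom[OF a[unfolded A_def]] bj unfolding F_def by (intro magnus_singleton_hom) auto
  finally show "ab_mat m (a \<otimes>\<^bsub>A\<^esub> b) $$ (i, j) = (ab_mat m a * ab_mat m b) $$ (i, j)"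
    using m by (simp add: ab_mat_def scalar_prod_def atLeast0LessThan)
qed (simp_all add: ab_mat_def)

lemma ab_mat_one: "ab_mat m \<one>\<^bsub>A\<^esub> = 1\<^sub>m m"
proof (rule eq_matI)
  fix i j assume "i < dim_row (1\<^sub>m m :: int mat)" "j < dim_col (1\<^sub>m m :: int mat)"
  then have m: "i < m" "j < m" by auto
  then have "gen j \<in> carrier F" unfolding F_def by (intro gen_closed) simp
  then show "ab_mat m \<one>\<^bsub>A\<^esub> $$ (i, j) = 1\<^sub>m m $$ (i, j)"
    using m by (simp add: ab_mat_def A_def F.AutoGroup_one_apply)
qed (simp_all add: ab_mat_def)

lemma ab_mat_hom: "ab_mat m \<in> hom A (GL_int m)"
proof (rule homI)
  fix a assume a: "a \<in> carrier A"
  have "ab_mat m a * ab_mat m (inv\<^bsub>A\<^esub> a) = 1\<^sub>m m" "ab_mat m (inv\<^bsub>A\<^esub> a) * ab_mat m a = 1\<^sub>m m"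
    using a by (simp_all add: ab_mat_one flip: ab_mat_mult)
  then show "ab_mat m a \<in> carrier (GL_int m)"
    unfolding units_of_carrier Units_def ring_mat_simps by (auto intro!: bexI[of _ "ab_mat m (inv\<^bsub>A\<^esub> a)"])
qed (simp add: ab_mat_mult units_of_mult ring_mat_simps)

lemma ab_mat_inner:
  assumes g: "g \<in> carrier F"
  shows "ab_mat m (F.inner g) = 1\<^sub>m m"
proof (rule eq_matI)
  fix i j assume "i < dim_row (1\<^sub>m m :: int mat)" "j < dim_col (1\<^sub>m m :: int mat)"
  then have m: "i < m" "j < m" by auto
  then have "gen j \<in> carrier F" unfolding F_def by (intro gen_closed) simp
  then have "magnus [i] (F.inner g (gen j)) = magnus [i] (gen j)"
    using g magnus_singleton_inv[of g "{..<m}" i] unfolding F.inner_apply[OF \<open>gen j \<in> carrier F\<close>]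
    by (simp add: F_def magnus_singleton_mult del: magnus.simps)
  then show "ab_mat m (F.inner g) $$ (i, j) = 1\<^sub>m m $$ (i, j)"
    using m by (simp add: ab_mat_def)
qed (simp_all add: ab_mat_def)

lemma ab_mat_one_unip:
  assumes a: "a \<in> carrier A" and one: "ab_mat m a = 1\<^sub>m m"
  shows "a \<in> F.unip_autos (Suc 0)"
  unfolding F_def
proof (rule unip_autos_1I)
  show "a \<in> carrier (AutoGroup (free_group_rank m))" using a by (simp add: A_def F_def)
  fix i w assume w: "w \<in> carrier (free_group_rank m)" and i: "i \<in> {..<m}"
  have *: "magnus [i] (a (gen k)) = (if i = k then 1 else 0)" if "k < m" for k
    using arg_cong[OF one, of "\<lambda>M. M $$ (i, k)"] that i by (simp add: ab_mat_def)
  have "magnus [i] (a w) = (\<Sum>k<m. magnus [i] (a (gen k)) * magnus [k] w)"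
    using F.AutoGroup_hom[OF a[unfolded A_def]] w unfolding F_def by (intro magnus_singleton_hom) auto
  also have "\<dots> = (\<Sum>k<m. if k = i then magnus [i] w else 0)"
    by (intro sum.cong) (auto simp: *)
  also have "\<dots> = magnus [i] w" using i by simp
  finally show "magnus [i] (a w) = magnus [i] w" .
qed simp

interpretation N: normal "inner_autos F" A
  unfolding A_def by (rule F.inner_autos_normal)

interpretation O: group Ou unfolding Ou_def by (rule F.group_OutGroup)

lemma Out_simps: "Ou = A Mod inner_autos F" by (simp add: OutGroup_def A_def Ou_def)

lemma out_ab_mat_hom:
  obtains f where "f \<in> hom Ou (GL_int m)" "\<And>C a. C \<in> carrier Ou \<Longrightarrow> a \<in> C \<Longrightarrow> f C = ab_mat m a"
proof -
  have inn: "ab_mat m i = 1\<^sub>m m" "i \<in> carrier A" if "i \<in> inner_autos F" for i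
    using that ab_mat_inner F.inner_closed by (auto simp: F.inner_autos_eq A_def)
  have coset: "ab_mat m b = ab_mat m a" if "b \<in> inner_autos F #>\<^bsub>A\<^esub> a" "a \<in> carrier A" for a b
    using that inn by (auto simp: r_coset_def ab_mat_mult left_mult_one_mat[OF ab_mat_carrier])
  obtain f where f: "f \<in> hom (A Mod inner_autos F) (GL_int m)"
    "\<And>a. a \<in> carrier A \<Longrightarrow> f (inner_autos F #>\<^bsub>A\<^esub> a) = ab_mat m a"
  proof (rule FactGroup_universal[OF ab_mat_hom N.normal_axioms])
    fix x y assume "x \<in> carrier A" "y \<in> carrier A" "inner_autos F #>\<^bsub>A\<^esub> x = inner_autos F #>\<^bsub>A\<^esub> y"
    then show "ab_mat m x = ab_mat m y" using coset A.rcos_self N.subgroup_axioms by metis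
  qed blast
  have "f C = ab_mat m a" if C: "C \<in> carrier Ou" "a \<in> C" for C a
  proof -
    obtain b where b: "b \<in> carrier A" "C = inner_autos F #>\<^bsub>A\<^esub> b"
      using C by (auto simp: Out_simps carrier_FactGroup)
    then show ?thesis using f(2) coset C by simp
  qed
  then show thesis using that f(1) by (simp add: Out_simps)
qed

text \<open>Lets the filtration step \<open>unip_autos_commutator\<close> be carried out on
  representatives.\<close>

lemma Out_commutator:
  assumes "C \<in> carrier Ou" "D \<in> carrier Ou" "a \<in> C" "b \<in> D"
  shows "a \<otimes>\<^bsub>A\<^esub> b \<otimes>\<^bsub>A\<^esub> inv\<^bsub>A\<^esub> a \<otimes>\<^bsub>A\<^esub> inv\<^bsub>A\<^esub> b
    \<in> C \<otimes>\<^bsub>Ou\<^esub> D \<otimes>\<^bsub>Ou\<^esub> inv\<^bsub>Ou\<^esub> C \<otimes>\<^bsub>Ou\<^esub> inv\<^bsub>Ou\<^esub> D"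
proof -
  have i: "inv\<^bsub>A\<^esub> c \<in> inv\<^bsub>Ou\<^esub> Z" if "Z \<in> carrier Ou" "c \<in> Z" for Z c
    using that N.inv_FactGroup[of Z] by (auto simp: Out_simps SET_INV_def)
  have m: "c \<otimes>\<^bsub>A\<^esub> d \<in> Z \<otimes>\<^bsub>Ou\<^esub> W" if "c \<in> Z" "d \<in> W" for c d Z W
    using that by (auto simp: Out_simps set_mult_def)
  show ?thesis using assms by (intro m i)
qed

section \<open>From homology to Aut and Out\<close>

lemma cyc_trace_poly_fun:
  assumes "cyc_distinct v"
  shows "cyc_trace v \<in> F.poly_fun (Suc (length v))"
proof -
  have "(\<lambda>x. \<Sum>v'\<in>rotations v. magnus v' x) \<in> F.poly_fun (Suc (length v))"
  proof (rule F.poly_fun_sum)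
    fix v' assume "v' \<in> rotations v"
    then show "magnus v' \<in> F.poly_fun (Suc (length v))"
      using magnus_poly_fun[of v' "{..<m}"] assms by (simp add: F_def cyc_distinctD length_rotations)
  qed
  then show ?thesis by (simp add: cyc_trace_def[abs_def])
qed

lemma perfect_hom_Aut_trivial:
  assumes "group B" and h: "h \<in> hom B A" and "L \<subseteq> carrier B"
    and "\<And>l. l \<in> L \<Longrightarrow> \<exists>a\<in>L. \<exists>b\<in>L. l = a \<otimes>\<^bsub>B\<^esub> b \<otimes>\<^bsub>B\<^esub> inv\<^bsub>B\<^esub> a \<otimes>\<^bsub>B\<^esub> inv\<^bsub>B\<^esub> b"
    and GL: "\<And>f. f \<in> hom B (GL_int m) \<Longrightarrow> f ` L \<subseteq> {1\<^sub>m m}"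
  shows "h ` L \<subseteq> {\<one>\<^bsub>A\<^esub>}"
proof -
  have "h ` L \<subseteq> F.unip_autos (Suc j)" for j
  proof (rule hom_commutator_descent[OF assms(1) _ h assms(3,4)])
    have "(\<lambda>x. ab_mat m (h x)) \<in> hom B (GL_int m)"
      using hom_compose[OF h ab_mat_hom] by (simp add: o_def)
    from GL[OF this] show "h ` L \<subseteq> F.unip_autos (Suc 0)"
      using ab_mat_one_unip assms(3) h by (auto simp: hom_def)
  qed (use F.unip_autos_commutator A.group_axioms in \<open>simp_all add: A_def\<close>)
  then have "h l \<in> F.unip_autos (Suc j)" if "l \<in> L" for j l using that by blast
  then show ?thesis using unip_autos_Inter[of _ "{..<m}"] by (auto simp: A_def F_def)
qed

text \<open>The coset \<open>h l\<close> has a unipotent representative at every level, but possibly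
  a different one each time, so the levels cannot be intersected as for Aut. For each v a
  representative b of level \<open>length v + 1\<close> preserves \<open>cyc_trace v\<close>; since
  b differs from the fixed representative a by an inner automorphism, a preserves it too.\<close>

lemma perfect_hom_Out_trivial:
  assumes "group B" and h: "h \<in> hom B Ou" and L: "L \<subseteq> carrier B"
    and "\<And>l. l \<in> L \<Longrightarrow> \<exists>a\<in>L. \<exists>b\<in>L. l = a \<otimes>\<^bsub>B\<^esub> b \<otimes>\<^bsub>B\<^esub> inv\<^bsub>B\<^esub> a \<otimes>\<^bsub>B\<^esub> inv\<^bsub>B\<^esub> b"
    and GL: "\<And>f. f \<in> hom B (GL_int m) \<Longrightarrow> f ` L \<subseteq> {1\<^sub>m m}"
  shows "h ` L \<subseteq> {\<one>\<^bsub>Ou\<^esub>}"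
proof -
  define U where "U j = {C \<in> carrier Ou. \<exists>a\<in>C. a \<in> F.unip_autos j}" for j
  obtain f where f: "f \<in> hom Ou (GL_int m)" "\<And>C a. C \<in> carrier Ou \<Longrightarrow> a \<in> C \<Longrightarrow> f C = ab_mat m a"
    using out_ab_mat_hom by blast
  have rep: "\<exists>a\<in>carrier A. C = inner_autos F #>\<^bsub>A\<^esub> a \<and> a \<in> C" if "C \<in> carrier Ou" for C
    using that A.rcos_self N.subgroup_axioms by (auto simp: Out_simps carrier_FactGroup)
  have hc: "h l \<in> carrier Ou" if "l \<in> L" for l using that L h by (auto simp: hom_def)
  have U: "h ` L \<subseteq> U (Suc j)" for j
  proof (rule hom_commutator_descent[OF assms(1) O.group_axioms h assms(3,4)])
    have "(\<lambda>x. f (h x)) \<in> hom B (GL_int m)"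
      using hom_compose[OF h f(1)] by (simp add: o_def)
    note 1 = GL[OF this]
    show "h ` L \<subseteq> U (Suc 0)"
    proof (rule image_subsetI)
      fix l assume l: "l \<in> L"
      obtain a where a: "a \<in> carrier A" "a \<in> h l" using rep[OF hc[OF l]] by blast
      have "ab_mat m a = 1\<^sub>m m" using f(2)[OF hc[OF l] a(2)] 1 l by auto
      then show "h l \<in> U (Suc 0)" using ab_mat_one_unip[OF a(1)] a hc[OF l] by (auto simp: U_def)
    qed
  next
    fix j C D assume "C \<in> U (Suc j)" "D \<in> U (Suc j)"
    then obtain a b where ab: "C \<in> carrier Ou" "D \<in> carrier Ou" "a \<in> C" "b \<in> D"
      "a \<in> F.unip_autos (Suc j)" "b \<in> F.unip_autos (Suc j)" by (auto simp: U_def)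
    then show "C \<otimes>\<^bsub>Ou\<^esub> D \<otimes>\<^bsub>Ou\<^esub> inv\<^bsub>Ou\<^esub> C \<otimes>\<^bsub>Ou\<^esub> inv\<^bsub>Ou\<^esub> D \<in> U (Suc (Suc j))"
      using Out_commutator[OF ab(1-4)] F.unip_autos_commutator[OF ab(5,6)] by (auto simp: U_def A_def)
  qed
  show ?thesis
  proof (rule image_subsetI)
    fix l assume l: "l \<in> L"
    obtain a where a: "a \<in> carrier A" "a \<in> h l" "h l = inner_autos F #>\<^bsub>A\<^esub> a" using rep[OF hc[OF l]] by blast
    have "trace_eq (a w) w" if w: "w \<in> carrier F" for w
      unfolding trace_eq_def
    proof (intro allI impI)
      fix v :: "nat list" assume v: "cyc_distinct v"
      obtain b where b: "b \<in> h l" "b \<in> F.unip_autos (Suc (length v))"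
        using U[of "length v"] l by (auto simp: U_def)
      then obtain g where g: "g \<in> carrier F" "b = F.inner g \<otimes>\<^bsub>A\<^esub> a"
        using a(3) by (auto simp: r_coset_def F.inner_autos_eq)
      have aw: "a w \<in> carrier F" using F.AutoGroup_apply_closed a(1) w by (simp add: A_def)
      have "b w = g \<otimes>\<^bsub>F\<^esub> a w \<otimes>\<^bsub>F\<^esub> inv\<^bsub>F\<^esub> g"
        using g a(1) w aw F.inner_closed[OF g(1)] by (simp add: A_def F.AutoGroup_mult_apply F.inner_apply)
      then have "cyc_trace v (b w) = cyc_trace v (a w)"
        using cyc_trace_conj[OF v] g(1) aw by (simp add: F_def)
      moreover have "cyc_trace v (b w) = cyc_trace v w"
        using F.unip_autosD[OF b(2) cyc_trace_poly_fun[OF v]] w by simp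
      ultimately show "cyc_trace v (a w) = cyc_trace v w" by simp
    qed
    then have "a \<in> inner_autos F"
      using a(1) trace_autos_subset_inner[of a "{..<m}"] by (simp add: trace_autos_def A_def F_def)
    then show "h l \<in> {\<one>\<^bsub>Ou\<^esub>}" using a(3) A.coset_join2[OF a(1) N.subgroup_axioms] by (simp add: Out_simps)
  qed
qed

end

section \<open>Elementary automorphisms of free groups\<close>

definition subst_letter :: "('a \<Rightarrow> ('a \<times> bool) list) \<Rightarrow> 'a \<times> bool \<Rightarrow> ('a \<times> bool) list" where
  "subst_letter f x = (if snd x then f (fst x) else rev (map inv_letter (f (fst x))))"

text \<open>Substitution followed by one reduction, instead of \<open>word_eval\<close>, lets the
  simplifier evaluate elementary automorphisms on explicit words. Relations between them are then
  checked on generators by computation.\<close>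

definition free_endo :: "'a set \<Rightarrow> ('a \<Rightarrow> ('a \<times> bool) list) \<Rightarrow> ('a \<times> bool) list \<Rightarrow> ('a \<times> bool) list" where
  "free_endo S f = (\<lambda>w\<in>carrier (free_group S). reduce (concat (map (subst_letter f) w)))"

lemma free_endo_eq_word_eval:
  assumes "f \<in> S \<rightarrow> carrier (free_group S)" "fst ` set w \<subseteq> S"
  shows "reduce (concat (map (subst_letter f) w)) = word_eval (free_group S) f w"
  using assms(2)
proof (induction w)
  case (Cons x w)
  have f: "f (fst x) \<in> carrier (free_group S)" using assms Cons.prems by auto
  have "letter_eval (free_group S) f x = subst_letter f x"
    using f by (simp add: letter_eval_def subst_letter_def free_group_inv_word)
  then show ?case
    using Cons by (simp add: free_group_simps(2) reduce_append_reduce2 flip: Cons.IH)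
qed (simp add: free_group_simps reduce_def)

lemma free_endo_hom:
  assumes "f \<in> S \<rightarrow> carrier (free_group S)"
  shows "free_endo S f \<in> hom (free_group S) (free_group S)"
proof -
  interpret F: group "free_group S" by (rule group_free_group)
  have eq: "free_endo S f w = word_eval (free_group S) f w" if "w \<in> carrier (free_group S)" for w
    using that assms by (simp add: free_endo_def free_endo_eq_word_eval free_group_simps(1))
  note h = F.word_eval_hom[OF assms]
  show ?thesis using h by (auto simp: hom_def eq)
qed

lemma free_endo_apply:
  "reduced w \<Longrightarrow> fst ` set w \<subseteq> S \<Longrightarrow> free_endo S f w = reduce (concat (map (subst_letter f) w))"
  by (simp add: free_endo_def free_group_simps(1))

lemma free_endo_gen:
  "f \<in> S \<rightarrow> carrier (free_group S) \<Longrightarrow> s \<in> S \<Longrightarrow> free_endo S f (gen s) = f s"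
  by (auto simp: free_endo_apply subst_letter_def reduce_reduced free_group_simps(1) Pi_iff)

lemma free_endo_auto:
  assumes f: "f \<in> S \<rightarrow> carrier (free_group S)" and g: "g \<in> S \<rightarrow> carrier (free_group S)"
    and "\<And>s. s \<in> S \<Longrightarrow> free_endo S f (g s) = gen s" "\<And>s. s \<in> S \<Longrightarrow> free_endo S g (f s) = gen s"
  shows "free_endo S f \<in> carrier (AutoGroup (free_group S))"
proof -
  interpret F: group "free_group S" by (rule group_free_group)
  have id: "a (b x) = x" if ab: "a \<in> hom (free_group S) (free_group S)" "b \<in> hom (free_group S) (free_group S)"
    "\<And>s. s \<in> S \<Longrightarrow> a (b (gen s)) = gen s" and x: "x \<in> carrier (free_group S)" for a b x
  proof -
    have "(\<lambda>x. a (b x)) \<in> hom (free_group S) (free_group S)"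
      using hom_compose[OF ab(2,1)] by (simp add: o_def)
    moreover have "(\<lambda>x. x) \<in> hom (free_group S) (free_group S)" by (auto simp: hom_def)
    ultimately show ?thesis
      using F.hom_free_group_eq_word_eval[of "\<lambda>x. a (b x)" S gen x]
        F.hom_free_group_eq_word_eval[of "\<lambda>x. x" S gen x] ab(3) x by simp
  qed
  show ?thesis
  proof (rule F.AutoGroup_memI[OF free_endo_hom[OF f] free_endo_hom[OF g]])
    show "free_endo S f \<in> extensional (carrier (free_group S))" by (simp add: free_endo_def)
    fix x assume x: "x \<in> carrier (free_group S)"
    show "free_endo S f (free_endo S g x) = x"
      by (rule id[OF free_endo_hom[OF f] free_endo_hom[OF g] _ x]) (simp add: free_endo_gen[OF g] assms(3))
    show "free_endo S g (free_endo S f x) = x"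
      by (rule id[OF free_endo_hom[OF g] free_endo_hom[OF f] _ x]) (simp add: free_endo_gen[OF f] assms(4))
  qed
qed

text \<open>Products of these in the automorphism group act from right to left.\<close>

definition lam :: "'a set \<Rightarrow> 'a \<Rightarrow> 'a \<Rightarrow> ('a \<times> bool) list \<Rightarrow> ('a \<times> bool) list" where
  "lam S i j = free_endo S (\<lambda>s. if s = i then [(j, True), (i, True)] else gen s)"

definition lam_inv :: "'a set \<Rightarrow> 'a \<Rightarrow> 'a \<Rightarrow> ('a \<times> bool) list \<Rightarrow> ('a \<times> bool) list" where
  "lam_inv S i j = free_endo S (\<lambda>s. if s = i then [(j, False), (i, True)] else gen s)"

definition eps :: "'a set \<Rightarrow> 'a \<Rightarrow> ('a \<times> bool) list \<Rightarrow> ('a \<times> bool) list" where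
  "eps S i = free_endo S (\<lambda>s. if s = i then [(i, False)] else gen s)"

definition swp :: "'a set \<Rightarrow> 'a \<Rightarrow> 'a \<Rightarrow> ('a \<times> bool) list \<Rightarrow> ('a \<times> bool) list" where
  "swp S i j = free_endo S (\<lambda>s. if s = i then gen j else if s = j then gen i else gen s)"

lemmas word_simps = free_endo_apply free_group_simps(1) reduced_def inv_letter_def reduce_def subst_letter_def

lemma lam_auto: "i \<in> S \<Longrightarrow> j \<in> S \<Longrightarrow> i \<noteq> j \<Longrightarrow> lam S i j \<in> carrier (AutoGroup (free_group S))"
  unfolding lam_def
  by (rule free_endo_auto[where g = "\<lambda>s. if s = i then [(j, False), (i, True)] else gen s"])
     (auto simp: word_simps)

lemma lam_inv_auto: "i \<in> S \<Longrightarrow> j \<in> S \<Longrightarrow> i \<noteq> j \<Longrightarrow> lam_inv S i j \<in> carrier (AutoGroup (free_group S))"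
  unfolding lam_inv_def
  by (rule free_endo_auto[where g = "\<lambda>s. if s = i then [(j, True), (i, True)] else gen s"])
     (auto simp: word_simps)

lemma eps_auto: "i \<in> S \<Longrightarrow> eps S i \<in> carrier (AutoGroup (free_group S))"
  unfolding eps_def
  by (rule free_endo_auto[where g = "\<lambda>s. if s = i then [(i, False)] else gen s"])
     (auto simp: word_simps)

lemma swp_auto: "i \<in> S \<Longrightarrow> j \<in> S \<Longrightarrow> swp S i j \<in> carrier (AutoGroup (free_group S))"
  unfolding swp_def
  by (rule free_endo_auto[where g = "\<lambda>s. if s = i then gen j else if s = j then gen i else gen s"])
     (auto simp: word_simps)

context
  fixes S :: "'a set" and A
  defines "A \<equiv> AutoGroup (free_group S)"
begin

lemma Aut_free_group: "group A"
  unfolding A_def by (rule group.AutoGroup[OF group_free_group])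

interpretation F: group "free_group S" by (rule group_free_group)
interpretation A: group A by (rule Aut_free_group)

lemma elementary_closed [simp]:
  "i \<in> S \<Longrightarrow> j \<in> S \<Longrightarrow> i \<noteq> j \<Longrightarrow> lam S i j \<in> carrier A"
  "i \<in> S \<Longrightarrow> j \<in> S \<Longrightarrow> i \<noteq> j \<Longrightarrow> lam_inv S i j \<in> carrier A"
  "i \<in> S \<Longrightarrow> eps S i \<in> carrier A"
  "i \<in> S \<Longrightarrow> j \<in> S \<Longrightarrow> swp S i j \<in> carrier A"
  by (simp_all add: A_def lam_auto lam_inv_auto eps_auto swp_auto)

lemma Aut_free_eqI:
  assumes "a \<in> carrier A" "b \<in> carrier A" "\<And>s. s \<in> S \<Longrightarrow> a (gen s) = b (gen s)"
  shows "a = b"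
  using assms unfolding A_def by (rule AutoGroup_free_eqI)

lemma Aut_free_mult_apply:
  "a \<in> carrier A \<Longrightarrow> b \<in> carrier A \<Longrightarrow> w \<in> carrier (free_group S) \<Longrightarrow> (a \<otimes>\<^bsub>A\<^esub> b) w = a (b w)"
  unfolding A_def by (rule F.AutoGroup_mult_apply)

lemma Aut_free_apply_closed: "a \<in> carrier A \<Longrightarrow> w \<in> carrier (free_group S) \<Longrightarrow> a w \<in> carrier (free_group S)"
  unfolding A_def by (rule F.AutoGroup_apply_closed)

lemmas Aut_free_eval = Aut_free_mult_apply Aut_free_apply_closed gen_closed

lemma Aut_free_one_gen: "s \<in> S \<Longrightarrow> \<one>\<^bsub>A\<^esub> (gen s) = gen s"
  unfolding A_def by (simp add: F.AutoGroup_one_apply gen_closed)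

lemmas elementary_defs = lam_def lam_inv_def eps_def swp_def

lemma eps_square: "i \<in> S \<Longrightarrow> eps S i \<otimes>\<^bsub>A\<^esub> eps S i = \<one>\<^bsub>A\<^esub>"
  by (rule Aut_free_eqI) (auto simp: Aut_free_eval Aut_free_one_gen, auto simp: elementary_defs word_simps)

lemma eps_commute: "i \<in> S \<Longrightarrow> j \<in> S \<Longrightarrow> eps S i \<otimes>\<^bsub>A\<^esub> eps S j = eps S j \<otimes>\<^bsub>A\<^esub> eps S i"
  by (rule Aut_free_eqI) (auto simp: Aut_free_eval, auto simp: elementary_defs word_simps)

lemma swp_commute: "swp S i j = swp S j i"
  by (auto simp: swp_def intro!: arg_cong[where f = "free_endo S"])

lemma swp_eps: "i \<in> S \<Longrightarrow> j \<in> S \<Longrightarrow> swp S i j \<otimes>\<^bsub>A\<^esub> eps S i = eps S j \<otimes>\<^bsub>A\<^esub> swp S i j"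
  by (rule Aut_free_eqI) (auto simp: Aut_free_eval, auto simp: elementary_defs word_simps)

lemma swp_eps_other:
  "i \<in> S \<Longrightarrow> j \<in> S \<Longrightarrow> k \<in> S \<Longrightarrow> k \<noteq> i \<Longrightarrow> k \<noteq> j \<Longrightarrow> swp S i j \<otimes>\<^bsub>A\<^esub> eps S k = eps S k \<otimes>\<^bsub>A\<^esub> swp S i j"
  by (rule Aut_free_eqI) (auto simp: Aut_free_eval, auto simp: elementary_defs word_simps)

lemma lam_lam_inv: "i \<in> S \<Longrightarrow> j \<in> S \<Longrightarrow> i \<noteq> j \<Longrightarrow> lam S i j \<otimes>\<^bsub>A\<^esub> lam_inv S i j = \<one>\<^bsub>A\<^esub>"
  by (rule Aut_free_eqI) (auto simp: Aut_free_eval Aut_free_one_gen, auto simp: elementary_defs word_simps)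

lemma inv_lam: "i \<in> S \<Longrightarrow> j \<in> S \<Longrightarrow> i \<noteq> j \<Longrightarrow> inv\<^bsub>A\<^esub> lam S i j = lam_inv S i j"
  by (rule A.inv_unique'[symmetric]) (auto simp: lam_lam_inv intro: A.inv_comm)

text \<open>Conjugation by \<open>eps S j\<close> inverts \<open>lam S i j\<close>; this is written
  without inverses.\<close>

lemma lam_eps_lam:
  "i \<in> S \<Longrightarrow> j \<in> S \<Longrightarrow> i \<noteq> j \<Longrightarrow> lam S i j \<otimes>\<^bsub>A\<^esub> eps S j \<otimes>\<^bsub>A\<^esub> lam S i j = eps S j"
  by (rule Aut_free_eqI) (auto simp: Aut_free_eval, auto simp: elementary_defs word_simps)

lemma lam_eps_commute:
  "i \<in> S \<Longrightarrow> j \<in> S \<Longrightarrow> k \<in> S \<Longrightarrow> i \<noteq> j \<Longrightarrow> k \<noteq> i \<Longrightarrow> k \<noteq> j \<Longrightarrow>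
    lam S i j \<otimes>\<^bsub>A\<^esub> eps S k = eps S k \<otimes>\<^bsub>A\<^esub> lam S i j"
  by (rule Aut_free_eqI) (auto simp: Aut_free_eval, auto simp: elementary_defs word_simps)

text \<open>Conjugation by \<open>eps S i\<close> turns left multiplication of x_i by x_j into right
  multiplication by the inverse of x_j, and left and right multiplications commute. For distinct j
  and k the maps \<open>lam S i j\<close> and \<open>lam S i k\<close> themselves do not.\<close>

lemma lam_rho_commute:
  "i \<in> S \<Longrightarrow> j \<in> S \<Longrightarrow> k \<in> S \<Longrightarrow> i \<noteq> j \<Longrightarrow> i \<noteq> k \<Longrightarrow>
    (eps S i \<otimes>\<^bsub>A\<^esub> lam S i j \<otimes>\<^bsub>A\<^esub> eps S i) \<otimes>\<^bsub>A\<^esub> lam S i k =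
    lam S i k \<otimes>\<^bsub>A\<^esub> (eps S i \<otimes>\<^bsub>A\<^esub> lam S i j \<otimes>\<^bsub>A\<^esub> eps S i)"
  by (rule Aut_free_eqI) (auto simp: Aut_free_eval, auto simp: elementary_defs word_simps)

text \<open>Both sides send x_i to x_k x_j x_i. This is a Steinberg relation free of inverses; it
  serves both for perfectness and for flipping signs.\<close>

lemma lam_braid:
  "i \<in> S \<Longrightarrow> j \<in> S \<Longrightarrow> k \<in> S \<Longrightarrow> i \<noteq> j \<Longrightarrow> j \<noteq> k \<Longrightarrow> i \<noteq> k \<Longrightarrow>
    lam S j k \<otimes>\<^bsub>A\<^esub> lam S i j = lam S i j \<otimes>\<^bsub>A\<^esub> lam S i k \<otimes>\<^bsub>A\<^esub> lam S j k"
  by (rule Aut_free_eqI) (auto simp: Aut_free_eval, auto simp: elementary_defs word_simps)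

lemma lam_commute:
  "i \<in> S \<Longrightarrow> j \<in> S \<Longrightarrow> k \<in> S \<Longrightarrow> l \<in> S \<Longrightarrow> i \<noteq> l \<Longrightarrow> j \<noteq> k \<Longrightarrow> i \<noteq> j \<Longrightarrow> i \<noteq> k \<Longrightarrow> l \<noteq> j \<Longrightarrow>
    lam S j k \<otimes>\<^bsub>A\<^esub> lam S i l = lam S i l \<otimes>\<^bsub>A\<^esub> lam S j k"
  by (rule Aut_free_eqI) (auto simp: Aut_free_eval, auto simp: elementary_defs word_simps)

text \<open>As for 2 by 2 matrices, three transvections make a transposition up to sign. The two
  factors \<open>eps S i\<close> make the third transvection act from the right, and
  \<open>eps S j\<close> repairs the sign.\<close>

lemma swp_eq:
  "i \<in> S \<Longrightarrow> j \<in> S \<Longrightarrow> i \<noteq> j \<Longrightarrow>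
    swp S i j = lam S i j \<otimes>\<^bsub>A\<^esub> lam_inv S j i \<otimes>\<^bsub>A\<^esub> eps S i \<otimes>\<^bsub>A\<^esub> lam_inv S i j \<otimes>\<^bsub>A\<^esub> eps S i \<otimes>\<^bsub>A\<^esub> eps S j"
  by (rule Aut_free_eqI) (auto simp: Aut_free_eval, auto simp: elementary_defs word_simps)

text \<open>The auxiliary index j is where rank at least three enters. The commutators mix
  transvections and inverse transvections, so both kinds have to be expressed.\<close>

lemma lam_commutator:
  assumes "i \<in> S" "j \<in> S" "k \<in> S" "i \<noteq> j" "j \<noteq> k" "i \<noteq> k"
  shows "lam S i k = lam_inv S i j \<otimes>\<^bsub>A\<^esub> lam S j k \<otimes>\<^bsub>A\<^esub> inv\<^bsub>A\<^esub> lam_inv S i j \<otimes>\<^bsub>A\<^esub> inv\<^bsub>A\<^esub> lam S j k"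
    and "lam_inv S i k = lam S j k \<otimes>\<^bsub>A\<^esub> lam_inv S i j \<otimes>\<^bsub>A\<^esub> inv\<^bsub>A\<^esub> lam S j k \<otimes>\<^bsub>A\<^esub> inv\<^bsub>A\<^esub> lam_inv S i j"
proof -
  have inv_inv: "inv\<^bsub>A\<^esub> lam_inv S i j = lam S i j"
    using assms by (simp flip: inv_lam)
  have "lam_inv S i j \<otimes>\<^bsub>A\<^esub> (lam S j k \<otimes>\<^bsub>A\<^esub> lam S i j) =
      (lam_inv S i j \<otimes>\<^bsub>A\<^esub> lam S i j) \<otimes>\<^bsub>A\<^esub> (lam S i k \<otimes>\<^bsub>A\<^esub> lam S j k)"
    using assms by (simp add: lam_braid A.m_assoc)
  also have "lam_inv S i j \<otimes>\<^bsub>A\<^esub> lam S i j = \<one>\<^bsub>A\<^esub>"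
    using assms by (simp flip: inv_lam)
  finally have "lam_inv S i j \<otimes>\<^bsub>A\<^esub> lam S j k \<otimes>\<^bsub>A\<^esub> lam S i j = lam S i k \<otimes>\<^bsub>A\<^esub> lam S j k"
    using assms by (simp add: A.m_assoc)
  then show 1: "lam S i k = lam_inv S i j \<otimes>\<^bsub>A\<^esub> lam S j k \<otimes>\<^bsub>A\<^esub> inv\<^bsub>A\<^esub> lam_inv S i j \<otimes>\<^bsub>A\<^esub> inv\<^bsub>A\<^esub> lam S j k"
    unfolding inv_inv using assms by (simp add: A.m_assoc)
  have "inv\<^bsub>A\<^esub> lam S i k = lam S j k \<otimes>\<^bsub>A\<^esub> lam_inv S i j \<otimes>\<^bsub>A\<^esub> inv\<^bsub>A\<^esub> lam S j k \<otimes>\<^bsub>A\<^esub> inv\<^bsub>A\<^esub> lam_inv S i j"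
    using assms by (subst 1) (simp add: A.inv_mult_group A.m_assoc)
  then show "lam_inv S i k = lam S j k \<otimes>\<^bsub>A\<^esub> lam_inv S i j \<otimes>\<^bsub>A\<^esub> inv\<^bsub>A\<^esub> lam S j k \<otimes>\<^bsub>A\<^esub> inv\<^bsub>A\<^esub> lam_inv S i j"
    using assms by (simp add: inv_lam)
qed

end

section \<open>Nielsen's theorem: generation by elementary automorphisms\<close>

abbreviation word_inv :: "('a \<times> bool) list \<Rightarrow> ('a \<times> bool) list" where
  "word_inv w \<equiv> rev (map inv_letter w)"

lemma word_inv_word_inv [simp]: "word_inv (word_inv w) = w"
  by (simp add: rev_map map_idI)

lemma cancel_decomp:
  assumes "reduced u" "reduced v"
  obtains u' p v' where "u = u' @ word_inv p" "v = p @ v'" "reduced (u' @ v')"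
  using assms
proof (induction v arbitrary: u thesis)
  case Nil
  show ?case by (rule Nil(1)[of u "[]" "[]"]) (use Nil in auto)
next
  case (Cons z v)
  show ?case
  proof (cases "u = [] \<or> z \<noteq> inv_letter (last u)")
    case True
    then show ?thesis
      using Cons.prems by (intro Cons.prems(1)[of u "[]" "z # v"]) (auto simp: reduced_append_iff)
  next
    case False
    then obtain u0 where u0: "u = u0 @ [inv_letter z]"
      by (cases u rule: rev_cases) auto
    have "reduced u0" "reduced v"
      using Cons.prems(2,3) u0 by (auto simp: reduced_append_iff dest: reduced_ConsD)
    then obtain u' p v' where "u0 = u' @ word_inv p" "v = p @ v'" "reduced (u' @ v')"
      using Cons.IH by blast
    then show ?thesis by (intro Cons.prems(1)[of u' "z # p" v']) (auto simp: u0)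
  qed
qed

lemma reduce_cancel: "reduced (u' @ v') \<Longrightarrow> reduce ((u' @ word_inv p) @ (p @ v')) = u' @ v'"
proof -
  assume r: "reduced (u' @ v')"
  have "reduce ((u' @ word_inv p) @ (p @ v')) = reduce (u' @ reduce (reduce (word_inv p @ p) @ v'))"
    by (simp add: reduce_append_reduce1 reduce_append_reduce2)
  also have "\<dots> = reduce (u' @ v')" by (simp add: reduce_inverse_append reduce_append_reduce2)
  finally show ?thesis using r by (simp add: reduce_reduced)
qed

text \<open>Half the loss of length, that is, the number of letters removed from each factor; for
  reduced words the division is exact.\<close>

definition cancellation :: "('a \<times> bool) list \<Rightarrow> ('a \<times> bool) list \<Rightarrow> nat" where
  "cancellation u v = (length u + length v - length (reduce (u @ v))) div 2"

lemma cancellation_eq: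
  assumes "reduced (u' @ v')"
  shows "cancellation (u' @ word_inv p) (p @ v') = length p"
  unfolding cancellation_def reduce_cancel[OF assms] by simp

lemma cancellation_decomp:
  assumes "reduced u" "reduced v"
  obtains u' p v' where "u = u' @ word_inv p" "v = p @ v'" "reduced (u' @ v')"
    "length p = cancellation u v" "reduce (u @ v) = u' @ v'"
  using cancel_decomp[OF assms] cancellation_eq reduce_cancel by metis

lemma cancellation_word_inv:
  assumes "reduced u" "reduced v"
  shows "cancellation (word_inv v) (word_inv u) = cancellation u v"
proof -
  obtain u' p v' where d: "u = u' @ word_inv p" "v = p @ v'" "reduced (u' @ v')"
    "length p = cancellation u v" "reduce (u @ v) = u' @ v'"
    using cancellation_decomp[OF assms] .
  have "reduced (word_inv (u' @ v'))" using d(3) by (simp only: reduced_rev_inv)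
  then have "cancellation (word_inv v' @ word_inv p) (p @ word_inv u') = length p"
    by (intro cancellation_eq) simp
  moreover have "word_inv u = p @ word_inv u'"
    unfolding d(1) using word_inv_word_inv[of p] by simp
  ultimately show ?thesis using d(4) by (simp add: d(2))
qed

text \<open>Free groups have no involutions: the outer letters of such a word are inverse to each
  other and can be stripped, until the middle is an adjacent inverse pair or a letter equal to its
  inverse.\<close>

lemma word_inv_fixed:
  assumes "reduced w" "w = word_inv w"
  shows "w = []"
  using assms
proof (induction "length w" arbitrary: w rule: less_induct)
  case less
  show ?case
  proof (rule ccontr)
    assume "w \<noteq> []"
    then obtain z w' where w: "w = z # w'" by (cases w) auto
    have z: "z \<noteq> inv_letter z" by (simp add: inv_letter_def prod_eq_iff)
    have "last w = inv_letter z" using less.prems(2) w by (metis last_snoc list.simps(9) rev.simps(2))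
    then obtain w'' where w'': "w' = w'' @ [inv_letter z]"
      using w z by (cases w' rule: rev_cases) auto
    have "w'' = word_inv w''" using less.prems(2) by (simp add: w w'')
    moreover have "reduced w''" using less.prems(1) unfolding w w'' by (auto simp: reduced_append_iff dest: reduced_ConsD)
    ultimately have "w'' = []" using less.hyps[of w''] by (simp add: w w'')
    then show False using less.prems(1) by (simp add: w w'' reduced_def)
  qed
qed

text \<open>Otherwise p begins with the uncancelled part u', the rest of p is its own inverse and
  hence empty, and then the reduced square u' v' is its own inverse as well. Minimality will compare
  only letters over different generators, so equal letters need this separate bound.\<close>

lemma cancellation_self:
  assumes "reduced u" "u \<noteq> []"
  shows "2 * cancellation u u < length u"
proof (rule ccontr)
  assume ge: "\<not> 2 * cancellation u u < length u"
  obtain u' p v' where d: "u = u' @ word_inv p" "u = p @ v'" "reduced (u' @ v')"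
    "length p = cancellation u u"
    using cancellation_decomp[OF assms(1,1)] by metis
  have "length u = length u' + length p" "length u = length p + length v'"
    using arg_cong[OF d(1), of length] arg_cong[OF d(2), of length] by simp_all
  then have len: "length u' = length v'" "length u' \<le> length p"
    using ge d(4) by simp_all
  obtain p2 where p2: "p = u' @ p2"
    using d(1,2) len by (metis append_eq_append_conv_if append_take_drop_id)
  have "u' @ p2 @ v' = u' @ word_inv p2 @ word_inv u'"
    using d(1,2) p2 by simp
  then have "p2 @ v' = word_inv p2 @ word_inv u'" by simp
  then have eq: "p2 = word_inv p2" "v' = word_inv u'" by (auto simp: append_eq_append_conv)
  have "reduced p2" using assms(1) unfolding d(2) p2 by (simp add: reduced_append_iff)
  then have "p2 = []" using eq(1) by (rule word_inv_fixed)
  have "word_inv (u' @ v') = u' @ v'" unfolding eq(2) by (simp only: map_append rev_append word_inv_word_inv)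
  from word_inv_fixed[OF d(3) this[symmetric]] have "u' @ v' = []" .
  then show False using d(2) p2 \<open>p2 = []\<close> assms(2) by simp
qed

lemma reduced_glue:
  assumes "reduced (u @ v)" "reduced (v @ w)" "v \<noteq> []"
  shows "reduced (u @ v @ w)"
  using assms by (auto simp: reduced_append_iff)

subsection \<open>Cancellation in long products\<close>

locale letter_images =
  fixes S :: "'a set" and a :: "('a \<times> bool) list \<Rightarrow> ('a \<times> bool) list"
  assumes a: "a \<in> carrier (AutoGroup (free_group S))"
begin

interpretation F: group "free_group S" by (rule group_free_group)

lemma letter_image_closed: "fst x \<in> S \<Longrightarrow> a [x] \<in> carrier (free_group S)"
  by (rule F.AutoGroup_apply_closed[OF a letter_closed])

lemma letter_image_reduced: "fst x \<in> S \<Longrightarrow> reduced (a [x])"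
  using letter_image_closed by (simp add: free_group_simps(1))

lemma letter_image_inv: "fst x \<in> S \<Longrightarrow> a [inv_letter x] = word_inv (a [x])"
  using F.AutoGroup_apply_inv[OF a letter_closed] letter_image_closed
  by (simp add: inv_letter_word free_group_inv_word)

lemma letter_image_nonempty:
  assumes "fst x \<in> S"
  shows "a [x] \<noteq> []"
proof
  assume "a [x] = []"
  then have "a [x] = a \<one>\<^bsub>free_group S\<^esub>"
    unfolding F.AutoGroup_apply_one[OF a] by (simp add: free_group_simps(3))
  then have "[x] = \<one>\<^bsub>free_group S\<^esub>"
    by (rule F.AutoGroup_inj[OF a letter_closed[OF assms] F.one_closed])
  then show False by (simp add: free_group_simps(3))
qed

end

text \<open>The Nielsen condition on triple products: the two neighbours of a letter never absorb
  its image completely.\<close>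

locale short_cancellation = letter_images +
  assumes short: "\<And>x y z. fst x \<in> S \<Longrightarrow> fst y \<in> S \<Longrightarrow> fst z \<in> S \<Longrightarrow> y \<noteq> inv_letter x \<Longrightarrow> z \<noteq> inv_letter y \<Longrightarrow>
      cancellation (a [x]) (a [y]) + cancellation (a [y]) (a [z]) < length (a [y])"
begin

interpretation F: group "free_group S" by (rule group_free_group)

text \<open>Some part of the image of every letter survives in the image of a reduced word.\<close>

lemma image_survives:
  assumes "w @ [x] \<in> carrier (free_group S)"
  shows "\<exists>u k. a (w @ [x]) = u @ drop k (a [x]) \<and> length w \<le> length u \<and>
    (\<forall>y. fst y \<in> S \<longrightarrow> y \<noteq> inv_letter x \<longrightarrow> k + cancellation (a [x]) (a [y]) < length (a [x]))"
  using assms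
proof (induction w arbitrary: x rule: rev_induct)
  case Nil
  then have x: "fst x \<in> S" by (simp add: free_group_simps(1))
  have "cancellation (a [x]) (a [y]) < length (a [x])" if "fst y \<in> S" "y \<noteq> inv_letter x" for y
    using short[of x x y] that x by (simp add: inv_letter_def prod_eq_iff)
  then show ?case by (intro exI[of _ "[]"] exI[of _ 0]) auto
next
  case (snoc y w)
  have c: "w @ [y] \<in> carrier (free_group S)" and y: "fst y \<in> S" and x: "fst x \<in> S" "x \<noteq> inv_letter y"
    using snoc.prems reduced_append_iff[of "w @ [y]" "[x]"] by (auto simp: free_group_simps(1))
  obtain u k where u: "a (w @ [y]) = u @ drop k (a [y])" "length w \<le> length u"
    and k: "\<And>z. fst z \<in> S \<Longrightarrow> z \<noteq> inv_letter y \<Longrightarrow> k + cancellation (a [y]) (a [z]) < length (a [y])"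
    using snoc.IH[OF c] by blast
  obtain y' p x' where d: "a [y] = y' @ word_inv p" "a [x] = p @ x'" "reduced (y' @ x')"
    "length p = cancellation (a [y]) (a [x])"
    using cancellation_decomp[OF letter_image_reduced[OF y] letter_image_reduced[OF x(1)]] by metis
  have ky: "k < length y'" using k[OF x] arg_cong[OF d(1), of length] d(4) by simp
  then have dr: "drop k (a [y]) = drop k y' @ word_inv p" by (simp add: d(1))
  have "(w @ [y]) @ [x] = (w @ [y]) \<otimes>\<^bsub>free_group S\<^esub> [x]"
    using snoc.prems by (simp add: free_group_simps reduce_reduced)
  then have "a ((w @ [y]) @ [x]) = a (w @ [y]) \<otimes>\<^bsub>free_group S\<^esub> a [x]"
    using F.AutoGroup_apply_mult[OF a c letter_closed[OF x(1)]] by simp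
  also have "\<dots> = reduce ((u @ drop k y' @ word_inv p) @ (p @ x'))"
    using u(1) dr d(2) by (simp add: free_group_simps(2))
  \<comment> \<open>The surviving piece \<open>drop k y'\<close> is nonempty, so reducedness on its
    two sides can be glued, and exactly p cancels.\<close>
  also have "\<dots> = (u @ drop k y') @ x'"
  proof -
    have "reduced (a (w @ [y]))" using F.AutoGroup_apply_closed[OF a c] by (simp add: free_group_simps(1))
    then have "reduced (u @ drop k y')" unfolding u(1) dr by (auto simp: reduced_append_iff)
    moreover have "reduced (drop k y' @ x')"
      using d(3) append_take_drop_id[of k y'] by (metis append.assoc reduced_append_iff)
    ultimately have "reduced ((u @ drop k y') @ x')" using ky by (simp add: reduced_glue)
    from reduce_cancel[OF this, of p] show ?thesis by simp
  qed
  also have "x' = drop (length p) (a [x])" by (simp add: d(2))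
  finally have "a ((w @ [y]) @ [x]) = (u @ drop k y') @ drop (length p) (a [x])" .
  moreover have "length (w @ [y]) \<le> length (u @ drop k y')" using u(2) ky by simp
  moreover have "length p + cancellation (a [x]) (a [z]) < length (a [x])"
    if "fst z \<in> S" "z \<noteq> inv_letter x" for z
    using short[OF y x(1) that(1) x(2) that(2)] d(4) by simp
  ultimately show ?case by blast
qed

lemma length_image:
  assumes "w \<in> carrier (free_group S)"
  shows "length w \<le> length (a w)"
proof (cases w rule: rev_cases)
  case (snoc w' x)
  then obtain u k where u: "a w = u @ drop k (a [x])" "length w' \<le> length u"
    and k: "\<And>y. fst y \<in> S \<Longrightarrow> y \<noteq> inv_letter x \<Longrightarrow> k + cancellation (a [x]) (a [y]) < length (a [x])"
    using image_survives[of w' x] assms by blast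
  have "fst x \<in> S" using assms snoc by (simp add: free_group_simps(1))
  then have "k < length (a [x])" using k[of x] by (simp add: inv_letter_def prod_eq_iff)
  then show ?thesis using u snoc by simp
qed simp

text \<open>Since \<open>a\<close> does not shorten words, the preimage of a generator has length
  one.\<close>

lemma letter_preimage:
  assumes "s \<in> S"
  obtains x where "fst x \<in> S" "a [x] = gen s"
proof -
  interpret A: group "AutoGroup (free_group S)" by (rule F.AutoGroup)
  let ?w = "(inv\<^bsub>AutoGroup (free_group S)\<^esub> a) (gen s)"
  have gs: "gen s \<in> carrier (free_group S)" using assms by (rule gen_closed)
  have w: "?w \<in> carrier (free_group S)" "a ?w = gen s"
    using F.AutoGroup_apply_closed[OF A.inv_closed[OF a] gs] F.AutoGroup_inv_apply(2)[OF a gs] by auto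
  have "length ?w \<le> 1" using length_image[OF w(1)] w(2) by simp
  moreover have "?w \<noteq> []"
    using w(2) F.AutoGroup_apply_one[OF a] by (auto simp: free_group_simps(3))
  ultimately obtain x where "?w = [x]" by (cases ?w) auto
  then show thesis using that w by (simp add: free_group_simps(1))
qed

end

subsection \<open>Signed permutations\<close>

definition letter_auto :: "'a set \<Rightarrow> (('a \<times> bool) list \<Rightarrow> ('a \<times> bool) list) \<Rightarrow> bool" where
  "letter_auto S a \<longleftrightarrow> (\<forall>s\<in>S. \<exists>x. fst x \<in> S \<and> a (gen s) = [x])"

lemma eps_letter: "fst x \<in> S \<Longrightarrow> i \<in> S \<Longrightarrow> eps S i [x] = [if fst x = i then inv_letter x else x]"
  by (cases x) (auto simp: eps_def word_simps)

lemma swp_letter: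
  "fst x \<in> S \<Longrightarrow> i \<in> S \<Longrightarrow> j \<in> S \<Longrightarrow>
    swp S i j [x] = [(if fst x = i then j else if fst x = j then i else fst x, snd x)]"
  by (cases x) (auto simp: swp_def word_simps)

lemma letter_auto_generated:
  assumes S: "finite S" and N: "subgroup N (AutoGroup (free_group S))"
    and eps: "\<And>i. i \<in> S \<Longrightarrow> eps S i \<in> N"
    and swp: "\<And>i j. i \<in> S \<Longrightarrow> j \<in> S \<Longrightarrow> i \<noteq> j \<Longrightarrow> swp S i j \<in> N"
    and a: "a \<in> carrier (AutoGroup (free_group S))" "letter_auto S a"
  shows "a \<in> N"
  using a
\<comment> \<open>The first summand counts generators not sent to themselves up to sign, the second
  those not fixed. A swap lowers the first without raising the second; an inversion lowers the
  second once the first is zero.\<close>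
proof (induction "card {s \<in> S. \<forall>b. a (gen s) \<noteq> [(s, b)]} + card {s \<in> S. a (gen s) \<noteq> gen s}"
    arbitrary: a rule: less_induct)
  case less
  interpret F: group "free_group S" by (rule group_free_group)
  interpret A: group "AutoGroup (free_group S)" by (rule F.AutoGroup)
  interpret N: subgroup N "AutoGroup (free_group S)" by (rule N)
  note ac = less.prems(1)
  have step: "a \<in> N" if c: "c \<in> N" "c \<otimes>\<^bsub>AutoGroup (free_group S)\<^esub> a \<in> N" for c
  proof -
    have "inv\<^bsub>AutoGroup (free_group S)\<^esub> c \<otimes>\<^bsub>AutoGroup (free_group S)\<^esub> (c \<otimes>\<^bsub>AutoGroup (free_group S)\<^esub> a) \<in> N"
      using c by blast
    then show ?thesis using N.mem_carrier[OF c(1)] ac by (simp add: A.m_assoc[symmetric])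
  qed
  let ?U = "\<lambda>a. {s \<in> S. \<forall>b. a (gen s) \<noteq> [(s, b)]}" and ?V = "\<lambda>a. {s \<in> S. a (gen s) \<noteq> gen s}"
  have inj: "s = t" if st: "s \<in> S" "t \<in> S" "a (gen s) = [(r, b)]" "a (gen t) = [(r, b')]" for s t r b b'
  proof -
    have g: "gen s \<in> carrier (free_group S)" "gen t \<in> carrier (free_group S)" "[(t, False)] \<in> carrier (free_group S)"
      using st by (auto intro: gen_closed letter_closed)
    have "a [(t, False)] = inv\<^bsub>free_group S\<^esub> (a (gen t))"
      using F.AutoGroup_apply_inv[OF ac g(2)] inv_letter_word[of "(t, True)" S] st by (simp add: inv_letter_def)
    also have "\<dots> = [(r, \<not> b')]"
      using free_group_inv_word[OF F.AutoGroup_apply_closed[OF ac g(2)]] st(4) by (simp add: inv_letter_def)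
    finally have "a (gen s) = a (gen t) \<or> a (gen s) = a [(t, False)]" using st by auto
    then have "gen s = gen t \<or> gen s = [(t, False)]" using F.AutoGroup_inj[OF ac] g by metis
    then show ?thesis by auto
  qed
  consider "?V a = {}" | "?V a \<noteq> {}" "?U a = {}" | "?U a \<noteq> {}" by blast
  then show ?case
  proof cases
    case 1
    then have "a = \<one>\<^bsub>AutoGroup (free_group S)\<^esub>"
      using ac by (intro AutoGroup_free_eqI) (auto simp: F.AutoGroup_one_apply gen_closed)
    then show ?thesis by simp
  next
    case 2
    then obtain s where s: "s \<in> S" "a (gen s) \<noteq> gen s" by blast
    have im: "\<exists>b. a (gen r) = [(r, b)]" if "r \<in> S" for r using 2 that by blast
    have as: "a (gen s) = [(s, False)]" using im[OF s(1)] s(2) by auto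
    let ?c = "eps S s \<otimes>\<^bsub>AutoGroup (free_group S)\<^esub> a"
    have c: "?c (gen r) = (if r = s then gen s else a (gen r))" if r: "r \<in> S" for r
    proof -
      have "?c (gen r) = eps S s (a (gen r))"
        using F.AutoGroup_mult_apply[OF eps_auto[OF s(1)] ac gen_closed[OF r]] .
      then show ?thesis using im[OF r] as r s(1) by (auto simp: eps_letter inv_letter_def)
    qed
    have cc: "?c \<in> carrier (AutoGroup (free_group S))" using ac s by (simp add: eps_auto)
    have "\<exists>b. ?c (gen r) = [(r, b)]" if "r \<in> S" for r
      using c[OF that] im[OF that] by (cases "r = s") auto
    then have "?U ?c = {}" by blast
    moreover have "?V ?c \<subseteq> ?V a - {s}" using c s by (auto split: if_splits)
    then have "?V ?c \<subset> ?V a" using s by blast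
    then have "card (?V ?c) < card (?V a)" using S by (intro psubset_card_mono) auto
    moreover have "letter_auto S ?c"
      using less.prems(2) c s(1) by (auto simp: letter_auto_def)
    ultimately have "?c \<in> N" using less.hyps[OF _ cc] 2 by (metis (no_types, lifting) card.empty add_0)
    then show ?thesis using step[OF eps[OF s(1)]] by blast
  next
    case 3
    then obtain s where s: "s \<in> S" "\<And>b. a (gen s) \<noteq> [(s, b)]" by blast
    obtain t b where t: "t \<in> S" "a (gen s) = [(t, b)]"
      using less.prems(2) s(1) by (fastforce simp: letter_auto_def)
    have ts: "t \<noteq> s" using t s by auto
    let ?c = "swp S s t \<otimes>\<^bsub>AutoGroup (free_group S)\<^esub> a"
    have c: "?c (gen r) = swp S s t (a (gen r))" if r: "r \<in> S" for r
      using F.AutoGroup_mult_apply[OF swp_auto[OF s(1) t(1)] ac gen_closed[OF r]] .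
    have cs: "?c (gen s) = [(s, b)]" using c[OF s(1)] t s(1) ts by (simp add: swp_letter)
    have cr: "?c (gen r) = [(r, b')]" if r: "r \<in> S" "a (gen r) = [(r, b')]" for r b'
    proof -
      have "r \<noteq> s" using s(2) r by auto
      moreover have "r \<noteq> t" using inj[OF s(1) r(1) t(2)] r(2) \<open>r \<noteq> s\<close> by auto
      ultimately show ?thesis using c[OF r(1)] r s(1) t(1) by (simp add: swp_letter)
    qed
    have cc: "?c \<in> carrier (AutoGroup (free_group S))" using ac s t by (simp add: swp_auto)
    have "?U ?c \<subset> ?U a" using s cs cr by blast
    then have "card (?U ?c) < card (?U a)" using S by (intro psubset_card_mono) auto
    moreover have "?V ?c \<subseteq> ?V a" using cr by blast
    then have "card (?V ?c) \<le> card (?V a)" using S by (intro card_mono) auto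
    moreover have "letter_auto S ?c"
      unfolding letter_auto_def
    proof
      fix r assume r: "r \<in> S"
      then obtain x where x: "fst x \<in> S" "a (gen r) = [x]" using less.prems(2) by (auto simp: letter_auto_def)
      have "?c (gen r) = [(if fst x = s then t else if fst x = t then s else fst x, snd x)]"
        using c[OF r] swp_letter[OF x(1) s(1) t(1)] x(2) by simp
      then show "\<exists>x. fst x \<in> S \<and> ?c (gen r) = [x]" using x(1) s(1) t(1) by auto
    qed
    ultimately have "?c \<in> N" using less.hyps[OF _ cc] by (metis (no_types, lifting) add_less_le_mono)
    then show ?thesis using step[OF swp[OF s(1) t(1)]] ts by blast
  qed
qed

subsection \<open>Minimal representatives\<close>

text \<open>Digits in base B: for letter codes below B this is the lexicographic order on words of
  one length, coded in \<open>nat\<close> so that it can enter a \<open>measures\<close>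
  relation.\<close>

definition word_code :: "('a \<times> bool \<Rightarrow> nat) \<Rightarrow> nat \<Rightarrow> ('a \<times> bool) list \<Rightarrow> nat" where
  "word_code c B w = foldl (\<lambda>n x. n * B + c x) 0 w"

lemma word_code_append: "word_code c B (u @ v) = word_code c B u * B ^ length v + word_code c B v"
proof -
  have "foldl (\<lambda>n x. n * B + c x) n v = n * B ^ length v + word_code c B v" for n
    unfolding word_code_def by (induction v rule: rev_induct) (auto simp: algebra_simps)
  from this[of "word_code c B u"] show ?thesis
    by (simp only: word_code_def[of c B "u @ v"] word_code_def[of c B u] foldl_append)
qed

lemma word_code_inj:
  assumes "inj_on c L" "\<And>x. x \<in> L \<Longrightarrow> c x < B"
  shows "length u = length v \<Longrightarrow> set u \<subseteq> L \<Longrightarrow> set v \<subseteq> L \<Longrightarrow>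
    word_code c B u = word_code c B v \<Longrightarrow> u = v"
proof (induction u arbitrary: v rule: rev_induct)
  case (snoc x u)
  obtain v' y where v: "v = v' @ [y]" using snoc.prems(1) by (cases v rule: rev_cases) auto
  have xy: "x \<in> L" "y \<in> L" using snoc.prems v by auto
  have eq: "word_code c B u * B + c x = word_code c B v' * B + c y"
    using snoc.prems(4) v by (simp add: word_code_def)
  have "c x = (word_code c B u * B + c x) mod B" "word_code c B u = (word_code c B u * B + c x) div B"
    "c y = (word_code c B v' * B + c y) mod B" "word_code c B v' = (word_code c B v' * B + c y) div B"
    using assms(2)[OF xy(1)] assms(2)[OF xy(2)] by auto
  then have "c x = c y" "word_code c B u = word_code c B v'" using eq by metis+
  then show ?case using snoc v xy assms(1) by (auto dest: inj_onD)
qed simp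

text \<open>The tie-breaker of Nielsen reduction: it looks only at the initial halves of a word and of its
  inverse, so that replacing a short suffix changes only one of the two summands.\<close>

definition half_weight :: "('a \<times> bool \<Rightarrow> nat) \<Rightarrow> nat \<Rightarrow> ('a \<times> bool) list \<Rightarrow> nat" where
  "half_weight c B w = word_code c B (take (length w div 2) w) + word_code c B (take (length w div 2) (word_inv w))"

lemma half_weight_word_inv: "half_weight c B (word_inv w) = half_weight c B w"
  unfolding half_weight_def word_inv_word_inv by simp

text \<open>The suffix \<open>word_inv p\<close> is at most half of the word. So it stays outside
  the initial half of the word, while p supplies the leading digits for the initial half of the
  inverse.\<close>

lemma half_weight_less:
  assumes "length p = length q" "2 * length p \<le> length (u @ word_inv p)" "B > 0"
    and "word_code c B q < word_code c B p"
  shows "half_weight c B (u @ word_inv q) < half_weight c B (u @ word_inv p)"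
proof -
  define h where "h = length (u @ word_inv p) div 2"
  have h: "length (u @ word_inv q) div 2 = h" "h \<le> length u" "length p \<le> h"
    using assms by (auto simp: h_def)
  have t: "take h (u @ word_inv p') = take h u" for p' using h(2) by simp
  have i: "take h (word_inv (u @ word_inv p')) = p' @ take (h - length p') (word_inv u)" if "length p' = length p" for p'
  proof -
    have "word_inv (u @ word_inv p') = p' @ word_inv u" using word_inv_word_inv[of p'] by simp
    then show ?thesis using h(3) that by simp
  qed
  have "half_weight c B (u @ word_inv q) =
      word_code c B (take h u) + word_code c B (q @ take (h - length q) (word_inv u))"
    unfolding half_weight_def h(1) t i[OF assms(1)[symmetric]] ..
  moreover have "half_weight c B (u @ word_inv p) =
      word_code c B (take h u) + word_code c B (p @ take (h - length p) (word_inv u))"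
    unfolding half_weight_def h_def[symmetric] t i[OF refl] ..
  ultimately show ?thesis using assms by (simp add: word_code_append)
qed

lemma length_reduce_append:
  assumes "reduced u" "reduced v"
  shows "length (reduce (u @ v)) + 2 * cancellation u v = length u + length v"
    "cancellation u v \<le> length u" "cancellation u v \<le> length v"
proof -
  obtain u' p v' where d: "u = u' @ word_inv p" "v = p @ v'" "reduced (u' @ v')"
    "length p = cancellation u v" "reduce (u @ v) = u' @ v'"
    using cancellation_decomp[OF assms] .
  have l: "length u = length u' + length p" "length v = length p + length v'"
    unfolding d(1,2) by simp_all
  then show "length (reduce (u @ v)) + 2 * cancellation u v = length u + length v"
    "cancellation u v \<le> length u" "cancellation u v \<le> length v"
    unfolding d(5) using d(4) by simp_all
qed

text \<open>No move from the image of x to that of xy lowers the pair of length and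
  \<open>half_weight\<close> lexicographically. As x and y carry both signs, multiplications from
  the left are included.\<close>

locale nielsen_minimal = letter_images S a
  for S :: "'a set" and a +
  fixes c :: "'a \<times> bool \<Rightarrow> nat" and B :: nat
  assumes c: "inj_on c (S \<times> UNIV)" "\<And>x. fst x \<in> S \<Longrightarrow> c x < B"
    and minimal: "\<And>x y. fst x \<in> S \<Longrightarrow> fst y \<in> S \<Longrightarrow> fst x \<noteq> fst y \<Longrightarrow>
      length (a [x]) < length (reduce (a [x] @ a [y])) \<or>
      length (a [x]) = length (reduce (a [x] @ a [y])) \<and>
        half_weight c B (a [x]) \<le> half_weight c B (reduce (a [x] @ a [y]))"
begin

text \<open>For different generators, minimal length bounds the cancellation by half of
  \<open>a [y]\<close>; the bound by half of \<open>a [x]\<close> is the same statement for the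
  inverse letters in reverse order. Equal letters are covered by
  \<open>cancellation_self\<close>.\<close>

lemma cancellation_half:
  assumes x: "fst x \<in> S" and y: "fst y \<in> S" "y \<noteq> inv_letter x"
  shows "2 * cancellation (a [x]) (a [y]) \<le> length (a [x])"
    "2 * cancellation (a [x]) (a [y]) \<le> length (a [y])"
    "fst x = fst y \<Longrightarrow> 2 * cancellation (a [x]) (a [y]) < length (a [y])"
proof -
  note rx = letter_image_reduced[OF x] and ry = letter_image_reduced[OF y(1)]
  have same: "2 * cancellation (a [x]) (a [y]) < length (a [y]) \<and> y = x" if "fst x = fst y"
  proof -
    have "y = x" using that y(2) by (auto simp: inv_letter_def prod_eq_iff)
    then show ?thesis using cancellation_self[OF rx letter_image_nonempty[OF x]] by simp
  qed
  then show "fst x = fst y \<Longrightarrow> 2 * cancellation (a [x]) (a [y]) < length (a [y])" by blast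
  have diff: "2 * cancellation (a [x]) (a [y]) \<le> length (a [y])" "2 * cancellation (a [x]) (a [y]) \<le> length (a [x])"
    if ne: "fst x \<noteq> fst y"
  proof -
    show "2 * cancellation (a [x]) (a [y]) \<le> length (a [y])"
      using minimal[OF x y(1) ne] length_reduce_append(1)[OF rx ry] by linarith
    have "length (reduce (word_inv (a [y]) @ word_inv (a [x]))) + 2 * cancellation (a [x]) (a [y]) =
        length (a [x]) + length (a [y])"
      using length_reduce_append(1)[of "word_inv (a [y])" "word_inv (a [x])"] rx ry
        cancellation_word_inv[OF rx ry] by (simp add: reduced_rev_inv)
    then show "2 * cancellation (a [x]) (a [y]) \<le> length (a [x])"
      using minimal[of "inv_letter y" "inv_letter x"] x y ne by (auto simp: letter_image_inv)
  qed
  show "2 * cancellation (a [x]) (a [y]) \<le> length (a [x])"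
  proof (cases "fst x = fst y")
    case True
    from same[OF this] show ?thesis by force
  qed (rule diff(2))
  show "2 * cancellation (a [x]) (a [y]) \<le> length (a [y])"
  proof (cases "fst x = fst y")
    case True
    from same[OF this] show ?thesis by force
  qed (rule diff(1))
qed

text \<open>Here the move keeps the length and only trades the suffix \<open>word_inv p\<close> for
  \<open>word_inv q\<close>, so the tie-breaker decides.\<close>

lemma no_tie:
  assumes xy: "fst x \<in> S" "fst y \<in> S" "fst x \<noteq> fst y"
    and u: "a [x] = u @ word_inv p" and p: "a [y] = p @ word_inv q" "length p = length q"
    and len: "2 * length p \<le> length (a [x])" and red: "reduced (u @ word_inv q)"
  shows "\<not> word_code c B q < word_code c B p"
proof
  assume lt: "word_code c B q < word_code c B p"
  have B: "B > 0" using c(2)[OF xy(1)] by simp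
  have "reduce (a [x] @ a [y]) = u @ word_inv q"
    unfolding u p(1) by (rule reduce_cancel[OF red])
  then have "half_weight c B (u @ word_inv p) \<le> half_weight c B (u @ word_inv q)"
    using minimal[OF xy] u p(2) by simp
  moreover have "half_weight c B (u @ word_inv q) < half_weight c B (u @ word_inv p)"
    using half_weight_less[OF p(2) _ B lt, of u] len u by simp
  ultimately show False by simp
qed

text \<open>If the image of y were absorbed, it would be halved exactly, as p followed by the
  inverse of q. The tie-breaker for x and y, and after inversion for the inverses of z and y,
  excludes both strict comparisons of p and q. So p = q, and \<open>a [y]\<close> would be its own
  inverse.\<close>

sublocale short_cancellation S a
proof
  fix x y z :: "'a \<times> bool"
  assume x: "fst x \<in> S" and y: "fst y \<in> S" "y \<noteq> inv_letter x" and z: "fst z \<in> S" "z \<noteq> inv_letter y"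
  note rx = letter_image_reduced[OF x] and ry = letter_image_reduced[OF y(1)] and rz = letter_image_reduced[OF z(1)]
  note hxy = cancellation_half[OF x y] and hyz = cancellation_half[OF y(1) z]
  show "cancellation (a [x]) (a [y]) + cancellation (a [y]) (a [z]) < length (a [y])"
  proof (rule ccontr)
    assume "\<not> ?thesis"
    then have eq: "2 * cancellation (a [x]) (a [y]) = length (a [y])" "2 * cancellation (a [y]) (a [z]) = length (a [y])"
      using hxy(2) hyz(1) by linarith+
    have ne: "fst x \<noteq> fst y" using hxy(3) eq by linarith
    have ne': "fst y \<noteq> fst z"
    proof
      assume "fst y = fst z"
      then have "z = y" using z(2) by (auto simp: inv_letter_def prod_eq_iff)
      then show False using hyz(3) eq by simp
    qed
    obtain u p v where d: "a [x] = u @ word_inv p" "a [y] = p @ v" "reduced (u @ v)"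
      "length p = cancellation (a [x]) (a [y])"
      using cancellation_decomp[OF rx ry] by metis
    obtain v' q w where e: "a [y] = v' @ word_inv q" "a [z] = q @ w" "reduced (v' @ w)"
      "length q = cancellation (a [y]) (a [z])"
      using cancellation_decomp[OF ry rz] by metis
    have pq: "length p = length q" using d(4) e(4) eq by linarith
    have "length (a [y]) = length v' + length q" unfolding e(1) by simp
    then have "length v' = length p" using e(4) d(4) eq by linarith
    then have v: "v' = p" "v = word_inv q" using d(2) e(1) by simp_all
    have ay: "a [y] = p @ word_inv q" using d(2) v by simp
    have 1: "\<not> word_code c B q < word_code c B p"
      by (rule no_tie[OF x y(1) ne d(1) ay pq]) (use hxy(1) d v in simp_all)
    have iz: "a [inv_letter z] = word_inv w @ word_inv q" and iy: "a [inv_letter y] = q @ word_inv p"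
      using z y by (simp_all add: letter_image_inv e(2)) (use ay word_inv_word_inv[of q] in simp)
    have "reduced (word_inv (p @ w))" using e(3) v by (simp only: reduced_rev_inv)
    then have 2: "\<not> word_code c B p < word_code c B q"
      using z y ne' pq hyz(2) e by (intro no_tie[OF _ _ _ iz iy]) (auto simp: letter_image_inv)
    have "set p \<subseteq> S \<times> UNIV" "set q \<subseteq> S \<times> UNIV"
      using letter_image_closed[OF y(1)] letter_image_closed[of "inv_letter y"] y(1)
      unfolding ay iy free_group_simps(1) by (auto simp: mem_Times_iff)
    then have "p = q"
      using word_code_inj[OF c(1) _ pq, of B] c(2) 1 2 by (auto simp: mem_Times_iff)
    then have "a [y] = word_inv (a [y])" using ay word_inv_word_inv[of p] by simp
    then show False using word_inv_fixed[OF ry] letter_image_nonempty[OF y(1)] by blast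
  qed
qed

end

text \<open>Only left transvections are given. Conjugating by \<open>eps S i\<close> produces the
  right ones, and if x is the inverse of x_i, appending y to x means multiplying x_i on the left by
  the inverse of y.\<close>

lemma nielsen_move:
  assumes N: "subgroup N (AutoGroup (free_group S))"
    and eps: "\<And>i. i \<in> S \<Longrightarrow> eps S i \<in> N"
    and lam: "\<And>i j. i \<in> S \<Longrightarrow> j \<in> S \<Longrightarrow> i \<noteq> j \<Longrightarrow> lam S i j \<in> N"
    and xy: "fst x \<in> S" "fst y \<in> S" "fst x \<noteq> fst y"
  shows "\<exists>t\<in>N. t [x] = [x, y] \<and> (\<forall>s\<in>S. s \<noteq> fst x \<longrightarrow> t (gen s) = gen s)"
proof -
  interpret F: group "free_group S" by (rule group_free_group)
  interpret A: group "AutoGroup (free_group S)" by (rule F.AutoGroup)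
  interpret N: subgroup N "AutoGroup (free_group S)" by (rule N)
  obtain i b j b' where ij: "x = (i, b)" "y = (j, b')" by (cases x; cases y)
  have S: "i \<in> S" "j \<in> S" "i \<noteq> j" using xy ij by auto
  have li: "lam_inv S i j \<in> N" using lam[OF S] S by (metis inv_lam N.m_inv_closed)
  let ?r = "\<lambda>l. eps S i \<otimes>\<^bsub>AutoGroup (free_group S)\<^esub> l \<otimes>\<^bsub>AutoGroup (free_group S)\<^esub> eps S i"
  have r: "?r l \<in> N" if "l \<in> N" for l using that eps[OF S(1)] by blast
  have i: "[(i, False)] \<in> carrier (free_group S)" "[(i, True)] \<in> carrier (free_group S)"
    using S by (auto intro: letter_closed)
  note sm = Aut_free_mult_apply Aut_free_apply_closed gen_closed i elementary_closed
  consider "b" "b'" | "b" "\<not> b'" | "\<not> b" "b'" | "\<not> b" "\<not> b'" by blast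
  then show ?thesis
  proof cases
    case 1
    show ?thesis
      by (rule bexI[OF _ r[OF li]])
         (use S 1 in \<open>auto simp: ij sm, auto simp: elementary_defs word_simps\<close>)
  next
    case 2
    show ?thesis
      by (rule bexI[OF _ r[OF lam[OF S]]])
         (use S 2 in \<open>auto simp: ij sm, auto simp: elementary_defs word_simps\<close>)
  next
    case 3
    show ?thesis
      by (rule bexI[OF _ li]) (use S 3 in \<open>auto simp: ij, auto simp: elementary_defs word_simps\<close>)
  next
    case 4
    show ?thesis
      by (rule bexI[OF _ lam[OF S]]) (use S 4 in \<open>auto simp: ij, auto simp: elementary_defs word_simps\<close>)
  qed
qed

text \<open>Composing with t from \<open>N\<close> on the right multiplies images of letters by one
  another, so a minimal element b of the coset of a modulo \<open>N\<close> is Nielsen minimal. By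
  \<open>letter_preimage\<close> its inverse sends generators to letters and hence lies in
  \<open>N\<close>.\<close>

theorem nielsen_generation:
  assumes S: "finite S" and N: "subgroup N (AutoGroup (free_group S))"
    and eps: "\<And>i. i \<in> S \<Longrightarrow> eps S i \<in> N"
    and lam: "\<And>i j. i \<in> S \<Longrightarrow> j \<in> S \<Longrightarrow> i \<noteq> j \<Longrightarrow> lam S i j \<in> N"
  shows "carrier (AutoGroup (free_group S)) \<subseteq> N"
proof
  fix a assume ac: "a \<in> carrier (AutoGroup (free_group S))"
  interpret F: group "free_group S" by (rule group_free_group)
  interpret A: group "AutoGroup (free_group S)" by (rule F.AutoGroup)
  interpret N: subgroup N "AutoGroup (free_group S)" by (rule N)
  let ?A = "AutoGroup (free_group S)"
  obtain c where c: "bij_betw c (S \<times> (UNIV :: bool set)) {0..<card (S \<times> (UNIV :: bool set))}"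
    using ex_bij_betw_finite_nat S by (metis finite_SigmaI finite_class.finite_UNIV)
  define B where "B = card (S \<times> (UNIV :: bool set))"
  have cB: "c x < B" if "fst x \<in> S" for x
  proof -
    have "x \<in> S \<times> UNIV" using that by (cases x) auto
    then have "c x \<in> {0..<B}" unfolding B_def using bij_betwE[OF c] by blast
    then show ?thesis by simp
  qed
  define M1 where "M1 b = (\<Sum>s\<in>S. length (b (gen s)))" for b :: "('a \<times> bool) list \<Rightarrow> ('a \<times> bool) list"
  define M2 where "M2 b = (\<Sum>s\<in>S. half_weight c B (b (gen s)))" for b :: "('a \<times> bool) list \<Rightarrow> ('a \<times> bool) list"
  define Q where "Q = {a \<otimes>\<^bsub>?A\<^esub> t |t. t \<in> N}"
  have "a \<otimes>\<^bsub>?A\<^esub> \<one>\<^bsub>?A\<^esub> \<in> Q" unfolding Q_def using N.one_closed by blast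
  then obtain b where b: "b \<in> Q" and min: "\<And>b'. (b', b) \<in> measures [M1, M2] \<Longrightarrow> b' \<notin> Q"
    by (rule wfE_min[OF wf_measures[of "[M1, M2]"]]) blast
  obtain t0 where t0: "t0 \<in> N" "b = a \<otimes>\<^bsub>?A\<^esub> t0" using b unfolding Q_def by blast
  have bc: "b \<in> carrier ?A" using t0 ac N.mem_carrier by simp
  interpret letter_images S b by unfold_locales (rule bc)
  interpret nielsen_minimal S b c B
  proof unfold_locales
    show "inj_on c (S \<times> UNIV)" using c by (simp add: bij_betw_def)
    show "c x < B" if "fst x \<in> S" for x using cB[OF that] .
    fix x y :: "'a \<times> bool" assume xy: "fst x \<in> S" "fst y \<in> S" "fst x \<noteq> fst y"
    obtain t where t: "t \<in> N" "t [x] = [x, y]" "\<And>s. s \<in> S \<Longrightarrow> s \<noteq> fst x \<Longrightarrow> t (gen s) = gen s"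
      using nielsen_move[OF N eps lam xy] by blast
    have tc: "t \<in> carrier ?A" using t(1) by (rule N.mem_carrier)
    define b' where "b' = b \<otimes>\<^bsub>?A\<^esub> t"
    have b'c: "b' \<in> carrier ?A" using bc tc by (simp add: b'_def)
    have "b' = a \<otimes>\<^bsub>?A\<^esub> (t0 \<otimes>\<^bsub>?A\<^esub> t)"
      using ac t0 tc N.mem_carrier[OF t0(1)] by (simp add: b'_def A.m_assoc)
    then have "b' \<in> Q" unfolding Q_def using N.m_closed[OF t0(1) t(1)] by blast
    then have nless: "(b', b) \<notin> measures [M1, M2]" using min by blast
    interpret b': letter_images S b' by unfold_locales (rule b'c)
    have [simp]: "[x] \<in> carrier (free_group S)" "[y] \<in> carrier (free_group S)"
      using xy by (auto intro: letter_closed)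
    have "[x, y] = [x] \<otimes>\<^bsub>free_group S\<^esub> [y]"
      using xy by (auto simp: free_group_simps(2) reduce_def)
    then have b'x: "b' [x] = reduce (b [x] @ b [y])"
      using F.AutoGroup_apply_mult[OF bc, of "[x]" "[y]"] F.AutoGroup_mult_apply[OF bc tc, of "[x]"] t(2)
      by (simp add: b'_def free_group_simps(2))
    have b's: "b' (gen s) = b (gen s)" if "s \<in> S - {fst x}" for s
      using F.AutoGroup_mult_apply[OF bc tc gen_closed] t(3) that by (simp add: b'_def)
    have xg: "x = (fst x, True) \<or> x = inv_letter (fst x, True)" by (cases x) (auto simp: inv_letter_def)
    \<comment> \<open>x may be an inverse letter, while \<open>M1\<close> and \<open>M2\<close> sum
      over generators; length and \<open>half_weight\<close> do not see the difference.\<close>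
    have lw: "length (d (gen (fst x))) = length (d [x]) \<and> half_weight c B (d (gen (fst x))) = half_weight c B (d [x])"
      if "letter_images S d" for d
    proof -
      interpret d: letter_images S d by (rule that)
      show ?thesis
        using xg d.letter_image_inv[of "(fst x, True)"] xy(1) half_weight_word_inv[of c B "d (gen (fst x))"]
        by (metis fst_conv length_map length_rev)
    qed
    have M1: "M1 d = length (d [x]) + (\<Sum>s\<in>S - {fst x}. length (d (gen s)))"
      and M2: "M2 d = half_weight c B (d [x]) + (\<Sum>s\<in>S - {fst x}. half_weight c B (d (gen s)))"
      if "letter_images S d" for d
      using lw[OF that] sum.remove[OF S xy(1), of "\<lambda>s. length (d (gen s))"]
        sum.remove[OF S xy(1), of "\<lambda>s. half_weight c B (d (gen s))"]
      by (simp_all add: M1_def M2_def)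
    have "M1 b' + length (b [x]) = M1 b + length (b' [x])"
      "M2 b' + half_weight c B (b [x]) = M2 b + half_weight c B (b' [x])"
      using M1[OF b'.letter_images_axioms] M1[OF letter_images_axioms]
        M2[OF b'.letter_images_axioms] M2[OF letter_images_axioms] by (simp_all add: b's)
    then show "length (b [x]) < length (reduce (b [x] @ b [y])) \<or>
      length (b [x]) = length (reduce (b [x] @ b [y])) \<and>
        half_weight c B (b [x]) \<le> half_weight c B (reduce (b [x] @ b [y]))"
      using nless unfolding b'x[symmetric] by auto
  qed
  have swp: "swp S i j \<in> N" if "i \<in> S" "j \<in> S" "i \<noteq> j" for i j
  proof -
    have "lam_inv S i j \<in> N" "lam_inv S j i \<in> N"
      using lam[of i j] lam[of j i] that by (metis inv_lam N.m_inv_closed)+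
    then show ?thesis unfolding swp_eq[OF that] using that eps lam by (intro N.m_closed) auto
  qed
  have "inv\<^bsub>?A\<^esub> b \<in> N"
  proof (rule letter_auto_generated[OF S N eps swp])
    show "inv\<^bsub>?A\<^esub> b \<in> carrier ?A" using bc by simp
    show "letter_auto S (inv\<^bsub>?A\<^esub> b)"
      unfolding letter_auto_def
    proof
      fix s assume "s \<in> S"
      then obtain x where x: "fst x \<in> S" "b [x] = gen s" using letter_preimage by blast
      then show "\<exists>x. fst x \<in> S \<and> (inv\<^bsub>?A\<^esub> b) (gen s) = [x]"
        using F.AutoGroup_inv_apply(1)[OF bc letter_closed[OF x(1)]] by (intro exI[of _ x]) simp
    qed
  qed
  then have "b \<in> N" using N.m_inv_closed bc A.inv_inv by metis
  then have "b \<otimes>\<^bsub>?A\<^esub> inv\<^bsub>?A\<^esub> t0 \<in> N" using t0(1) by blast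
  moreover have "b \<otimes>\<^bsub>?A\<^esub> inv\<^bsub>?A\<^esub> t0 = a"
    using ac t0 N.mem_carrier[OF t0(1)] by (simp add: A.m_assoc)
  ultimately show "a \<in> N" by simp
qed

section \<open>Integral representations of small degree\<close>

locale int_rep = group G for G (structure) +
  fixes m :: nat and r :: "'a \<Rightarrow> int mat"
  assumes rep: "r \<in> hom G (GL_int m)"
begin

abbreviation V :: "rat vec set" where "V \<equiv> carrier_vec m"

text \<open>Scalars are extended to the rationals so that eigenvalue theory over a field
  applies.\<close>

definition act :: "'a \<Rightarrow> rat vec \<Rightarrow> rat vec" where
  "act g v = map_mat rat_of_int (r g) *\<^sub>v v"

lemma rep_carrier: "g \<in> carrier G \<Longrightarrow> r g \<in> carrier_mat m m"
  using hom_in_carrier[OF rep] by (auto simp: units_of_carrier Units_def ring_mat_simps)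

lemma rep_mult: "g \<in> carrier G \<Longrightarrow> h \<in> carrier G \<Longrightarrow> r (g \<otimes> h) = r g * r h"
  using hom_mult[OF rep] by (simp add: units_of_mult ring_mat_simps)

lemma rep_one: "r \<one> = 1\<^sub>m m"
  using hom_one[OF rep] group_GL_int by (simp add: units_of_one ring_mat_simps)

lemma act_closed: "g \<in> carrier G \<Longrightarrow> v \<in> V \<Longrightarrow> act g v \<in> V"
  unfolding act_def by (intro mult_mat_vec_carrier[of _ m m]) (simp_all add: rep_carrier)

lemma act_mult:
  assumes "g \<in> carrier G" "h \<in> carrier G" "v \<in> V"
  shows "act (g \<otimes> h) v = act g (act h v)"
proof -
  have "map_mat rat_of_int (r g * r h) = map_mat rat_of_int (r g) * map_mat rat_of_int (r h)"
    using rep_carrier[OF assms(1)] rep_carrier[OF assms(2)] by (rule of_int_hom.mat_hom_mult)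
  then show ?thesis
    using assms rep_carrier unfolding act_def
    by (simp add: rep_mult assoc_mult_mat_vec[of _ m m _ m])
qed

lemma act_one: "v \<in> V \<Longrightarrow> act \<one> v = v"
  by (simp add: act_def rep_one of_int_hom.mat_hom_one)

lemma act_add: "g \<in> carrier G \<Longrightarrow> v \<in> V \<Longrightarrow> w \<in> V \<Longrightarrow> act g (v + w) = act g v + act g w"
  unfolding act_def by (rule mult_add_distrib_mat_vec[of _ m m]) (simp_all add: rep_carrier)

lemma act_smult: "g \<in> carrier G \<Longrightarrow> v \<in> V \<Longrightarrow> act g (k \<cdot>\<^sub>v v) = k \<cdot>\<^sub>v act g v"
  unfolding act_def by (rule mult_mat_vec[of _ m m]) (simp_all add: rep_carrier)

lemma act_zero:
  assumes "g \<in> carrier G" shows "act g (0\<^sub>v m) = 0\<^sub>v m"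
proof -
  have "0 \<cdot>\<^sub>v v = 0\<^sub>v m" if "v \<in> V" for v using that by (intro eq_vecI) auto
  then show ?thesis
    using act_smult[OF assms, of "0\<^sub>v m" 0] act_closed[OF assms, of "0\<^sub>v m"] by simp
qed

lemma act_nonzero:
  assumes "g \<in> carrier G" "v \<in> V" "v \<noteq> 0\<^sub>v m"
  shows "act g v \<noteq> 0\<^sub>v m"
proof
  assume "act g v = 0\<^sub>v m"
  then have "act (inv g) (act g v) = 0\<^sub>v m" using assms by (simp add: act_zero)
  then show False using assms by (simp add: act_one flip: act_mult)
qed

lemma act_trivial:
  assumes g: "g \<in> carrier G" and id: "\<And>v. v \<in> V \<Longrightarrow> act g v = v"
  shows "r g = 1\<^sub>m m"
proof (rule eq_matI)
  fix i j assume "i < dim_row (1\<^sub>m m :: int mat)" "j < dim_col (1\<^sub>m m :: int mat)"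
  then have ij: "i < m" "j < m" by auto
  have c: "map_mat rat_of_int (r g) \<in> carrier_mat m m" using rep_carrier[OF g] by simp
  have "map_mat rat_of_int (r g) *\<^sub>v unit_vec m j = unit_vec m j"
    using id[of "unit_vec m j"] by (simp add: act_def)
  then have "(map_mat rat_of_int (r g) *\<^sub>v unit_vec m j) $ i = unit_vec m j $ i" by simp
  moreover have "(map_mat rat_of_int (r g) *\<^sub>v unit_vec m j) $ i = map_mat rat_of_int (r g) $$ (i, j)"
    using c ij by (simp add: scalar_prod_right_unit)
  ultimately show "r g $$ (i, j) = 1\<^sub>m m $$ (i, j)"
    using rep_carrier[OF g] ij by (auto simp: unit_vec_def split: if_splits)
qed (use rep_carrier[OF g] in auto)

definition sign_vec :: "(nat \<Rightarrow> 'a) \<Rightarrow> nat set \<Rightarrow> nat set \<Rightarrow> rat vec \<Rightarrow> bool" where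
  "sign_vec b J T v \<longleftrightarrow> v \<in> V \<and> v \<noteq> 0\<^sub>v m \<and> (\<forall>j\<in>J. act (b j) v = (if j \<in> T then -1 else 1) \<cdot>\<^sub>v v)"

text \<open>Confining T to \<open>J\<close> makes it determined by the signs on \<open>J\<close>, so
  patterns can be counted as sets.\<close>

definition sign_pattern :: "(nat \<Rightarrow> 'a) \<Rightarrow> nat set \<Rightarrow> nat set \<Rightarrow> bool" where
  "sign_pattern b J T \<longleftrightarrow> T \<subseteq> J \<and> (\<exists>v. sign_vec b J T v)"

text \<open>The matrix \<open>\<Sum>\<^sub>j 2\<^sup>j b\<^sub>j\<close> has a different eigenvalue for each sign pattern.\<close>

lemma card_sign_patterns:
  assumes J: "finite J" and b: "\<And>j. j \<in> J \<Longrightarrow> b j \<in> carrier G"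
    and P: "\<And>T. T \<in> P \<Longrightarrow> sign_pattern b J T"
  shows "card P \<le> m"
proof -
  define M where "M = mat m m (\<lambda>(i, k). \<Sum>j\<in>J. 2 ^ j * rat_of_int (r (b j) $$ (i, k)))"
  have M: "M \<in> carrier_mat m m" by (simp add: M_def)
  define ev where "ev T = (\<Sum>j\<in>J. 2 ^ j * (if j \<in> T then -1 else 1 :: rat))" for T
  have Mv: "(M *\<^sub>v v) $ i = (\<Sum>j\<in>J. 2 ^ j * act (b j) v $ i)" if v: "v \<in> V" and i: "i < m" for v i
  proof -
    have "act (b j) v $ i = (\<Sum>k = 0..<m. rat_of_int (r (b j) $$ (i, k)) * v $ k)" if "j \<in> J" for j
      using rep_carrier[OF b[OF that]] v i by (auto simp: act_def scalar_prod_def)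
    then have "(\<Sum>j\<in>J. 2 ^ j * act (b j) v $ i) =
        (\<Sum>j\<in>J. \<Sum>k = 0..<m. 2 ^ j * rat_of_int (r (b j) $$ (i, k)) * v $ k)"
      by (simp add: sum_distrib_left mult.assoc)
    also have "\<dots> = (\<Sum>k = 0..<m. \<Sum>j\<in>J. 2 ^ j * rat_of_int (r (b j) $$ (i, k)) * v $ k)"
      by (rule sum.swap)
    also have "\<dots> = (M *\<^sub>v v) $ i"
      using v i by (simp add: M_def scalar_prod_def sum_distrib_right)
    finally show ?thesis ..
  qed
  have "eigenvalue M (ev T)" if T: "T \<in> P" for T
  proof -
    obtain v where v: "v \<in> V" "v \<noteq> 0\<^sub>v m" "\<And>j. j \<in> J \<Longrightarrow> act (b j) v = (if j \<in> T then -1 else 1) \<cdot>\<^sub>v v"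
      using P[OF T] by (auto simp: sign_pattern_def sign_vec_def)
    have "M *\<^sub>v v = ev T \<cdot>\<^sub>v v"
    proof (rule eq_vecI)
      fix i assume "i < dim_vec (ev T \<cdot>\<^sub>v v)"
      then have i: "i < m" using v(1) by simp
      have "(\<Sum>j\<in>J. 2 ^ j * act (b j) v $ i) = (\<Sum>j\<in>J. 2 ^ j * (if j \<in> T then -1 else 1) * v $ i)"
        using v i by (intro sum.cong) auto
      then show "(M *\<^sub>v v) $ i = (ev T \<cdot>\<^sub>v v) $ i"
        using v(1) i by (simp add: Mv ev_def sum_distrib_right)
    qed (use M v(1) in auto)
    then show ?thesis using v M by (auto simp: eigenvalue_def eigenvector_def)
  qed
  then have roots: "ev ` P \<subseteq> {k. poly (char_poly M) k = 0}"
    by (auto simp: eigenvalue_root_char_poly[OF M])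
  have deg: "degree (char_poly M) = m" "char_poly M \<noteq> 0"
    using degree_monic_char_poly[OF M] by auto
  \<comment> \<open>The eigenvalue is a constant minus twice the number whose binary digits form T,
    and \<open>set_encode\<close> is injective on finite sets.\<close>
  have ev: "ev T = ev J + 2 * (\<Sum>j\<in>J. 2 ^ j) - 2 * of_nat (set_encode T)" if "T \<subseteq> J" for T
  proof -
    have "(\<Sum>j\<in>J. if j \<in> T then 2 ^ j else 0 :: rat) = (\<Sum>j\<in>T. 2 ^ j)"
      using that J by (simp add: sum.If_cases Int_absorb1)
    moreover have "ev T = (\<Sum>j\<in>J. 2 ^ j) - 2 * (\<Sum>j\<in>J. if j \<in> T then 2 ^ j else 0)"
      unfolding ev_def sum_distrib_left sum_subtractf[symmetric] by (intro sum.cong) auto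
    moreover have "ev J = - (\<Sum>j\<in>J. 2 ^ j)" by (simp add: ev_def sum_negf)
    moreover have "rat_of_nat (set_encode T) = (\<Sum>j\<in>T. 2 ^ j)" by (simp add: set_encode_def)
    ultimately show ?thesis by simp
  qed
  have "inj_on ev P"
  proof (rule inj_onI)
    fix T U assume TU: "T \<in> P" "U \<in> P" "ev T = ev U"
    then have sub: "T \<subseteq> J" "U \<subseteq> J" using P by (auto simp: sign_pattern_def)
    then have "rat_of_nat (set_encode T) = rat_of_nat (set_encode U)"
      using TU(3) ev[of T] ev[of U] by linarith
    then have "set_encode T = set_encode U" by (simp only: of_nat_eq_iff)
    then show "T = U" using sub J by (simp add: set_encode_eq finite_subset)
  qed
  then have "card P = card (ev ` P)" by (simp add: card_image)
  also have "\<dots> \<le> card {k. poly (char_poly M) k = 0}"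
    using roots deg by (intro card_mono poly_roots_finite) auto
  also have "\<dots> \<le> m" using card_poly_roots_bound[OF deg(2)] deg(1) by simp
  finally show ?thesis .
qed

text \<open>The relations are assumed for the action only, since transvections are not involutions
  in the group. Start from u - cu for some u moved by c. For each further b_j replace v by v + b_j
  v; if that vanishes, b_j already acts on v by -1.\<close>

lemma exists_sign_vec:
  assumes J: "finite J" and b: "\<And>j. j \<in> J \<Longrightarrow> b j \<in> carrier G" and c: "c \<in> carrier G" "r c \<noteq> 1\<^sub>m m"
    and inv_c: "\<And>v. v \<in> V \<Longrightarrow> act c (act c v) = v"
    and inv_b: "\<And>j v. j \<in> J \<Longrightarrow> v \<in> V \<Longrightarrow> act (b j) (act (b j) v) = v"
    and comm_c: "\<And>j v. j \<in> J \<Longrightarrow> v \<in> V \<Longrightarrow> act c (act (b j) v) = act (b j) (act c v)"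
    and comm_b: "\<And>i j v. i \<in> J \<Longrightarrow> j \<in> J \<Longrightarrow> v \<in> V \<Longrightarrow> act (b i) (act (b j) v) = act (b j) (act (b i) v)"
  shows "\<exists>T\<subseteq>J. \<exists>v. sign_vec b J T v \<and> act c v = - v"
proof -
  have neg: "(- 1 :: rat) \<cdot>\<^sub>v v = - v" for v :: "rat vec" by auto
  have "\<exists>T\<subseteq>K. \<exists>v. sign_vec b K T v \<and> act c v = (-1) \<cdot>\<^sub>v v" if "finite K" "K \<subseteq> J" for K
    using that
  proof (induction K rule: finite_induct)
    case empty
    obtain u where u: "u \<in> V" "act c u \<noteq> u" using act_trivial[OF c(1)] c(2) by blast
    let ?v = "u + (-1) \<cdot>\<^sub>v act c u"
    have cu: "act c u \<in> V" using u c by (simp add: act_closed)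
    have "act c ?v = act c u + (-1) \<cdot>\<^sub>v u"
      using u cu c by (simp add: act_add act_smult inv_c)
    also have "\<dots> = (-1) \<cdot>\<^sub>v ?v" using u cu by (intro eq_vecI) auto
    finally have "act c ?v = (-1) \<cdot>\<^sub>v ?v" .
    moreover have "?v \<noteq> 0\<^sub>v m"
    proof
      assume z: "?v = 0\<^sub>v m"
      have "act c u = u"
      proof (rule eq_vecI)
        fix i assume i: "i < dim_vec u"
        then have "?v $ i = 0" using z u by auto
        then show "act c u $ i = u $ i" using i cu u by simp
      qed (use cu u in auto)
      then show False using u by simp
    qed
    ultimately have "sign_vec b {} {} ?v \<and> act c ?v = (-1) \<cdot>\<^sub>v ?v"
      using u cu by (simp add: sign_vec_def)
    then show ?case by blast
  next
    case (insert j K)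
    then obtain T v where T: "T \<subseteq> K" and v: "v \<in> V" "v \<noteq> 0\<^sub>v m" "act c v = (-1) \<cdot>\<^sub>v v"
      and K: "\<And>k. k \<in> K \<Longrightarrow> act (b k) v = (if k \<in> T then -1 else 1) \<cdot>\<^sub>v v" by (auto simp: sign_vec_def)
    have j: "j \<in> J" "j \<notin> K" using insert by auto
    have bv: "act (b j) v \<in> V" using v b[OF j(1)] by (simp add: act_closed)
    let ?w = "v + act (b j) v"
    show ?case
    proof (cases "?w = 0\<^sub>v m")
      case True
      have "act (b j) v = (-1) \<cdot>\<^sub>v v"
      proof (rule eq_vecI)
        fix i assume i: "i < dim_vec ((-1) \<cdot>\<^sub>v v)"
        then have "?w $ i = 0" using True v by auto
        then show "act (b j) v $ i = ((-1) \<cdot>\<^sub>v v) $ i" using i bv v by simp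
      qed (use bv v in auto)
      then have "sign_vec b (insert j K) (insert j T) v"
        using v K j T by (auto simp: sign_vec_def)
      then show ?thesis using T v by blast
    next
      case False
      have eig: "act g ?w = k \<cdot>\<^sub>v ?w" if g: "g \<in> carrier G" "act g v = k \<cdot>\<^sub>v v"
        and gb: "act g (act (b j) v) = act (b j) (act g v)" for g k
      proof -
        have "act g ?w = k \<cdot>\<^sub>v v + k \<cdot>\<^sub>v act (b j) v"
          using g v bv b[OF j(1)] by (simp add: act_add gb act_smult)
        also have "\<dots> = k \<cdot>\<^sub>v ?w" using v bv by (intro smult_add_distrib_vec[symmetric]) auto
        finally show ?thesis .
      qed
      have "act (b j) ?w = act (b j) v + v"
        using v bv b[OF j(1)] by (simp add: act_add inv_b[OF j(1)])
      also have "\<dots> = 1 \<cdot>\<^sub>v ?w" using v bv by (intro eq_vecI) auto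
      finally have "act (b j) ?w = 1 \<cdot>\<^sub>v ?w" .
      moreover have "act (b k) ?w = (if k \<in> T then -1 else 1) \<cdot>\<^sub>v ?w" if "k \<in> K" for k
        using that insert.prems v(1) j(1) by (intro eig b K comm_b) auto
      moreover have "act c ?w = (-1) \<cdot>\<^sub>v ?w"
        using v j(1) by (intro eig c comm_c) auto
      ultimately have "sign_vec b (insert j K) T ?w" "act c ?w = (-1) \<cdot>\<^sub>v ?w"
        using v bv False j T by (auto simp: sign_vec_def)
      then show ?thesis using T by blast
    qed
  qed
  from this[OF J subset_refl] show ?thesis by (simp add: neg)
qed

end

section \<open>Moving and counting sign patterns\<close>

context int_rep
begin

lemma act_relation:
  "a \<otimes> b = c \<otimes> d \<Longrightarrow> a \<in> carrier G \<Longrightarrow> b \<in> carrier G \<Longrightarrow> c \<in> carrier G \<Longrightarrow> d \<in> carrier G \<Longrightarrow>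
    v \<in> V \<Longrightarrow> act a (act b v) = act c (act d v)"
  by (simp flip: act_mult)

lemma sign_vec_act:
  assumes "g \<in> carrier G" "sign_vec b J T v" "T' \<subseteq> J"
    and "\<And>j. j \<in> J \<Longrightarrow> act (b j) (act g v) = (if j \<in> T' then -1 else 1) \<cdot>\<^sub>v act g v"
  shows "sign_pattern b J T'"
  using assms by (auto simp: sign_pattern_def sign_vec_def act_closed act_nonzero intro!: exI[of _ "act g v"])

end

text \<open>Besides T itself, exchange an element j of T for b, or exchange a for an element j
  outside T other than b. These \<open>card S - 1\<close> sets differ from one another: b belongs to
  the new set exactly when j was in T, and then j can be read off.\<close>

lemma card_transposition_orbit:
  assumes S: "finite S" and T: "T \<subseteq> S" "T \<in> P" and ab: "a \<in> T" "b \<in> S" "b \<notin> T" and P: "finite P"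
    and swap: "\<And>i j. i \<in> T \<Longrightarrow> j \<in> S - T \<Longrightarrow> insert j (T - {i}) \<in> P"
  shows "card S \<le> card P"
proof -
  let ?f = "\<lambda>j. if j \<in> T then insert b (T - {j}) else insert j (T - {a})"
  have "inj_on ?f (S - {b})"
  proof (rule inj_onI)
    fix i j assume ij: "i \<in> S - {b}" "j \<in> S - {b}" "?f i = ?f j"
    have *: "b \<in> ?f k \<longleftrightarrow> k \<in> T" if "k \<in> S - {b}" for k using that ab by auto
    show "i = j"
    proof (cases "i \<in> T")
      case True
      then have "j \<in> T" using *[OF ij(1)] *[OF ij(2)] ij(3) by metis
      then have eq: "insert b (T - {i}) = insert b (T - {j})" using True ij(3) by simp
      have "i \<notin> insert b (T - {i})" using ij(1) by simp
      then show ?thesis unfolding eq using True by simp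
    next
      case False
      then have j: "j \<notin> T" using *[OF ij(1)] *[OF ij(2)] ij(3) by metis
      then have eq: "insert i (T - {a}) = insert j (T - {a})" using False ij(3) by simp
      have "i \<in> insert i (T - {a})" by simp
      then show ?thesis unfolding eq using False by simp
    qed
  qed
  then have "card (?f ` (S - {b})) = card (S - {b})" by (rule card_image)
  also have "\<dots> = card S - 1" using ab S by simp
  finally have "card (?f ` (S - {b})) = card S - 1" .
  moreover have "T \<notin> ?f ` (S - {b})"
  proof
    assume "T \<in> ?f ` (S - {b})"
    then obtain j where "j \<in> S - {b}" "T = ?f j" by blast
    then show False using ab by (cases "j \<in> T") auto
  qed
  ultimately have "card (insert T (?f ` (S - {b}))) = Suc (card S - 1)" using S by simp
  moreover have "insert T (?f ` (S - {b})) \<subseteq> P" using swap T ab by auto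
  then have "card (insert T (?f ` (S - {b}))) \<le> card P" by (rule card_mono[OF P])
  ultimately show ?thesis by linarith
qed

text \<open>An element can be toggled as long as another one stays in the set. So T leads to {a},
  then to every {a, b}, and from one of these to {b}: 1 + (card J - 1) + 1 sets. The extra one
  matters, because \<open>J\<close> will have one element fewer than the rank.\<close>

lemma card_flip_orbit:
  assumes J: "finite J" "2 \<le> card J" and P: "finite P"
    and T: "T \<subseteq> J" "T \<in> P" "T \<noteq> {}"
    and flip: "\<And>T k j. T \<subseteq> J \<Longrightarrow> T \<in> P \<Longrightarrow> k \<in> T \<Longrightarrow> j \<in> J \<Longrightarrow> j \<noteq> k \<Longrightarrow>
      (if j \<in> T then T - {j} else insert j T) \<in> P"
  shows "card J < card P"
proof -
  obtain a where a: "a \<in> T" using T by blast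
  have "T - U \<in> P" if "finite U" "U \<subseteq> T - {a}" for U
    using that
  proof (induction U rule: finite_induct)
    case (insert u U)
    then have "(if u \<in> T - U then T - U - {u} else Set.insert u (T - U)) \<in> P"
      using a T by (intro flip[of _ a]) auto
    moreover have "T - insert u U = T - U - {u}" by blast
    ultimately show ?case using insert by auto
  qed (use T in simp)
  from this[of "T - {a}"] have "T - (T - {a}) \<in> P" using J T finite_subset by blast
  moreover have "T - (T - {a}) = {a}" using a by blast
  ultimately have sa: "{a} \<in> P" by simp
  have aJ: "a \<in> J" using a T by blast
  have pair: "{a, b} \<in> P" if "b \<in> J - {a}" for b
    using flip[of "{a}" a b] sa that aJ by (auto simp: insert_commute)
  obtain b where b: "b \<in> J" "b \<noteq> a"
    using J aJ by (metis card_1_singleton_iff card_le_Suc0_iff_eq not_less_eq_eq numeral_2_eq_2)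
  have sb: "{b} \<in> P"
    using flip[of "{a, b}" b a] pair[of b] b aJ by auto
  let ?Q = "insert {b} (insert {a} ((\<lambda>b. {a, b}) ` (J - {a})))"
  have "inj_on (\<lambda>b. {a, b}) (J - {a})" by (rule inj_onI) (auto simp: doubleton_eq_iff)
  then have "card ((\<lambda>b. {a, b}) ` (J - {a})) = card J - 1" using aJ J by (simp add: card_image)
  moreover have "{a} \<notin> (\<lambda>b. {a, b}) ` (J - {a})" "{b} \<notin> insert {a} ((\<lambda>b. {a, b}) ` (J - {a}))"
    using b by auto
  ultimately have "card ?Q = Suc (Suc (card J - 1))" using J by simp
  moreover have "?Q \<subseteq> P" using sa sb pair by auto
  then have "card ?Q \<le> card P" by (rule card_mono[OF P])
  ultimately show ?thesis using J by linarith
qed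

section \<open>Representations of Aut(F_n) of degree below n\<close>

locale aut_rep = int_rep "AutoGroup (free_group S)" m r for S :: "nat set" and m r +
  assumes S: "finite S" "3 \<le> card S" "m < card S"
begin

abbreviation "A \<equiv> AutoGroup (free_group S)"

lemma finite_patterns:
  assumes "finite J"
  shows "finite {T. sign_pattern b J T}"
  by (rule finite_subset[of _ "Pow J"]) (use assms in \<open>auto simp: sign_pattern_def\<close>)

lemma exists_third:
  assumes "i \<in> S" "j \<in> S"
  obtains k where "k \<in> S" "k \<noteq> i" "k \<noteq> j"
proof -
  have "\<not> S \<subseteq> {i, j}"
  proof
    assume "S \<subseteq> {i, j}"
    then have "card S \<le> card {i, j}" by (intro card_mono) auto
    also have "\<dots> \<le> 2" by (simp add: card_insert_if)
    finally show False using S(2) by simp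
  qed
  then show thesis using that by blast
qed

lemma act_eps_eps: "i \<in> S \<Longrightarrow> v \<in> V \<Longrightarrow> act (eps S i) (act (eps S i) v) = v"
  by (simp add: elementary_closed eps_square act_one flip: act_mult)

lemma act_eps_commute:
  "i \<in> S \<Longrightarrow> j \<in> S \<Longrightarrow> v \<in> V \<Longrightarrow> act (eps S i) (act (eps S j) v) = act (eps S j) (act (eps S i) v)"
  by (rule act_relation[OF eps_commute]) (auto simp: elementary_closed)

lemma swp_eps_transpose:
  assumes "i \<in> S" "j \<in> S" "k \<in> S" "i \<noteq> j"
  shows "eps S k \<otimes>\<^bsub>A\<^esub> swp S i j = swp S i j \<otimes>\<^bsub>A\<^esub> eps S (if k = i then j else if k = j then i else k)"
  using assms swp_eps[of i S j] swp_eps[of j S i] swp_eps_other[of i S j k] by (auto simp: swp_commute[of S j i])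

text \<open>If the two inversions act differently, their product c has an eigenvector with
  eigenvalue -1, on which exactly one of them acts by -1. So T is a nonempty proper subset of
  \<open>S\<close>, and swaps move it to at least \<open>card S\<close> patterns.\<close>

lemma rep_eps_eq:
  assumes ab: "a \<in> S" "b \<in> S"
  shows "r (eps S a) = r (eps S b)"
proof (rule ccontr)
  assume ne: "r (eps S a) \<noteq> r (eps S b)"
  let ?c = "eps S a \<otimes>\<^bsub>A\<^esub> eps S b"
  have c: "?c \<in> carrier A" using ab by (simp add: elementary_closed)
  have ac: "act ?c v = act (eps S a) (act (eps S b) v)" if "v \<in> V" for v
    using ab that by (simp add: act_mult elementary_closed)
  have "r ?c \<noteq> 1\<^sub>m m"
  proof
    assume 1: "r ?c = 1\<^sub>m m"
    have "?c \<otimes>\<^bsub>A\<^esub> eps S b = eps S a" using ab by (simp add: m_assoc elementary_closed eps_square)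
    then have "r (eps S a) = r ?c * r (eps S b)" using rep_mult[OF c, of "eps S b"] ab by (simp add: elementary_closed)
    then show False using 1 ne rep_carrier[of "eps S b"] ab by (simp add: elementary_closed)
  qed
  then obtain T v where T: "T \<subseteq> S" "sign_vec (eps S) S T v" "act ?c v = - v"
    using exists_sign_vec[OF S(1), of "eps S" ?c] c ab
    by (auto simp: elementary_closed ac act_eps_eps act_eps_commute act_closed)
  have v: "v \<in> V" "v \<noteq> 0\<^sub>v m" "\<And>j. j \<in> S \<Longrightarrow> act (eps S j) v = (if j \<in> T then -1 else 1) \<cdot>\<^sub>v v"
    using T(2) by (auto simp: sign_vec_def)
  have "(a \<in> T) \<noteq> (b \<in> T)"
  proof
    assume eq: "(a \<in> T) = (b \<in> T)"
    have "act ?c v = v"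
      using v ab eq by (auto simp: ac act_smult elementary_closed smult_smult_assoc)
    then have "v = - v" using T(3) by simp
    have "v $ i = 0" if "i < m" for i
    proof -
      have "v $ i = (- v) $ i" using \<open>v = - v\<close> by simp
      then show ?thesis using v(1) that by simp
    qed
    then have "v = 0\<^sub>v m" using v(1) by (intro eq_vecI) auto
    then show False using v(2) by simp
  qed
  then obtain a' b' where a'b': "a' \<in> T" "b' \<in> S" "b' \<notin> T" using ab by blast
  have swap: "sign_pattern (eps S) S (insert j (T - {i}))" if ij: "i \<in> T" "j \<in> S - T" for i j
  proof (rule sign_vec_act[OF _ T(2)])
    have ij': "i \<in> S" "j \<in> S" "i \<noteq> j" using ij T(1) by auto
    then show "swp S i j \<in> carrier A" by (simp add: elementary_closed)
    show "insert j (T - {i}) \<subseteq> S" using ij T(1) by auto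
    fix k assume k: "k \<in> S"
    define k' where "k' = (if k = i then j else if k = j then i else k)"
    have k': "k' \<in> S" using k ij' by (simp add: k'_def)
    have "act (eps S k) (act (swp S i j) v) = act (swp S i j) (act (eps S k') v)"
      using ij' k k' v(1) by (intro act_relation) (simp_all add: elementary_closed swp_eps_transpose k'_def)
    also have "\<dots> = (if k' \<in> T then -1 else 1) \<cdot>\<^sub>v act (swp S i j) v"
      using v(3)[OF k'] v(1) ij' by (simp add: act_smult elementary_closed)
    also have "(k' \<in> T) = (k \<in> insert j (T - {i}))" using ij k by (auto simp: k'_def)
    finally show "act (eps S k) (act (swp S i j) v) =
      (if k \<in> insert j (T - {i}) then -1 else 1) \<cdot>\<^sub>v act (swp S i j) v" .
  qed
  have "card S \<le> card {T. sign_pattern (eps S) S T}"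
    using T a'b' swap
    by (intro card_transposition_orbit[OF S(1) T(1) _ a'b' finite_patterns[OF S(1)]]) (auto simp: sign_pattern_def)
  also have "\<dots> \<le> m"
    using S(1) by (intro card_sign_patterns[of S "eps S"]) (auto simp: elementary_closed)
  finally show False using S(3) by simp
qed

lemma act_eps_eq: "i \<in> S \<Longrightarrow> j \<in> S \<Longrightarrow> act (eps S i) v = act (eps S j) v"
  by (simp add: act_def rep_eps_eq[of i j])

text \<open>An inversion at a third index commutes with the transvection in the group, and all
  inversions act alike.\<close>

lemma act_lam_eps_commute:
  assumes "i \<in> S" "j \<in> S" "k \<in> S" "i \<noteq> j" "v \<in> V"
  shows "act (lam S i j) (act (eps S k) v) = act (eps S k) (act (lam S i j) v)"
proof -
  obtain l where l: "l \<in> S" "l \<noteq> i" "l \<noteq> j" using exists_third assms by blast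
  have "act (lam S i j) (act (eps S l) v) = act (eps S l) (act (lam S i j) v)"
    using assms l by (intro act_relation[OF lam_eps_commute]) (auto simp: elementary_closed)
  then show ?thesis using act_eps_eq[OF l(1) assms(3)] by simp
qed

text \<open>Once the inversion can be moved past the transvection, \<open>lam_eps_lam\<close> says
  that the square of the transvection acts trivially.\<close>

lemma act_lam_lam:
  assumes ij: "i \<in> S" "j \<in> S" "i \<noteq> j" and v: "v \<in> V"
  shows "act (lam S i j) (act (lam S i j) v) = v"
proof -
  have lv: "act (lam S i j) v \<in> V" "act (lam S i j) (act (lam S i j) v) \<in> V"
    using ij v by (simp_all add: act_closed elementary_closed)
  have "act (eps S j) v = act (lam S i j) (act (eps S j) (act (lam S i j) v))"
    using arg_cong[OF lam_eps_lam[OF ij], of "\<lambda>g. act g v"] ij v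
    by (simp add: act_mult elementary_closed act_closed)
  also have "\<dots> = act (eps S j) (act (lam S i j) (act (lam S i j) v))"
    using ij lv by (simp add: act_lam_eps_commute)
  finally have "act (eps S j) (act (eps S j) v) =
      act (eps S j) (act (eps S j) (act (lam S i j) (act (lam S i j) v)))" by simp
  then show ?thesis using ij v lv by (simp add: act_eps_eps)
qed

text \<open>The conjugate of \<open>lam S i j\<close> by \<open>eps S i\<close> acts like
  \<open>lam S i j\<close> itself, and it commutes with \<open>lam S i k\<close> by
  \<open>lam_rho_commute\<close>.\<close>

lemma act_lam_commute:
  assumes ij: "i \<in> S" "j \<in> S" "i \<noteq> j" and k: "k \<in> S" "i \<noteq> k" and v: "v \<in> V"
  shows "act (lam S i j) (act (lam S i k) v) = act (lam S i k) (act (lam S i j) v)"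
proof -
  have conj: "act (eps S i \<otimes>\<^bsub>A\<^esub> lam S i j \<otimes>\<^bsub>A\<^esub> eps S i) w = act (lam S i j) w" if "w \<in> V" for w
    using ij that by (simp add: act_mult elementary_closed act_closed act_lam_eps_commute act_eps_eps)
  have "act (eps S i \<otimes>\<^bsub>A\<^esub> lam S i j \<otimes>\<^bsub>A\<^esub> eps S i) (act (lam S i k) v) =
      act (lam S i k) (act (eps S i \<otimes>\<^bsub>A\<^esub> lam S i j \<otimes>\<^bsub>A\<^esub> eps S i) v)"
    using ij k v by (intro act_relation[OF lam_rho_commute]) (simp_all add: elementary_closed)
  then show ?thesis using ij k v by (simp add: conj act_closed elementary_closed)
qed

theorem rep_lam_trivial:
  assumes ia: "i \<in> S" "a \<in> S" "i \<noteq> a"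
  shows "r (lam S i a) = 1\<^sub>m m"
proof (rule ccontr)
  assume ne: "r (lam S i a) \<noteq> 1\<^sub>m m"
  define J where "J = S - {i}"
  have J: "finite J" "card J = card S - 1" using S ia by (auto simp: J_def)
  have Jc: "lam S i j \<in> carrier A" if "j \<in> J" for j using that ia by (auto simp: J_def elementary_closed)
  have aJ: "a \<in> J" using ia by (simp add: J_def)
  obtain T v where T: "T \<subseteq> J" "sign_vec (lam S i) J T v" "act (lam S i a) v = - v"
    using exists_sign_vec[OF J(1), of "lam S i", OF Jc Jc[OF aJ] ne] ia
    by (auto simp: J_def act_lam_lam act_lam_commute)
  have "v \<noteq> act (lam S i a) v"
  proof
    assume "v = act (lam S i a) v"
    then have eq: "v = - v" using T(3) by simp
    have v: "v \<in> V" "v \<noteq> 0\<^sub>v m" using T(2) by (auto simp: sign_vec_def)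
    have "v $ i = 0" if "i < m" for i
    proof -
      have "v $ i = (- v) $ i" using eq by simp
      then show ?thesis using v(1) that by simp
    qed
    then have "v = 0\<^sub>v m" using v(1) by (intro eq_vecI) auto
    then show False using v(2) by simp
  qed
  then have "a \<in> T" using T(2) aJ by (auto simp: sign_vec_def)
  then have T0: "T \<noteq> {}" by blast
  \<comment> \<open>Apply \<open>lam_braid\<close> to v and put w = \<open>lam S j k\<close> v. As k
    is in T, \<open>lam S i k\<close> acts on w by -1; hence the sign of \<open>lam S i j\<close>
    changes, while all others are kept.\<close>
  have flip: "sign_pattern (lam S i) J (if j \<in> T then T - {j} else insert j T)"
    if T: "T \<subseteq> J" "sign_pattern (lam S i) J T" and k: "k \<in> T" and j: "j \<in> J" "j \<noteq> k" for T k j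
  proof -
    obtain v where sv: "sign_vec (lam S i) J T v" using T(2) by (auto simp: sign_pattern_def)
    then have v: "v \<in> V" "\<And>l. l \<in> J \<Longrightarrow> act (lam S i l) v = (if l \<in> T then -1 else 1) \<cdot>\<^sub>v v"
      by (auto simp: sign_vec_def)
    have ijk: "i \<in> S" "j \<in> S" "k \<in> S" "i \<noteq> j" "j \<noteq> k" "i \<noteq> k" "k \<in> J" using k j T(1) ia by (auto simp: J_def)
    let ?w = "act (lam S j k) v"
    have jk: "lam S j k \<in> carrier A" using ijk by (simp add: elementary_closed)
    have w: "?w \<in> V" using jk v by (simp add: act_closed)
    have other: "act (lam S i l) ?w = (if l \<in> T then -1 else 1) \<cdot>\<^sub>v ?w" if l: "l \<in> J" "l \<noteq> j" for l
    proof -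
      have "act (lam S j k) (act (lam S i l) v) = act (lam S i l) ?w"
        using l ijk v by (intro act_relation[OF lam_commute]) (auto simp: J_def elementary_closed)
      then show ?thesis using v(2)[OF l(1)] jk v(1) by (simp add: act_smult)
    qed
    have "act (lam S j k) (act (lam S i j) v) = act (lam S i j \<otimes>\<^bsub>A\<^esub> lam S i k) ?w"
      using ijk v by (intro act_relation[OF lam_braid]) (auto simp: elementary_closed)
    also have "\<dots> = act (lam S i j) (act (lam S i k) ?w)"
      using ijk w by (simp add: act_mult elementary_closed)
    also have "\<dots> = (-1) \<cdot>\<^sub>v act (lam S i j) ?w"
      using other[OF ijk(7)] ijk k w by (simp add: act_smult elementary_closed)
    finally have "(-1) \<cdot>\<^sub>v act (lam S i j) ?w = (if j \<in> T then -1 else 1) \<cdot>\<^sub>v ?w"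
      using v(2)[OF j(1)] v(1) jk by (simp add: act_smult)
    then have "(-1) \<cdot>\<^sub>v ((-1) \<cdot>\<^sub>v act (lam S i j) ?w) = (-1) \<cdot>\<^sub>v ((if j \<in> T then -1 else 1) \<cdot>\<^sub>v ?w)"
      by (rule arg_cong)
    then have jw: "act (lam S i j) ?w = (if j \<in> T then 1 else -1) \<cdot>\<^sub>v ?w"
      by (simp add: smult_smult_assoc split: if_splits)
    show ?thesis
    proof (rule sign_vec_act[OF jk sv])
      fix l assume l: "l \<in> J"
      show "act (lam S i l) ?w = (if l \<in> (if j \<in> T then T - {j} else insert j T) then -1 else 1) \<cdot>\<^sub>v ?w"
        using other[OF l] jw by (cases "l = j") (auto split: if_splits)
    qed (use T j in auto)
  qed
  have "card J < card {T. sign_pattern (lam S i) J T}"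
    using flip T T0 S(2) J
    by (intro card_flip_orbit[OF J(1) _ finite_patterns[OF J(1)] T(1)]) (auto simp: sign_pattern_def)
  also have "\<dots> \<le> m"
    using J Jc by (intro card_sign_patterns[of J "lam S i"]) auto
  finally show False using S(3) J(2) by linarith
qed

end

section \<open>From trivial transvections to the three targets\<close>

text \<open>Once the transvections die, all the inversions \<open>eps S i\<close> have the same image.\<close>

lemma hom_image_card:
  assumes H: "group H" and h: "h \<in> hom (AutoGroup (free_group S)) H"
    and S: "finite S" "S \<noteq> {}"
    and lam: "\<And>i j. i \<in> S \<Longrightarrow> j \<in> S \<Longrightarrow> i \<noteq> j \<Longrightarrow> h (lam S i j) = \<one>\<^bsub>H\<^esub>"
  shows "trivial_hom (AutoGroup (free_group S)) H h \<or> card (h ` carrier (AutoGroup (free_group S))) = 2"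
proof -
  let ?A = "AutoGroup (free_group S)"
  interpret A: group ?A by (rule group.AutoGroup[OF group_free_group])
  interpret H: group H by (rule H)
  interpret h: group_hom ?A H h using h by unfold_locales
  obtain s where s: "s \<in> S" using S by blast
  define e where "e = h (eps S s)"
  have e: "e \<in> carrier H" using s by (simp add: e_def elementary_closed)
  have eps2: "h (eps S i) \<otimes>\<^bsub>H\<^esub> h (eps S i) = \<one>\<^bsub>H\<^esub>" if "i \<in> S" for i
    using arg_cong[OF eps_square[OF that], of h] that by (simp add: elementary_closed)
  have lam_inv: "h (lam_inv S i j) = \<one>\<^bsub>H\<^esub>" if "i \<in> S" "j \<in> S" "i \<noteq> j" for i j
    using that lam[OF that] by (simp add: elementary_closed flip: inv_lam)
  have swp: "h (swp S i j) = h (eps S j)" if "i \<in> S" "j \<in> S" "i \<noteq> j" for i j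
  proof -
    \<comment> \<open>The transvections in \<open>swp_eq\<close> disappear, which leaves two
      cancelling factors and \<open>eps S j\<close>.\<close>
    have "h (swp S i j) = h (eps S i) \<otimes>\<^bsub>H\<^esub> h (eps S i) \<otimes>\<^bsub>H\<^esub> h (eps S j)"
      using that lam[of i j] lam_inv[of i j] lam_inv[of j i]
      by (subst swp_eq[OF that]) (simp add: elementary_closed)
    then show ?thesis using that by (simp add: eps2 elementary_closed)
  qed
  \<comment> \<open>\<open>swp\<close> is symmetric in its indices, so the previous identity, read
    both ways, equates the images of two inversions.\<close>
  have eps: "h (eps S i) = e" if "i \<in> S" for i
    using swp[of i s] swp[of s i] that s by (cases "i = s") (auto simp: e_def swp_commute[of S i s])
  define N where "N = {a \<in> carrier ?A. h a \<in> {\<one>\<^bsub>H\<^esub>, e}}"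
  have ee: "e \<otimes>\<^bsub>H\<^esub> e = \<one>\<^bsub>H\<^esub>" using eps2[OF s] by (simp add: e_def)
  have ie: "inv\<^bsub>H\<^esub> e = e" using H.inv_equality[OF ee e e] .
  have clos: "inv\<^bsub>H\<^esub> x \<in> {\<one>\<^bsub>H\<^esub>, e}" "x \<otimes>\<^bsub>H\<^esub> y \<in> {\<one>\<^bsub>H\<^esub>, e}"
    if "x \<in> {\<one>\<^bsub>H\<^esub>, e}" "y \<in> {\<one>\<^bsub>H\<^esub>, e}" for x y
    using that ee ie e by auto
  have "subgroup N ?A"
  proof (rule A.subgroupI)
    have "\<one>\<^bsub>?A\<^esub> \<in> N" using h.hom_one by (simp add: N_def)
    then show "N \<noteq> {}" by blast
  next
    fix a assume "a \<in> N"
    then show "inv\<^bsub>?A\<^esub> a \<in> N" using clos(1)[of "h a" "h a"] by (simp add: N_def del: insert_iff)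
  next
    fix a b assume "a \<in> N" "b \<in> N"
    then show "a \<otimes>\<^bsub>?A\<^esub> b \<in> N" using clos(2)[of "h a" "h b"] by (simp add: N_def del: insert_iff)
  qed (auto simp: N_def)
  then have "carrier ?A \<subseteq> N"
    by (rule nielsen_generation[OF S(1)]) (auto simp: N_def elementary_closed lam eps)
  then have im: "h ` carrier ?A \<subseteq> {\<one>\<^bsub>H\<^esub>, e}" by (auto simp: N_def)
  show ?thesis
  proof (cases "e = \<one>\<^bsub>H\<^esub>")
    case True
    then show ?thesis using im by (auto simp: trivial_hom_def)
  next
    case False
    have "\<one>\<^bsub>H\<^esub> \<in> h ` carrier ?A" using h.hom_one A.one_closed by (metis imageI)
    moreover have "e \<in> h ` carrier ?A" using s by (auto simp: e_def elementary_closed)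
    ultimately have "h ` carrier ?A = {\<one>\<^bsub>H\<^esub>, e}" using im by blast
    then show ?thesis using False by simp
  qed
qed

theorem theoremA:
  fixes n m :: nat
  assumes "n \<ge> 3" and "0 < m" and "m < n"
  shows
    "(\<forall>h \<in> hom (AutoGroup (free_group_rank n)) (AutoGroup (free_group_rank m)).
        trivial_hom (AutoGroup (free_group_rank n)) (AutoGroup (free_group_rank m)) h \<or>
        card (h ` carrier (AutoGroup (free_group_rank n))) = 2) \<and>
     (\<forall>h \<in> hom (AutoGroup (free_group_rank n)) (OutGroup (free_group_rank m)).
        trivial_hom (AutoGroup (free_group_rank n)) (OutGroup (free_group_rank m)) h \<or>
        card (h ` carrier (AutoGroup (free_group_rank n))) = 2) \<and>
     (\<forall>h \<in> hom (AutoGroup (free_group_rank n)) (GL_int m).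
        trivial_hom (AutoGroup (free_group_rank n)) (GL_int m) h \<or>
        card (h ` carrier (AutoGroup (free_group_rank n))) = 2)"
proof -
  let ?S = "{..<n}"
  let ?A = "AutoGroup (free_group_rank n)"
  interpret Fm: group "free_group_rank m" by (rule group_free_group)
  have A: "group ?A" by (rule group.AutoGroup[OF group_free_group])
  interpret A: group ?A by (rule A)
  \<comment> \<open>Inverse transvections are included so that every member is a commutator of
    members.\<close>
  define L where "L = {lam ?S i j |i j. i < n \<and> j < n \<and> i \<noteq> j} \<union> {lam_inv ?S i j |i j. i < n \<and> j < n \<and> i \<noteq> j}"
  have Lc: "L \<subseteq> carrier ?A" by (auto simp: L_def elementary_closed)
  have L: "\<exists>a\<in>L. \<exists>b\<in>L. l = a \<otimes>\<^bsub>?A\<^esub> b \<otimes>\<^bsub>?A\<^esub> inv\<^bsub>?A\<^esub> a \<otimes>\<^bsub>?A\<^esub> inv\<^bsub>?A\<^esub> b" if l: "l \<in> L" for l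
  proof -
    obtain i k where ik: "i < n" "k < n" "i \<noteq> k" and lk: "l = lam ?S i k \<or> l = lam_inv ?S i k"
      using l by (auto simp: L_def)
    have "\<not> {..<n} \<subseteq> {i, k}"
      using card_mono[of "{i, k}" "{..<n}"] assms(1) by (auto simp: card_insert_if split: if_splits)
    then obtain j where j: "j < n" "j \<noteq> i" "j \<noteq> k" by blast
    have "lam_inv ?S i j \<in> L" "lam ?S j k \<in> L" using ik j by (auto simp: L_def)
    then show ?thesis using lk lam_commutator[of i ?S j k] ik j by auto
  qed
  have GL: "f ` L \<subseteq> {1\<^sub>m m}" if f: "f \<in> hom ?A (GL_int m)" for f
  proof -
    interpret f: group_hom ?A "GL_int m" f
      using f A group_GL_int by (simp add: group_hom_def group_hom_axioms_def)
    interpret aut_rep ?S m f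
      by unfold_locales (use f assms in auto)
    have one: "\<one>\<^bsub>GL_int m\<^esub> = 1\<^sub>m m" by (simp add: units_of_one ring_mat_simps)
    have lam: "f (lam ?S i j) = 1\<^sub>m m" if "i < n" "j < n" "i \<noteq> j" for i j
      using that rep_lam_trivial by simp
    moreover have "f (lam_inv ?S i j) = 1\<^sub>m m" if "i < n" "j < n" "i \<noteq> j" for i j
    proof -
      have "f (lam_inv ?S i j) = inv\<^bsub>GL_int m\<^esub> f (lam ?S i j)"
        using that f.hom_inv[of "lam ?S i j"] by (simp add: elementary_closed inv_lam)
      also have "\<dots> = 1\<^sub>m m" using lam[OF that] f.H.inv_one by (simp only: one[symmetric])
      finally show ?thesis .
    qed
    ultimately show ?thesis by (auto simp: L_def)
  qed
  have conclude: "trivial_hom ?A H h \<or> card (h ` carrier ?A) = 2"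
    if "group H" "h \<in> hom ?A H" "h ` L \<subseteq> {\<one>\<^bsub>H\<^esub>}" for H :: "('b, 'c) monoid_scheme" and h
  proof (rule hom_image_card[OF that(1,2)])
    show "?S \<noteq> {}" using assms(1) by (auto simp: lessThan_empty_iff)
    fix i j assume "i \<in> ?S" "j \<in> ?S" "i \<noteq> j"
    then have "lam ?S i j \<in> L" by (auto simp: L_def)
    then show "h (lam ?S i j) = \<one>\<^bsub>H\<^esub>" using that(3) by blast
  qed simp
  have "trivial_hom ?A (AutoGroup (free_group_rank m)) h \<or> card (h ` carrier ?A) = 2"
    if "h \<in> hom ?A (AutoGroup (free_group_rank m))" for h
    by (rule conclude[OF Fm.AutoGroup that perfect_hom_Aut_trivial[OF A that Lc L GL]])
  moreover have "trivial_hom ?A (OutGroup (free_group_rank m)) h \<or> card (h ` carrier ?A) = 2"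
    if "h \<in> hom ?A (OutGroup (free_group_rank m))" for h
    by (rule conclude[OF Fm.group_OutGroup that perfect_hom_Out_trivial[OF A that Lc L GL]])
  moreover have "trivial_hom ?A (GL_int m) h \<or> card (h ` carrier ?A) = 2"
    if "h \<in> hom ?A (GL_int m)" for h
    using GL[OF that] by (intro conclude[OF group_GL_int that]) (simp add: units_of_one ring_mat_simps)
  ultimately show ?thesis by blast
qed

end
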